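(* Let $g\ge 0$ and $n\ge 0$ be integers with $g\equiv n \pmod 2$ and $3n\le g+2$, and let $P_{g,n}\subset\mathbb{R}^2$ be the lattice polygon with vertices $(0,0)$, $(0,\tfrac{g+3n+2}{2})$, $(3,\tfrac{g-3n+2}{2})$, $(3,0)$. Let $\Gamma$ be an abstract tropical curve which can be embedded smoothly into $\mathbb{R}^2$ in the sense that (a tropical modification $\Gamma'$ of) $\Gamma$ is a smooth plane tropical curve dual to a unimodular triangulation of $P_{g,n}$ (a smooth plane tropical curve in $\mathbb{F}_n$). Then the projection $\mathbb{R}^2\to\mathbb{R}$, $(x,y)\mapsto y$ (the tropicalization of the ruling $\mathbb{F}_n\to\mathbb{P}^1$), restricted to this embedded curve is a realizable well-contracted tropical cover of degree $3$ of $\mathbb{R}$.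
   Context: **Abstract and plane tropical curves.** An abstract tropical curve is a connected metric graph $\Gamma$, possibly with unbounded ends, with a genus function $\Gamma\to\mathbb{N}$ nonzero at finitely many points. Its canonical model is obtained by shrinking all ends and then, iteratively, all leaf edges (and using the smallest vertex set). Two metric graphs are tropically equivalent if they have the same canonical model; a tropical modification of $\Gamma$ is a metric graph tropically equivalent to $\Gamma$ obtained by gluing trees (possibly with unbounded edges) at some points. A plane tropical curve is the tropical vanishing locus in $\mathbb{R}^2$ of a tropical polynomial; it is dual to a regular subdivision of the Newton polygon, and it is smooth if this subdivision is a unimodular triangulation (all triangles have area $1/2$). In a smooth plane tropical curve, the length of an edge is its Euclidean length divided by the Euclidean norm of its primitive integer direction vector. **Morphisms and covers.** A model of a metric graph is a pair $(G,l)$, a graph with edge lengths; models may be refined by adding 2-valent vertices. A continuous map $\varphi:\Gamma_1\to\Gamma_2$ of metric graphs is a morphism if for suitable models $(G_1,l_1),(G_2,l_2)$ one has $\varphi(V(G_1))\subset V(G_2)$, $\varphi^{-1}(E(G_2))\subset E(G_1)$, and for each $e\in E(G_1)$ the number $\mu_\varphi(e)$, defined as $l_2(\varphi(e))/l_1(e)$ if $\varphi(e)$ is an edge and as $0$ if $\varphi(e)$ is a vertex ($e$ is contracted), is a nonnegative integer, positive in the first case (for unbounded edges $\mu_\varphi(e)$ is the slope of $\varphi$ along $e$). It is non-degenerate if every vertex $v$ has an incident edge $e$ with $\mu_\varphi(e)>0$ and no loop is contracted. It is harmonic if for each vertex $v$ the number $m_\varphi(v)=\sum_{e\ni v,\ \varphi(e)=e'}\mu_\varphi(e)$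 does not depend on the edge $e'$ at $\varphi(v)$; its degree is $\sum_{\varphi(e)=e'}\mu_\varphi(e)$, independent of the edge $e'$ of the target. A tropical cover of degree $d$ is a harmonic morphism of degree $d$ such that for every vertex $v$ whose image has valence at least $2$, $(2m_\varphi(v)-2)-\sum_{e\ni v}(\mu_\varphi(e)-1)\ge 0$, where the sum runs over all outgoing edges at $v$, contracted ones included. A path is a metric tree homeomorphic to an interval (e.g. $\mathbb{R}$). A well-contracted cover is a non-degenerate tropical cover whose target is a path. **Realizable.** A tropical cover is realizable if all its local Hurwitz numbers are nonzero; the local Hurwitz number at $v$ counts connected covers of $\mathbb{P}^1$ of degree $m_\varphi(v)$ by a curve of genus the genus of $v$, with ramification profiles over the points corresponding to the edges at $\varphi(v)$ given by the weights $\mu_\varphi(e)>0$ and with the remaining ramification simple. It is a known fact that every tropical cover of degree at most $3$ is realizable. *)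

theory Defs
  imports "HOL-Complex_Analysis.Complex_Analysis" "HOL-Homology.Homology"
    "HOL-Algebra.Free_Abelian_Groups" "HOL-Library.Multiset"
begin

section \<open>Metric graphs\<close>

text \<open>
  A model of a metric graph is given on the points of the metric graph themselves: the vertices are
  points, and a bounded edge of length \<open>l\<close> is parametrised at unit speed by \<open>{0..l}\<close>, an unbounded
  one by \<open>{0..}\<close>. The parametrisation is irrelevant elsewhere. An unbounded edge has exactly one
  end vertex, the point with parameter \<open>0\<close>; there are no vertices at infinity.
\<close>

datatype 'a edge = Edge (len: ereal) (par: "real \<Rightarrow> 'a")

record 'a mgraph =
  verts :: "'a set"
  edges :: "'a edge set"
  genus :: "'a \<Rightarrow> nat"

definition edge_dom :: "'a edge \<Rightarrow> real set" where
  "edge_dom e = {t. 0 \<le> t \<and> ereal t \<le> len e}"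

definition cell :: "'a edge \<Rightarrow> 'a set" where
  "cell e = par e ` {t. 0 < t \<and> ereal t < len e}"

definition points :: "'a mgraph \<Rightarrow> 'a set" where
  "points G = verts G \<union> (\<Union>e\<in>edges G. cell e)"

definition metric_graph :: "'a mgraph \<Rightarrow> bool" where
  "metric_graph G \<longleftrightarrow>
     finite (verts G) \<and> verts G \<noteq> {} \<and> finite (edges G) \<and>
     (\<forall>e\<in>edges G. 0 < len e \<and> inj_on (par e) {t. 0 < t \<and> ereal t < len e} \<and>
        cell e \<inter> verts G = {} \<and> par e 0 \<in> verts G \<and>
        (len e < \<infinity> \<longrightarrow> par e (real_of_ereal (len e)) \<in> verts G)) \<and>
     (\<forall>e\<in>edges G. \<forall>e'\<in>edges G. e \<noteq> e' \<longrightarrow> cell e \<inter> cell e' = {}) \<and>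
     (\<forall>x. genus G x > 0 \<longrightarrow> x \<in> verts G)"

definition graph_topology :: "'a mgraph \<Rightarrow> 'a topology" where
  "graph_topology G = topology (\<lambda>U. U \<subseteq> points G \<and>
     (\<forall>e\<in>edges G. openin (top_of_set (edge_dom e)) {t \<in> edge_dom e. par e t \<in> U}))"

lemma openin_graph_topology:
  "openin (graph_topology G) U \<longleftrightarrow> U \<subseteq> points G \<and>
     (\<forall>e\<in>edges G. openin (top_of_set (edge_dom e)) {t \<in> edge_dom e. par e t \<in> U})"
proof -
  have "istopology (\<lambda>U. U \<subseteq> points G \<and>
     (\<forall>e\<in>edges G. openin (top_of_set (edge_dom e)) {t \<in> edge_dom e. par e t \<in> U}))"
    unfolding istopology_def
  proof (intro conjI allI impI)
    fix S T
    assume S: "S \<subseteq> points G \<and>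
        (\<forall>e\<in>edges G. openin (top_of_set (edge_dom e)) {t \<in> edge_dom e. par e t \<in> S})"
      and T: "T \<subseteq> points G \<and>
        (\<forall>e\<in>edges G. openin (top_of_set (edge_dom e)) {t \<in> edge_dom e. par e t \<in> T})"
    show "S \<inter> T \<subseteq> points G" using S by blast
    show "\<forall>e\<in>edges G. openin (top_of_set (edge_dom e)) {t \<in> edge_dom e. par e t \<in> S \<inter> T}"
    proof
      fix e assume "e \<in> edges G"
      with S T have "openin (top_of_set (edge_dom e))
          ({t \<in> edge_dom e. par e t \<in> S} \<inter> {t \<in> edge_dom e. par e t \<in> T})"
        by (intro openin_Int) auto
      moreover have "{t \<in> edge_dom e. par e t \<in> S} \<inter> {t \<in> edge_dom e. par e t \<in> T}
          = {t \<in> edge_dom e. par e t \<in> S \<inter> T}" by blast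
      ultimately show "openin (top_of_set (edge_dom e)) {t \<in> edge_dom e. par e t \<in> S \<inter> T}"
        by simp
    qed
  next
    fix K
    assume K: "\<forall>S\<in>K. S \<subseteq> points G \<and>
        (\<forall>e\<in>edges G. openin (top_of_set (edge_dom e)) {t \<in> edge_dom e. par e t \<in> S})"
    show "\<Union>K \<subseteq> points G" using K by blast
    show "\<forall>e\<in>edges G. openin (top_of_set (edge_dom e)) {t \<in> edge_dom e. par e t \<in> \<Union>K}"
    proof
      fix e assume e: "e \<in> edges G"
      have "openin (top_of_set (edge_dom e)) (\<Union>S\<in>K. {t \<in> edge_dom e. par e t \<in> S})"
        using K e by (intro openin_Union) auto
      moreover have "(\<Union>S\<in>K. {t \<in> edge_dom e. par e t \<in> S}) = {t \<in> edge_dom e. par e t \<in> \<Union>K}"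
        by blast
      ultimately show "openin (top_of_set (edge_dom e)) {t \<in> edge_dom e. par e t \<in> \<Union>K}"
        by simp
    qed
  qed
  then show ?thesis by (simp add: graph_topology_def topology_inverse')
qed

definition abstract_tropical_curve :: "'a mgraph \<Rightarrow> bool" where
  "abstract_tropical_curve G \<longleftrightarrow> metric_graph G \<and> connected_space (graph_topology G)"

text \<open>
  Directions: \<open>(e, True)\<close> is \<open>e\<close> traversed from parameter \<open>0\<close>, \<open>(e, False)\<close> is \<open>e\<close> traversed from the
  other end, which exists only for bounded \<open>e\<close>. A loop contributes two directions at its vertex.
\<close>

definition dedges :: "'a mgraph \<Rightarrow> ('a edge \<times> bool) set" where
  "dedges G = {(e, b). e \<in> edges G \<and> (b \<or> len e < \<infinity>)}"

fun dpar :: "'a edge \<times> bool \<Rightarrow> real \<Rightarrow> 'a" where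
  "dpar (e, True) t = par e t"
| "dpar (e, False) t = par e (real_of_ereal (len e) - t)"

definition outgoing :: "'a mgraph \<Rightarrow> 'a \<Rightarrow> ('a edge \<times> bool) set" where
  "outgoing G v = {d \<in> dedges G. dpar d 0 = v}"

text \<open>Subdivision by 2-valent vertices.\<close>

definition refines :: "'a mgraph \<Rightarrow> 'a mgraph \<Rightarrow> bool" where
  "refines K G \<longleftrightarrow> metric_graph K \<and> metric_graph G \<and>
     points K = points G \<and> verts G \<subseteq> verts K \<and> genus K = genus G \<and>
     (\<forall>e\<in>edges K. \<exists>e'\<in>edges G. \<exists>a::real. \<exists>\<sigma>\<in>{1, -1}. \<forall>t\<in>edge_dom e.
        a + \<sigma> * t \<in> edge_dom e' \<and> par e t = par e' (a + \<sigma> * t))"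

text \<open>\<open>G\<close> and \<open>H\<close> are models of one and the same metric graph.\<close>

definition same_metric_graph :: "'a mgraph \<Rightarrow> 'a mgraph \<Rightarrow> bool" where
  "same_metric_graph G H \<longleftrightarrow> (\<exists>K. refines K G \<and> refines K H)"

text \<open>\<open>f\<close> maps the closed edge of \<open>d\<close> onto that of \<open>d'\<close>, along the directions, with slope \<open>k\<close>.\<close>

definition dilates :: "('a \<Rightarrow> 'b) \<Rightarrow> nat \<Rightarrow> 'a edge \<times> bool \<Rightarrow> 'b edge \<times> bool \<Rightarrow> bool" where
  "dilates f k d d' \<longleftrightarrow> len (fst d') = ereal (real k) * len (fst d) \<and>
     (\<forall>t\<in>edge_dom (fst d). f (dpar d t) = dpar d' (real k * t))"

section \<open>Tropical equivalence and tropical modifications\<close>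

definition model_iso :: "'a mgraph \<Rightarrow> 'b mgraph \<Rightarrow> bool" where
  "model_iso G H \<longleftrightarrow> (\<exists>h. bij_betw h (points G) (points H) \<and> h ` verts G = verts H \<and>
     (\<forall>e\<in>edges G. \<exists>d\<in>dedges H. dilates h 1 (e, True) d) \<and>
     (\<forall>x\<in>points G. genus H (h x) = genus G x))"

definition shrink_ends :: "'a mgraph \<Rightarrow> 'a mgraph" where
  "shrink_ends G = G\<lparr>edges := {e \<in> edges G. len e < \<infinity>}\<rparr>"

text \<open>
  Contracting a leaf edge onto its inner vertex amounts to deleting it together with its leaf.
  As usual, a 1-valent vertex of positive genus is not a leaf.
\<close>

definition shrink_leaf :: "'a mgraph \<Rightarrow> 'a mgraph \<Rightarrow> bool" where
  "shrink_leaf G G' \<longleftrightarrow> (\<exists>v\<in>verts G. \<exists>d. outgoing G v = {d} \<and> len (fst d) < \<infinity> \<and> genus G v = 0 \<and>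
     G' = G\<lparr>verts := verts G - {v}, edges := edges G - {fst d}\<rparr>)"

definition canonical_model :: "'a mgraph \<Rightarrow> 'a mgraph \<Rightarrow> bool" where
  "canonical_model G M \<longleftrightarrow> (\<exists>K. shrink_leaf\<^sup>*\<^sup>* (shrink_ends G) K \<and> (\<nexists>L. shrink_leaf K L) \<and>
     same_metric_graph K M \<and> (\<forall>M'. same_metric_graph K M' \<longrightarrow> card (verts M) \<le> card (verts M')))"

definition tropically_equivalent :: "'a mgraph \<Rightarrow> 'b mgraph \<Rightarrow> bool" where
  "tropically_equivalent G H \<longleftrightarrow>
     (\<exists>M N. canonical_model G M \<and> canonical_model H N \<and> model_iso M N)"

text \<open>
  One new edge, an end or a bounded edge with a new leaf, attached at a vertex. Gluing trees
  means gluing their edges one after the other.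
\<close>

definition glue_edge :: "'a mgraph \<Rightarrow> 'a mgraph \<Rightarrow> bool" where
  "glue_edge G G' \<longleftrightarrow> metric_graph G \<and> metric_graph G' \<and> genus G' = genus G \<and>
     (\<exists>e b. e \<notin> edges G \<and> edges G' = insert e (edges G) \<and> dpar (e, b) 0 \<in> verts G \<and>
        (if len e = \<infinity> then b \<and> verts G' = verts G
         else dpar (e, \<not> b) 0 \<notin> points G \<and> verts G' = insert (dpar (e, \<not> b) 0) (verts G)))"

definition obtained_by_gluing_trees :: "'a mgraph \<Rightarrow> 'b mgraph \<Rightarrow> bool" where
  "obtained_by_gluing_trees G G' \<longleftrightarrow>
     (\<exists>M N N'. same_metric_graph G M \<and> model_iso M N \<and> glue_edge\<^sup>*\<^sup>* N N' \<and> same_metric_graph G' N')"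

definition tropical_modification :: "'a mgraph \<Rightarrow> 'b mgraph \<Rightarrow> bool" where
  "tropical_modification G G' \<longleftrightarrow> tropically_equivalent G G' \<and> obtained_by_gluing_trees G G'"

section \<open>Morphisms and tropical covers\<close>

text \<open>
  The following predicates refer to fixed models of the two metric graphs. The morphism is required
  to be linear on each edge, as is implicit in calling \<open>\<mu>(e)\<close>, here \<open>stretch H f e\<close>, its slope.
\<close>

definition contracted :: "'b mgraph \<Rightarrow> ('a \<Rightarrow> 'b) \<Rightarrow> 'a edge \<Rightarrow> bool" where
  "contracted H f e \<longleftrightarrow> (\<exists>w\<in>verts H. \<forall>x\<in>cell e. f x = w)"

definition morphism :: "'a mgraph \<Rightarrow> 'b mgraph \<Rightarrow> ('a \<Rightarrow> 'b) \<Rightarrow> bool" where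
  "morphism G H f \<longleftrightarrow> metric_graph G \<and> metric_graph H \<and>
     continuous_map (graph_topology G) (graph_topology H) f \<and>
     f ` verts G \<subseteq> verts H \<and>
     (\<forall>e'\<in>edges H. \<exists>F\<subseteq>edges G. {x \<in> points G. f x \<in> cell e'} = (\<Union>e\<in>F. cell e)) \<and>
     (\<forall>e\<in>edges G. contracted H f e \<or> (\<exists>k>0. \<exists>d'\<in>dedges H. dilates f k (e, True) d'))"

definition stretch :: "'b mgraph \<Rightarrow> ('a \<Rightarrow> 'b) \<Rightarrow> 'a edge \<Rightarrow> nat" where
  "stretch H f e = (if contracted H f e then 0
     else (THE k. k > 0 \<and> (\<exists>d'\<in>dedges H. dilates f k (e, True) d')))"

definition nondegenerate :: "'a mgraph \<Rightarrow> 'b mgraph \<Rightarrow> ('a \<Rightarrow> 'b) \<Rightarrow> bool" where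
  "nondegenerate G H f \<longleftrightarrow>
     (\<forall>v\<in>verts G. \<exists>d\<in>outgoing G v. stretch H f (fst d) > 0) \<and>
     (\<forall>e\<in>edges G. len e < \<infinity> \<and> par e 0 = par e (real_of_ereal (len e)) \<longrightarrow> \<not> contracted H f e)"

definition outgoing_over ::
    "'a mgraph \<Rightarrow> ('a \<Rightarrow> 'b) \<Rightarrow> 'a \<Rightarrow> 'b edge \<times> bool \<Rightarrow> ('a edge \<times> bool) set" where
  "outgoing_over G f v d' = {d \<in> outgoing G v. \<exists>k>0. dilates f k d d'}"

definition harmonic :: "'a mgraph \<Rightarrow> 'b mgraph \<Rightarrow> ('a \<Rightarrow> 'b) \<Rightarrow> bool" where
  "harmonic G H f \<longleftrightarrow> morphism G H f \<and>
     (\<forall>v\<in>verts G. \<exists>m. \<forall>d'\<in>outgoing H (f v). (\<Sum>d\<in>outgoing_over G f v d'. stretch H f (fst d)) = m)"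

definition local_degree :: "'a mgraph \<Rightarrow> 'b mgraph \<Rightarrow> ('a \<Rightarrow> 'b) \<Rightarrow> 'a \<Rightarrow> nat" where
  "local_degree G H f v =
     (THE m. \<forall>d'\<in>outgoing H (f v). (\<Sum>d\<in>outgoing_over G f v d'. stretch H f (fst d)) = m)"

definition has_degree :: "'a mgraph \<Rightarrow> 'b mgraph \<Rightarrow> ('a \<Rightarrow> 'b) \<Rightarrow> nat \<Rightarrow> bool" where
  "has_degree G H f d \<longleftrightarrow>
     (\<forall>e'\<in>edges H. (\<Sum>e | e \<in> edges G \<and> f ` cell e = cell e'. stretch H f e) = d)"

definition tropical_cover :: "nat \<Rightarrow> 'a mgraph \<Rightarrow> 'b mgraph \<Rightarrow> ('a \<Rightarrow> 'b) \<Rightarrow> bool" where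
  "tropical_cover d G H f \<longleftrightarrow> harmonic G H f \<and> has_degree G H f d \<and>
     (\<forall>v\<in>verts G. card (outgoing H (f v)) \<ge> 2 \<longrightarrow>
        (2 * int (local_degree G H f v) - 2)
          - (\<Sum>\<delta>\<in>outgoing G v. int (stretch H f (fst \<delta>)) - 1) \<ge> 0)"

definition is_path :: "'b mgraph \<Rightarrow> bool" where
  "is_path H \<longleftrightarrow> (\<exists>I::real set. is_interval I \<and> interior I \<noteq> {} \<and>
     graph_topology H homeomorphic_space top_of_set I)"

definition well_contracted_cover :: "nat \<Rightarrow> 'a mgraph \<Rightarrow> 'b mgraph \<Rightarrow> ('a \<Rightarrow> 'b) \<Rightarrow> bool" where
  "well_contracted_cover d G H f \<longleftrightarrow> tropical_cover d G H f \<and> nondegenerate G H f \<and> is_path H"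

section \<open>Hurwitz numbers\<close>

type_synonym 'a surface = "'a topology \<times> ('a set \<times> ('a \<Rightarrow> complex)) set"

definition compact_riemann_surface :: "'a surface \<Rightarrow> bool" where
  "compact_riemann_surface S \<longleftrightarrow> (case S of (X, \<A>) \<Rightarrow>
     Hausdorff_space X \<and> compact_space X \<and> connected_space X \<and>
     \<Union>(fst ` \<A>) = topspace X \<and>
     (\<forall>(U, \<phi>)\<in>\<A>. openin X U \<and> open (\<phi> ` U) \<and>
        homeomorphic_map (subtopology X U) (top_of_set (\<phi> ` U)) \<phi>) \<and>
     (\<forall>(U, \<phi>)\<in>\<A>. \<forall>(V, \<psi>)\<in>\<A>. (\<psi> \<circ> inv_into U \<phi>) holomorphic_on \<phi> ` (U \<inter> V)))"

text \<open>The genus is half the first Betti number.\<close>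

definition surface_genus :: "'a surface \<Rightarrow> nat \<Rightarrow> bool" where
  "surface_genus S h \<longleftrightarrow> homology_group 1 (fst S) \<cong> free_Abelian_group {..<2 * h}"

definition holomorphic_map :: "'a surface \<Rightarrow> 'b surface \<Rightarrow> ('a \<Rightarrow> 'b) \<Rightarrow> bool" where
  "holomorphic_map S T f \<longleftrightarrow> continuous_map (fst S) (fst T) f \<and>
     (\<forall>(U, \<phi>)\<in>snd S. \<forall>(V, \<psi>)\<in>snd T.
        (\<psi> \<circ> f \<circ> inv_into U \<phi>) holomorphic_on \<phi> ` {x \<in> U. f x \<in> V})"

text \<open>The projective line over the complex numbers; \<open>None\<close> is the point at infinity.\<close>

definition P1 :: "complex option surface" where
  "P1 = (Alexandroff_compactification euclidean,
     {(range Some, the), (UNIV - {Some 0}, case_option 0 inverse)})"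

definition ramification_index :: "'a surface \<Rightarrow> ('a \<Rightarrow> complex option) \<Rightarrow> 'a \<Rightarrow> nat" where
  "ramification_index S f x = (THE k. \<forall>(U, \<phi>)\<in>snd S. \<forall>(V, \<psi>)\<in>snd P1. x \<in> U \<and> f x \<in> V \<longrightarrow>
     zorder (\<lambda>z. \<psi> (f (inv_into U \<phi> z)) - \<psi> (f x)) (\<phi> x) = int k)"

definition ramification_profile ::
    "'a surface \<Rightarrow> ('a \<Rightarrow> complex option) \<Rightarrow> complex option \<Rightarrow> nat multiset" where
  "ramification_profile S f p =
     image_mset (ramification_index S f) (mset_set {x \<in> topspace (fst S). f x = p})"

text \<open>
  Hurwitz numbers do not depend on the position of the branch points, which are fixed to be
  \<open>\<infinity>, 0, 1, 2, \<dots>\<close> in this order.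
\<close>

fun branch_point :: "nat \<Rightarrow> complex option" where
  "branch_point 0 = None"
| "branch_point (Suc i) = Some (of_nat i)"

text \<open>
  Every compact Riemann surface is isomorphic to one whose points form a subset of a fixed type with
  the cardinality of the continuum, and \<^typ>\<open>complex option\<close> is used for this purpose.
\<close>

type_synonym cover = "complex option surface \<times> (complex option \<Rightarrow> complex option)"

definition hurwitz_covers :: "nat \<Rightarrow> nat \<Rightarrow> nat multiset list \<Rightarrow> cover set" where
  "hurwitz_covers h m ps = {(S, f).
     compact_riemann_surface S \<and> surface_genus S h \<and> holomorphic_map S P1 f \<and>
     (\<exists>x\<in>topspace (fst S). \<exists>y\<in>topspace (fst S). f x \<noteq> f y) \<and>
     (\<forall>i<length ps. ramification_profile S f (branch_point i) = ps ! i) \<and>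
     (\<forall>p. p \<notin> branch_point ` {..<length ps} \<longrightarrow>
        ramification_profile S f p = replicate_mset m 1)}"

definition cover_isos :: "cover \<Rightarrow> cover \<Rightarrow> (complex option \<Rightarrow> complex option) set" where
  "cover_isos c c' = {u \<in> extensional (topspace (fst (fst c))).
     holomorphic_map (fst c) (fst c') u \<and>
     (\<exists>u'. holomorphic_map (fst c') (fst c) u' \<and>
        homeomorphic_maps (fst (fst c)) (fst (fst c')) u u') \<and>
     (\<forall>x\<in>topspace (fst (fst c)). snd c' (u x) = snd c x)}"

text \<open>
  Isomorphism classes are counted with weight one over the number of automorphisms. The sum is
  taken in \<^typ>\<open>ennreal\<close>, where every sum exists and the inverse of 0 is \<open>\<infinity>\<close>, so that no
  count becomes 0 for lack of finiteness.
\<close>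

definition hurwitz_number :: "nat \<Rightarrow> nat \<Rightarrow> nat multiset list \<Rightarrow> ennreal" where
  "hurwitz_number h m ps =
     (\<Sum>\<^sub>\<infinity>C\<in>hurwitz_covers h m ps // {(c, c'). c \<in> hurwitz_covers h m ps \<and>
          c' \<in> hurwitz_covers h m ps \<and> cover_isos c c' \<noteq> {}}.
        let c = (SOME c. c \<in> C) in inverse (of_nat (card (cover_isos c c))))"

text \<open>
  By Riemann-Hurwitz the number of remaining, simple branch points is
  \<open>2m - 2 + 2h - \<Sum> (\<mu> - 1)\<close>, where the sum is over the edges with \<open>\<mu> > 0\<close>. If this is
  negative, there are no covers at all and the Hurwitz number without additional branch points is 0
  as well. The list \<open>ds\<close> fixes the order of the edges at the image vertex.
\<close>

definition local_hurwitz_number ::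
    "'a mgraph \<Rightarrow> 'b mgraph \<Rightarrow> ('a \<Rightarrow> 'b) \<Rightarrow> 'a \<Rightarrow> ('b edge \<times> bool) list \<Rightarrow> ennreal" where
  "local_hurwitz_number G H f v ds =
     (let m = local_degree G H f v;
          r = nat (2 * int m - 2 + 2 * int (genus G v)
                - (\<Sum>d | d \<in> outgoing G v \<and> stretch H f (fst d) > 0. int (stretch H f (fst d)) - 1))
      in hurwitz_number (genus G v) m
           (map (\<lambda>d'. image_mset (\<lambda>d. stretch H f (fst d)) (mset_set (outgoing_over G f v d'))) ds
            @ replicate r ({#2#} + replicate_mset (m - 2) 1)))"

definition realizable :: "'a mgraph \<Rightarrow> 'b mgraph \<Rightarrow> ('a \<Rightarrow> 'b) \<Rightarrow> bool" where
  "realizable G H f \<longleftrightarrow> (\<forall>v\<in>verts G. \<forall>ds. distinct ds \<and> set ds = outgoing H (f v) \<longrightarrow>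
     local_hurwitz_number G H f v ds \<noteq> 0)"

section \<open>Plane tropical curves\<close>

text \<open>
  A tropical polynomial is given by the finite set \<open>A\<close> of its exponents and its coefficients \<open>c\<close>
  (max-plus convention).
\<close>

definition lattice_point :: "nat \<times> nat \<Rightarrow> real ^ 2" where
  "lattice_point a = vector [real (fst a), real (snd a)]"

definition trop_term :: "(nat \<times> nat \<Rightarrow> real) \<Rightarrow> real ^ 2 \<Rightarrow> nat \<times> nat \<Rightarrow> real" where
  "trop_term c p a = c a + lattice_point a \<bullet> p"

definition trop_poly :: "(nat \<times> nat) set \<Rightarrow> (nat \<times> nat \<Rightarrow> real) \<Rightarrow> real ^ 2 \<Rightarrow> real" where
  "trop_poly A c p = Max (trop_term c p ` A)"

definition maximal_terms :: "(nat \<times> nat) set \<Rightarrow> (nat \<times> nat \<Rightarrow> real) \<Rightarrow> real ^ 2 \<Rightarrow> (nat \<times> nat) set"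
  where "maximal_terms A c p = {a \<in> A. trop_term c p a = trop_poly A c p}"

definition plane_tropical_curve :: "(nat \<times> nat) set \<Rightarrow> (nat \<times> nat \<Rightarrow> real) \<Rightarrow> (real ^ 2) set" where
  "plane_tropical_curve A c = {p. card (maximal_terms A c p) \<ge> 2}"

definition newton_polygon :: "(nat \<times> nat) set \<Rightarrow> (real ^ 2) set" where
  "newton_polygon A = convex hull (lattice_point ` A)"

text \<open>
  The cells of the dual subdivision are the projections of the upper faces of the lifted polytope
  \<open>conv {(a, c a) | a \<in> A}\<close>: the face on which the functional \<open>(p, 1)\<close> is maximal is the convex
  hull of the lifted exponents of the terms that are maximal at \<open>p\<close>.
\<close>

definition dual_subdivision :: "(nat \<times> nat) set \<Rightarrow> (nat \<times> nat \<Rightarrow> real) \<Rightarrow> (real ^ 2) set set" where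
  "dual_subdivision A c = (\<lambda>p. convex hull (lattice_point ` maximal_terms A c p)) ` UNIV"

definition unimodular_triangulation :: "(real ^ 2) set set \<Rightarrow> bool" where
  "unimodular_triangulation \<Q> \<longleftrightarrow> (\<forall>Q\<in>\<Q>. interior Q \<noteq> {} \<longrightarrow>
     (\<exists>x y z. Q = convex hull {lattice_point x, lattice_point y, lattice_point z}) \<and>
     measure lebesgue Q = 1 / 2)"

text \<open>
  \<open>G\<close> is a model of a smooth plane tropical curve \<open>C\<close> as a metric graph: the edges are straight, and
  parametrising them by multiples of a primitive integer vector gives the lattice length.
\<close>

definition primitive :: "real ^ 2 \<Rightarrow> bool" where
  "primitive u \<longleftrightarrow> (\<exists>a b::int. coprime a b \<and> u = vector [real_of_int a, real_of_int b])"

definition plane_curve_model :: "(real ^ 2) set \<Rightarrow> (real ^ 2) mgraph \<Rightarrow> bool" where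
  "plane_curve_model C G \<longleftrightarrow> metric_graph G \<and> points G = C \<and> genus G = (\<lambda>_. 0) \<and>
     (\<forall>e\<in>edges G. \<exists>p u. primitive u \<and> (\<forall>t\<in>edge_dom e. par e t = p + t *\<^sub>R u))"

definition real_line :: "real mgraph" where
  "real_line = \<lparr>verts = {0}, edges = {Edge \<infinity> (\<lambda>t. t), Edge \<infinity> (\<lambda>t. - t)}, genus = (\<lambda>_. 0)\<rparr>"

definition hirzebruch_polygon :: "nat \<Rightarrow> nat \<Rightarrow> (real ^ 2) set" where
  "hirzebruch_polygon g n = convex hull
     {vector [0, 0], vector [0, (real g + 3 * real n + 2) / 2],
      vector [3, (real g - 3 * real n + 2) / 2], vector [3, 0]}"

end

theory Submission
  imports Defs "HOL-Computational_Algebra.Fundamental_Theorem_Algebra"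
begin

text \<open>
  Restricted to a horizontal line, the tropical polynomial is a convex, piecewise linear function of
  \<open>x\<close> whose slopes are the first coordinates of the maximal exponents. The polygon has width 3, so
  the slope rises from 0 to 3 along the line. The curve meets the line where the slope jumps, hence,
  for a generic line, in three points when each is counted with its jump, and the jump at a point is
  the slope of the projection along the edge through it. This is the degree (\<open>sum_crossings\<close>,
  \<open>has_degree_cover\<close>).

  Locally, unimodularity leaves two possibilities (\<open>curve_cases\<close>): two terms are maximal and the
  curve is a line, or three terms forming a triangle of area 1/2 are maximal and the point is
  trivalent, its outgoing edges being the primitive outer normals of the triangle. These normals add
  up to zero, and their second coordinates are the differences of the first coordinates of the three
  exponents. Up to sign, such differences are \<open>1, -1, 0\<close> or \<open>1, 1, -2\<close> or \<open>1, 2, -3\<close>, because they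
  are at most 3 and two of them are coprime (\<open>heights_cases\<close>). In each case the positive entries
  have the same sum as the absolute values of the negative ones, which is harmonicity; the
  Riemann-Hurwitz inequality is verified by inspection; and the local Hurwitz number is nonzero as
  soon as one cover of the sphere with the required profiles is exhibited. The covers are
  \<open>z ^ m\<close>, \<open>z\<^sup>2 + 1\<close> and \<open>3 z\<^sup>2 - 2 z\<^sup>3\<close>, and the compositions of the last two with inversion.

  A morphism refers to models of both curves. The vertices of the line are 0 and the heights of
  the trivalent points, and the vertices of the curve are the trivalent points together with all points
  at these heights that lie on non-horizontal edges. Horizontal edges are contracted and must not be
  subdivided, since all edges at a new vertex inside them would be contracted, against
  non-degeneracy. That these vertices give a model of the curve as a metric graph, and a common
  refinement with any other model, is proved for every closed set that, off a finite set \<open>S\<close>, is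
  locally a line and contains no whole line, and that leaves each point of \<open>S\<close> in finitely many
  directions (\<open>metric_graph_model\<close>, \<open>points_model\<close>, \<open>graph_topology_model\<close>,
  \<open>same_metric_graph_model\<close>); the target line is a second instance of this.
\<close>

section \<open>The projective line\<close>

lemma Alexandroff_compactification_homeomorphic:
  assumes "X homeomorphic_space Y"
  shows "Alexandroff_compactification X homeomorphic_space Alexandroff_compactification Y"
proof -
  obtain h k where hk: "homeomorphic_maps X Y h k"
    using assms by (auto simp: homeomorphic_space_def)
  have cont: "continuous_map (Alexandroff_compactification X) (Alexandroff_compactification Y) (map_option h)"
    if hk: "homeomorphic_maps X Y h k" for X :: "'c topology" and Y :: "'d topology" and h k
    unfolding continuous_map_def
  proof (intro conjI allI impI)
    have hY: "h x \<in> topspace Y" if "x \<in> topspace X" for x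
      using hk that by (auto simp: homeomorphic_maps_def continuous_map_def)
    show "map_option h \<in> topspace (Alexandroff_compactification X) \<rightarrow> topspace (Alexandroff_compactification Y)"
      using hY by auto
    fix U assume "openin (Alexandroff_compactification Y) U"
    then consider V where "openin Y V" "U = Some ` V"
      | C where "compactin Y C" "closedin Y C" "U = insert None (Some ` (topspace Y - C))"
      unfolding openin_Alexandroff_compactification by blast
    then show "openin (Alexandroff_compactification X)
        {x \<in> topspace (Alexandroff_compactification X). map_option h x \<in> U}"
    proof cases
      case 1
      have "{x \<in> topspace (Alexandroff_compactification X). map_option h x \<in> U}
          = Some ` {x \<in> topspace X. h x \<in> V}"
        using 1 by auto
      moreover have "openin X {x \<in> topspace X. h x \<in> V}"
        using hk 1 by (auto simp: homeomorphic_maps_def continuous_map_def)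
      ultimately show ?thesis by simp
    next
      case 2
      have sub: "C \<subseteq> topspace Y" using 2(2) closedin_subset by blast
      have im: "k ` C = {x \<in> topspace X. h x \<in> C}"
        using hk sub by (force simp: homeomorphic_maps_def continuous_map_def Pi_iff subset_iff image_iff)
      have "compactin X (k ` C)"
        using hk 2(1) by (auto simp: homeomorphic_maps_def intro: image_compactin)
      moreover have "closedin X (k ` C)"
        unfolding im using hk 2(2) by (auto simp: homeomorphic_maps_def continuous_map_closedin)
      moreover have "{x \<in> topspace (Alexandroff_compactification X). map_option h x \<in> U}
          = insert None (Some ` (topspace X - k ` C))"
        unfolding im using 2 hY by auto
      ultimately show ?thesis
        unfolding openin_Alexandroff_compactification by blast
    qed
  qed
  have "homeomorphic_maps (Alexandroff_compactification X) (Alexandroff_compactification Y)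
      (map_option h) (map_option k)"
    using hk cont[OF hk] cont[of Y X k h] unfolding homeomorphic_maps_def by auto
  then show ?thesis by (auto simp: homeomorphic_space_def)
qed

text \<open>
  Stereographic projection identifies the plane with the punctured sphere, and a compact Hausdorff
  space is the one-point compactification of the complement of any of its points.
\<close>

lemma P1_homeomorphic_sphere: "fst P1 homeomorphic_space nsphere 2"
proof -
  let ?S = "sphere (0 :: complex \<times> real) 1" and ?a = "(0, 1) :: complex \<times> real"
  have a: "?a \<in> ?S" by simp
  have "(?S - {?a}) homeomorphic (UNIV :: complex set)"
    by (rule homeomorphic_punctured_sphere_affine) (auto simp: aff_dim_UNIV)
  then have "top_of_set (?S - {?a}) homeomorphic_space (euclidean :: complex topology)"
    using homeomorphic_space_iff_homeomorphic[of "?S - {?a}" "UNIV :: complex set"] subtopology_UNIV by metis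
  then have "Alexandroff_compactification (euclidean :: complex topology) homeomorphic_space
      Alexandroff_compactification (top_of_set (?S - {?a}))"
    using Alexandroff_compactification_homeomorphic homeomorphic_space_sym by blast
  also have "\<dots> homeomorphic_space top_of_set ?S"
    using Alexandroff_compactification_unique[of "top_of_set ?S" ?a] a
    by (simp add: Hausdorff_imp_kc_space Hausdorff_space_subtopology compact_space_subtopology
        compactin_euclidean_iff subtopology_subtopology Int_absorb1 compact_sphere)
  also have "\<dots> homeomorphic_space nsphere 2"
  proof -
    obtain f :: "(nat \<Rightarrow> real) \<Rightarrow> complex \<times> real" and g where
      "homeomorphic_maps (nsphere (card (Basis :: (complex \<times> real) set) - 1))
         (top_of_set (sphere 0 1 \<inter> span Basis)) f g"
      using homeomorphic_maps_nsphere_euclidean_sphere[of "Basis :: (complex \<times> real) set"]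
        independent_Basis orthogonal_Basis norm_Basis DIM_positive by (metis less_irrefl)
    then show ?thesis
      using homeomorphic_maps_imp_homeomorphic_space homeomorphic_space_sym by fastforce
  qed
  finally show ?thesis by (simp add: P1_def)
qed

lemma surface_genus_P1: "surface_genus P1 0"
proof -
  have "homology_group 1 (nsphere 2) = reduced_homology_group 1 (nsphere 2)"
    by (simp add: un_reduced_homology_group)
  then have triv: "trivial_group (homology_group 1 (nsphere 2))"
    using trivial_reduced_homology_group_nsphere[of 1 2] by simp
  have "homology_group 1 (fst P1) \<cong> homology_group 1 (nsphere 2)"
    by (rule homeomorphic_space_imp_isomorphic_homology_groups[OF P1_homeomorphic_sphere])
  then have t1: "trivial_group (homology_group 1 (fst P1))"
    using triv isomorphic_group_triviality[OF _ group_relative_homology_group group_relative_homology_group]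
    by blast
  have "group (free_Abelian_group ({} :: nat set))" by simp
  moreover have "carrier (free_Abelian_group ({} :: nat set)) = {0}"
    by (auto simp: free_Abelian_group_def)
  ultimately have t2: "trivial_group (free_Abelian_group ({} :: nat set))"
    using group.trivial_group by blast
  show ?thesis
    unfolding surface_genus_def using t1 t2 unfolding trivial_group_def is_iso_def iso_def hom_def bij_betw_def
    by (auto intro!: exI[of _ "\<lambda>_. \<one>\<^bsub>free_Abelian_group {}\<^esub>"] simp: group.is_monoid)
qed

text \<open>
  The weight of an isomorphism class is the inverse of a natural number in \<open>ennreal\<close>, hence never
  zero, and the sum of weights cannot cancel. One cover therefore suffices.
\<close>

lemma hurwitz_number_neq_0:
  assumes "hurwitz_covers h m ps \<noteq> {}"
  shows "hurwitz_number h m ps \<noteq> 0"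
proof -
  let ?R = "{(c, c'). c \<in> hurwitz_covers h m ps \<and> c' \<in> hurwitz_covers h m ps \<and> cover_isos c c' \<noteq> {}}"
  define w where "w C = (let c = (SOME c. c \<in> C) in inverse (of_nat (card (cover_isos c c))) :: ennreal)"
    for C :: "cover set"
  obtain c where c: "c \<in> hurwitz_covers h m ps" using assms by blast
  define C where "C = ?R `` {c}"
  have C: "C \<in> hurwitz_covers h m ps // ?R" unfolding C_def quotient_def using c by blast
  have "w C \<le> hurwitz_number h m ps"
    unfolding hurwitz_number_def w_def[symmetric]
    using infsum_mono_neutral[of w "{C}" w "hurwitz_covers h m ps // ?R"] C
    by (simp add: nonneg_summable_on_complete)
  moreover have "w C \<noteq> 0"
    by (simp add: w_def Let_def ennreal_inverse_eq_0_iff)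
  ultimately show ?thesis by auto
qed

lemma openin_P1_iff:
  "openin (fst P1) U \<longleftrightarrow> open (Some -` U) \<and> (None \<in> U \<longrightarrow> bounded (- (Some -` U)))"
proof -
  have "(\<exists>C. compact C \<and> U = insert None (Some ` (- C))) \<longleftrightarrow>
      None \<in> U \<and> open (Some -` U) \<and> bounded (- (Some -` U))"
  proof safe
    assume *: "None \<in> U" "open (Some -` U)" "bounded (- (Some -` U))"
    have "U = insert None (Some ` (- (- (Some -` U))))"
    proof (rule Set.set_eqI)
      fix x show "x \<in> U \<longleftrightarrow> x \<in> insert None (Some ` (- (- (Some -` U))))"
        using *(1) by (cases x) auto
    qed
    moreover have "compact (- (Some -` U))" using * by (simp add: compact_eq_bounded_closed closed_Compl)
    ultimately show "\<exists>C. compact C \<and> U = insert None (Some ` (- C))" by blast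
  next
    fix C :: "complex set" assume C: "compact C"
    have [simp]: "Some -` insert None (Some ` (- C)) = - C" by auto
    show "open (Some -` insert None (Some ` (- C)))" using C by (simp add: compact_imp_closed open_Compl)
    show "bounded (- (Some -` insert None (Some ` (- C))))" using C by (simp add: compact_imp_bounded)
  qed
  moreover have "(\<exists>V. open V \<and> U = Some ` V) \<longleftrightarrow> None \<notin> U \<and> open (Some -` U)"
  proof safe
    assume "None \<notin> U" "open (Some -` U)"
    moreover have "U = Some ` (Some -` U)"
      using \<open>None \<notin> U\<close> by (auto simp: image_iff) (metis not_None_eq)
    ultimately show "\<exists>V. open V \<and> U = Some ` V" by blast
  next
    fix V :: "complex set" assume "open V"
    then show "open (Some -` Some ` V)" by (simp add: inj_vimage_image_eq)
  qed
  ultimately show ?thesis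
    unfolding P1_def fst_conv openin_Alexandroff_compactification
    by (auto simp: Compl_eq_Diff_UNIV[symmetric] compact_imp_closed)
qed

lemma topspace_P1 [simp]: "topspace (fst P1) = UNIV"
  by (simp add: P1_def UNIV_option_conv)

lemma continuous_map_to_P1I:
  fixes f :: "complex \<Rightarrow> complex option"
  assumes "\<And>z. limitin (fst P1) f (f z) (at z)"
  shows "continuous_map euclidean (fst P1) f"
proof -
  have "atin euclidean z = at z" for z :: complex
    by (auto simp: filter_eq_iff eventually_atin eventually_at_topological)
  then show ?thesis using assms by (simp add: continuous_map_atin)
qed

text \<open>
  The complements of bounded sets form a neighbourhood basis of the point at infinity.
\<close>

lemma continuous_map_P1I:
  assumes c: "continuous_map euclidean (fst P1) (\<lambda>z. F (Some z))"
    and l: "limitin (fst P1) (\<lambda>z. F (Some z)) (F None) at_infinity"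
  shows "continuous_map (fst P1) (fst P1) F"
  unfolding continuous_map_def
proof (intro conjI allI impI)
  fix U assume U: "openin (fst P1) U"
  have "open {z. F (Some z) \<in> U}"
    using c U by (auto simp: continuous_map_def)
  moreover have "bounded (- {z. F (Some z) \<in> U})" if "F None \<in> U"
  proof -
    have "\<forall>\<^sub>F z in at_infinity. F (Some z) \<in> U"
      using l U that unfolding limitin_def by blast
    then obtain b where "\<And>x. b \<le> norm x \<Longrightarrow> F (Some x) \<in> U"
      by (auto simp: eventually_at_infinity)
    then show ?thesis by (intro boundedI[of _ b]) (use linear in blast)
  qed
  ultimately show "openin (fst P1) {x \<in> topspace (fst P1). F x \<in> U}"
    by (simp add: openin_P1_iff vimage_def)
qed auto

lemma continuous_map_Some_P1: "continuous_map euclidean (fst P1) Some"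
  unfolding P1_def fst_conv by (rule continuous_map_Some)

lemma limitin_Some:
  assumes "(g \<longlongrightarrow> l) F" shows "limitin (fst P1) (\<lambda>x. Some (g x)) (Some l) F"
  using assms by (auto simp: limitin_def openin_P1_iff dest: topological_tendstoD)

lemma limitin_None:
  assumes "filterlim g at_infinity F" shows "limitin (fst P1) (\<lambda>x. Some (g x)) None F"
  unfolding limitin_def
proof (intro conjI allI impI)
  fix U assume "openin (fst P1) U \<and> None \<in> U"
  then have "bounded (- (Some -` U))" by (simp add: openin_P1_iff)
  then obtain B where B: "\<And>z. Some z \<notin> U \<Longrightarrow> norm z \<le> B" by (auto simp: bounded_iff)
  have "\<forall>\<^sub>F z in at_infinity. Some z \<in> U"
    unfolding eventually_at_infinity using B by (intro exI[of _ "B + 1"]) force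
  then show "\<forall>\<^sub>F x in F. Some (g x) \<in> U" using assms by (auto simp: filterlim_iff)
qed simp

text \<open>
  This automorphism exchanges the two charts of the sphere. The point with coordinate \<open>z\<close> in the
  chart at infinity is the inversion of \<open>Some z\<close>, so every statement about the chart at infinity
  becomes one about the affine chart.
\<close>

definition P1_inversion :: "complex option \<Rightarrow> complex option" where
  "P1_inversion x = (case x of None \<Rightarrow> Some 0 | Some z \<Rightarrow> if z = 0 then None else Some (inverse z))"

lemma P1_inversion_simps [simp]:
  "P1_inversion None = Some 0" "P1_inversion (Some 0) = None"
  "z \<noteq> 0 \<Longrightarrow> P1_inversion (Some z) = Some (inverse z)"
  "P1_inversion (P1_inversion x) = x"
  by (auto simp: P1_inversion_def split: option.splits)

lemma P1_inversion_eq_iff: "P1_inversion x = y \<longleftrightarrow> x = P1_inversion y"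
  by (metis P1_inversion_simps(4))

lemma continuous_map_inversion_Some: "continuous_map euclidean (fst P1) (\<lambda>z. P1_inversion (Some z))"
proof (rule continuous_map_to_P1I)
  fix a :: complex
  have ev: "\<forall>\<^sub>F z in at a. Some (inverse z) = P1_inversion (Some z)"
    using eventually_neq_at_within[of 0 a UNIV] by (rule eventually_mono) auto
  show "limitin (fst P1) (\<lambda>z. P1_inversion (Some z)) (P1_inversion (Some a)) (at a)"
  proof (rule limitin_transform_eventually[OF ev])
    show "limitin (fst P1) (\<lambda>z. Some (inverse z)) (P1_inversion (Some a)) (at a)"
    proof (cases "a = 0")
      case True
      then show ?thesis using limitin_None[OF filterlim_inverse_at_infinity] by simp
    next
      case False
      then show ?thesis by (auto intro!: limitin_Some tendsto_intros)
    qed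
  qed
qed

lemma continuous_map_inversion: "continuous_map (fst P1) (fst P1) P1_inversion"
proof (rule continuous_map_P1I[OF continuous_map_inversion_Some])
  have "\<forall>\<^sub>F z in at_infinity. Some (inverse z) = P1_inversion (Some (z::complex))"
    unfolding eventually_at_infinity by (intro exI[of _ 1]) (auto simp: P1_inversion_def)
  then show "limitin (fst P1) (\<lambda>z. P1_inversion (Some z)) (P1_inversion None) at_infinity"
    by (rule limitin_transform_eventually) (auto intro!: limitin_Some tendsto_inverse_0)
qed

abbreviation P1_chart_infinity :: "complex option \<Rightarrow> complex" where
  "P1_chart_infinity \<equiv> case_option 0 inverse"

lemma P1_chart_infinity_eq: "y \<noteq> Some 0 \<Longrightarrow> P1_chart_infinity y = the (P1_inversion y)"
  by (cases y) (auto simp: P1_inversion_def)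

lemma P1_chart_infinity_inversion_Some [simp]: "P1_chart_infinity (P1_inversion (Some z)) = z"
  by (cases "z = 0") auto

lemma inv_into_P1_charts [simp]:
  "inv_into (range Some) the z = Some z"
  "inv_into (UNIV - {Some 0}) P1_chart_infinity z = P1_inversion (Some z)"
proof -
  show "inv_into (range Some) the z = Some z"
    by (rule inv_into_f_eq) (auto simp: inj_on_def)
  show "inv_into (UNIV - {Some 0}) P1_chart_infinity z = P1_inversion (Some z)"
  proof (rule inv_into_f_eq)
    show "inj_on P1_chart_infinity (UNIV - {Some 0})"
      by (auto simp: inj_on_def split: option.splits)
  qed (auto simp: P1_inversion_eq_iff)
qed

lemma P1_chart_images [simp]:
  "P1_chart_infinity ` (UNIV - {Some 0}) = UNIV"
proof -
  have "z \<in> P1_chart_infinity ` (UNIV - {Some 0})" for z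
    by (rule image_eqI[of _ _ "P1_inversion (Some z)"]) (auto simp: P1_inversion_eq_iff)
  then show ?thesis by blast
qed

lemma homeomorphic_map_P1_charts:
  "homeomorphic_map (subtopology (fst P1) (range Some)) euclidean the"
  "homeomorphic_map (subtopology (fst P1) (UNIV - {Some 0})) euclidean P1_chart_infinity"
proof -
  have "homeomorphic_map euclidean (subtopology (fst P1) (range Some)) (Some :: complex \<Rightarrow> _)"
    using embedding_map_Some[of "euclidean :: complex topology"] by (simp add: embedding_map_def P1_def)
  then obtain g where g: "homeomorphic_maps euclidean (subtopology (fst P1) (range Some)) (Some :: complex \<Rightarrow> _) g"
    by (auto simp: homeomorphic_map_maps)
  then have "homeomorphic_maps euclidean (subtopology (fst P1) (range Some)) (Some :: complex \<Rightarrow> _) the"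
    by (rule homeomorphic_maps_eq) (use g in \<open>auto simp: homeomorphic_maps_def\<close>)
  then have h1: "homeomorphic_maps (subtopology (fst P1) (range Some)) euclidean the (Some :: complex \<Rightarrow> _)"
    using homeomorphic_maps_sym by blast
  then show "homeomorphic_map (subtopology (fst P1) (range Some)) euclidean the"
    by (auto simp: homeomorphic_map_maps)
  have "continuous_map (subtopology (fst P1) (UNIV - {Some 0})) (subtopology (fst P1) (range Some)) P1_inversion"
    unfolding continuous_map_in_subtopology
    using continuous_map_from_subtopology[OF continuous_map_inversion]
    by (auto simp: P1_inversion_def image_iff split: option.splits)
  then have "continuous_map (subtopology (fst P1) (UNIV - {Some 0})) euclidean (the \<circ> P1_inversion)"
    using h1 by (auto simp: homeomorphic_maps_def intro: continuous_map_compose)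
  then have "continuous_map (subtopology (fst P1) (UNIV - {Some 0})) euclidean P1_chart_infinity"
    by (rule continuous_map_eq) (simp add: P1_chart_infinity_eq)
  moreover have "continuous_map euclidean (subtopology (fst P1) (UNIV - {Some 0})) (\<lambda>z. P1_inversion (Some z))"
    using continuous_map_inversion_Some by (auto simp: continuous_map_in_subtopology P1_inversion_eq_iff)
  ultimately have "homeomorphic_maps (subtopology (fst P1) (UNIV - {Some 0})) euclidean
      P1_chart_infinity (\<lambda>z. P1_inversion (Some z))"
    by (auto simp: homeomorphic_maps_def P1_inversion_def split: option.splits)
  then show "homeomorphic_map (subtopology (fst P1) (UNIV - {Some 0})) euclidean P1_chart_infinity"
    by (auto simp: homeomorphic_map_maps)
qed

lemma range_the_Some: "the ` range Some = UNIV"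
  by (simp add: image_image)

lemma compact_riemann_surface_P1: "compact_riemann_surface P1"
proof -
  let ?X = "Alexandroff_compactification (euclidean :: complex topology)"
  have X: "fst P1 = ?X" by (simp add: P1_def)
  have "Hausdorff_space ?X"
    by (simp add: Hausdorff_space_Alexandroff_compactification locally_compact_space_euclidean)
  moreover have "connected_space ?X"
  proof -
    \<comment> \<open>The plane is connected, and it is dense because it is not compact.\<close>
    have "connectedin ?X (Some ` UNIV)"
      by (rule connectedin_continuous_map_image[OF continuous_map_Some])
        (simp add: connected_UNIV)
    moreover have "\<not> compact_space (euclidean :: complex topology)"
      by (simp add: compact_space_def)
    ultimately have "connectedin ?X (topspace ?X)"
      using Alexandroff_compactification_dense[of "euclidean :: complex topology"]
        connectedin_closure_of by fastforce
    then show ?thesis by (simp only: connectedin_topspace)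
  qed
  moreover have op: "openin ?X (range Some)" "openin ?X (UNIV - {Some 0})"
    unfolding X[symmetric] openin_P1_iff by (auto simp: vimage_def Collect_neg_eq open_Compl)
  moreover have "homeomorphic_map (subtopology ?X (range Some)) (top_of_set (the ` range Some)) the"
    using homeomorphic_map_P1_charts(1) by (simp add: X image_image)
  moreover have "homeomorphic_map (subtopology ?X (UNIV - {Some 0}))
      (top_of_set (P1_chart_infinity ` (UNIV - {Some 0}))) P1_chart_infinity"
    unfolding P1_chart_images using homeomorphic_map_P1_charts(2) by (simp add: X)
  moreover have "(\<psi> \<circ> inv_into U \<phi>) holomorphic_on \<phi> ` (U \<inter> V)"
    if "(U, \<phi>) \<in> snd P1" "(V, \<psi>) \<in> snd P1" for U V \<phi> \<psi>
  proof -
    have "z \<in> P1_chart_infinity ` ((UNIV - {Some 0}) \<inter> range Some)" if "z \<noteq> 0" for z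
      by (rule image_eqI[of _ _ "Some (inverse z)"]) (use that in auto)
    moreover have "z \<in> the ` (range Some \<inter> (UNIV - {Some 0}))" if "z \<noteq> 0" for z :: complex
      by (rule image_eqI[of _ _ "Some z"]) (use that in auto)
    ultimately have sets: "the ` (range Some \<inter> (UNIV - {Some 0})) = - {0 :: complex}"
        "P1_chart_infinity ` ((UNIV - {Some 0}) \<inter> range Some) = - {0}"
      by (auto simp del: image_Int)
    have inv: "inverse holomorphic_on - {0::complex}"
      by (auto intro!: holomorphic_intros)
    have "(P1_chart_infinity \<circ> inv_into (range Some) the) holomorphic_on - {0}"
      by (rule holomorphic_transform[OF inv]) auto
    moreover have "(the \<circ> inv_into (UNIV - {Some 0}) P1_chart_infinity) holomorphic_on - {0}"
      by (rule holomorphic_transform[OF inv]) auto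
    moreover have "(P1_chart_infinity \<circ> inv_into (UNIV - {Some 0}) P1_chart_infinity) = (\<lambda>z. z)"
      "(the \<circ> inv_into (range Some) the) = (\<lambda>z::complex. z)"
      by (auto simp: fun_eq_iff)
    moreover have "(\<lambda>z. z) holomorphic_on A" for A :: "complex set" by (rule holomorphic_on_ident)
    ultimately show ?thesis
      using that unfolding P1_def by (auto simp only: sets snd_conv insert_iff empty_iff prod.inject)
  qed
  ultimately have *: "Hausdorff_space ?X" "connected_space ?X"
      "\<And>U \<phi>. (U, \<phi>) \<in> snd P1 \<Longrightarrow> openin ?X U \<and> \<phi> ` U = UNIV \<and>
         homeomorphic_map (subtopology ?X U) euclidean \<phi>"
      "\<And>U \<phi> V \<psi>. (U, \<phi>) \<in> snd P1 \<Longrightarrow> (V, \<psi>) \<in> snd P1 \<Longrightarrow>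
         (\<psi> \<circ> inv_into U \<phi>) holomorphic_on \<phi> ` (U \<inter> V)"
    unfolding P1_def snd_conv insert_iff empty_iff prod.inject
    by (blast, blast, metis P1_chart_images range_the_Some subtopology_UNIV, blast)
  have cover: "\<Union> (fst ` snd P1) = topspace ?X"
    by (auto simp: P1_def UNIV_option_conv)
  show ?thesis
    unfolding compact_riemann_surface_def case_prod_beta X[symmetric]
  proof (intro conjI ballI)
    show "\<Union> (fst ` snd P1) = topspace (fst P1)" using cover X by simp
  qed (use * in \<open>auto simp: X\<close>)
qed

section \<open>Polynomial covers of the projective line\<close>

lemma snd_P1: "snd P1 = {(range Some, the), (UNIV - {Some 0}, P1_chart_infinity)}"
  by (simp add: P1_def)

text \<open>
  The ramification index refers to every chart at \<open>x\<close> and every chart at \<open>f x\<close>: the four premises are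
  the four pairs of charts.
\<close>

lemma P1_ramification_indexI:
  assumes "\<And>a b. \<lbrakk>x = Some a; f x = Some b\<rbrakk> \<Longrightarrow> zorder (\<lambda>z. the (f (Some z)) - b) a = int k"
    and "\<And>a. \<lbrakk>x = Some a; f x \<noteq> Some 0\<rbrakk> \<Longrightarrow>
      zorder (\<lambda>z. P1_chart_infinity (f (Some z)) - P1_chart_infinity (f x)) a = int k"
    and "\<And>b. \<lbrakk>x \<noteq> Some 0; f x = Some b\<rbrakk> \<Longrightarrow>
      zorder (\<lambda>z. the (f (P1_inversion (Some z))) - b) (P1_chart_infinity x) = int k"
    and "\<lbrakk>x \<noteq> Some 0; f x \<noteq> Some 0\<rbrakk> \<Longrightarrow>
      zorder (\<lambda>z. P1_chart_infinity (f (P1_inversion (Some z))) - P1_chart_infinity (f x))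
        (P1_chart_infinity x) = int k"
  shows "ramification_index P1 f x = k"
  unfolding ramification_index_def
proof (rule the_equality)
  show *: "\<forall>(U, \<phi>)\<in>snd P1. \<forall>(V, \<psi>)\<in>snd P1. x \<in> U \<and> f x \<in> V \<longrightarrow>
     zorder (\<lambda>z. \<psi> (f (inv_into U \<phi> z)) - \<psi> (f x)) (\<phi> x) = int k"
    using assms unfolding P1_def by auto
  obtain U \<phi> where U: "(U, \<phi>) \<in> snd P1" "x \<in> U"
    by (cases x) (auto simp: P1_def)
  obtain V \<psi> where V: "(V, \<psi>) \<in> snd P1" "f x \<in> V"
    by (cases "f x") (auto simp: P1_def)
  have eq: "zorder (\<lambda>z. \<psi> (f (inv_into U \<phi> z)) - \<psi> (f x)) (\<phi> x) = int j"
    if j: "\<forall>(U, \<phi>)\<in>snd P1. \<forall>(V, \<psi>)\<in>snd P1. x \<in> U \<and> f x \<in> V \<longrightarrow>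
     zorder (\<lambda>z. \<psi> (f (inv_into U \<phi> z)) - \<psi> (f x)) (\<phi> x) = int j" for j
    using bspec[OF bspec[OF j U(1), unfolded case_prod_conv] V(1), unfolded case_prod_conv] U(2) V(2)
    by blast
  show "j = k" if "\<forall>(U, \<phi>)\<in>snd P1. \<forall>(V, \<psi>)\<in>snd P1. x \<in> U \<and> f x \<in> V \<longrightarrow>
     zorder (\<lambda>z. \<psi> (f (inv_into U \<phi> z)) - \<psi> (f x)) (\<phi> x) = int j" for j
    using eq[OF that] eq[OF *] by simp
qed

text \<open>
  Continuity, and holomorphy in each of the four pairs of charts.
\<close>

lemma holomorphic_map_P1_iff:
  "holomorphic_map P1 P1 f \<longleftrightarrow> continuous_map (fst P1) (fst P1) f \<and>
     (\<lambda>z. the (f (Some z))) holomorphic_on {z. f (Some z) \<noteq> None} \<and>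
     (\<lambda>z. P1_chart_infinity (f (Some z))) holomorphic_on {z. f (Some z) \<noteq> Some 0} \<and>
     (\<lambda>z. the (f (P1_inversion (Some z)))) holomorphic_on {z. f (P1_inversion (Some z)) \<noteq> None} \<and>
     (\<lambda>z. P1_chart_infinity (f (P1_inversion (Some z)))) holomorphic_on
       {z. f (P1_inversion (Some z)) \<noteq> Some 0}"
proof -
  have im1: "the ` {x \<in> range Some. f x \<in> V} = {z. f (Some z) \<in> V}" for V
    by (auto simp: image_iff intro!: exI[of _ "Some _"])
  have im2: "P1_chart_infinity ` {x \<in> UNIV - {Some 0}. f x \<in> V} = {z. f (P1_inversion (Some z)) \<in> V}" (is "?L = ?R") for V
  proof
    show "?L \<subseteq> ?R"
    proof
      fix z assume "z \<in> ?L"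
      then obtain x where x: "x \<noteq> Some 0" "f x \<in> V" "z = P1_chart_infinity x" by auto
      then have "P1_inversion (Some z) = x" by (cases x) auto
      then show "z \<in> ?R" using x by simp
    qed
    show "?R \<subseteq> ?L"
    proof
      fix z assume z: "z \<in> ?R"
      show "z \<in> ?L"
        by (rule image_eqI[of _ _ "P1_inversion (Some z)"]) (use z in \<open>auto simp: P1_inversion_eq_iff\<close>)
    qed
  qed
  have V: "y \<noteq> None \<longleftrightarrow> y \<in> range Some" "y \<noteq> Some 0 \<longleftrightarrow> y \<in> UNIV - {Some 0}" for y :: "complex option"
    by (cases y; auto)+
  show ?thesis
    unfolding holomorphic_map_def snd_P1 V
    by (simp only: ball_simps case_prod_conv im1 im2 o_def inv_into_P1_charts simp_thms conj_assoc)
qed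

definition P1_poly :: "complex poly \<Rightarrow> complex option \<Rightarrow> complex option" where
  "P1_poly p = map_option (poly p)"

lemma P1_poly_simps [simp]: "P1_poly p None = None" "P1_poly p (Some z) = Some (poly p z)"
  by (auto simp: P1_poly_def)

lemma continuous_map_P1_poly:
  assumes "degree p > 0" shows "continuous_map (fst P1) (fst P1) (P1_poly p)"
proof (rule continuous_map_P1I)
  show "continuous_map euclidean (fst P1) (\<lambda>z. P1_poly p (Some z))"
    by (rule continuous_map_to_P1I) (auto intro!: limitin_Some tendsto_intros)
  show "limitin (fst P1) (\<lambda>z. P1_poly p (Some z)) (P1_poly p None) at_infinity"
    using limitin_None[OF filterlim_poly_at_infinity[OF assms]] by simp
qed

lemma inverse_poly_inverse:
  assumes "z \<noteq> 0" shows "inverse (poly p (inverse z)) = z ^ degree p / poly (reflect_poly p) (z :: complex)"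
  using assms by (simp add: poly_reflect_poly_nz field_simps)

lemma holomorphic_map_P1_poly:
  assumes deg: "degree p > 0"
  shows "holomorphic_map P1 P1 (P1_poly p)"
unfolding holomorphic_map_P1_iff
proof (intro conjI continuous_map_P1_poly[OF deg])
  show "(\<lambda>z. the (P1_poly p (Some z))) holomorphic_on {z. P1_poly p (Some z) \<noteq> None}"
    by (auto intro!: holomorphic_intros)
  show "(\<lambda>z. P1_chart_infinity (P1_poly p (Some z))) holomorphic_on {z. P1_poly p (Some z) \<noteq> Some 0}"
    by (auto intro!: holomorphic_intros)
  have "(\<lambda>z. poly p (inverse z)) holomorphic_on - {0}"
    by (auto intro!: holomorphic_intros)
  moreover have "{z. P1_poly p (P1_inversion (Some z)) \<noteq> None} = - {0}"
    by (auto simp: P1_inversion_def)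
  ultimately show "(\<lambda>z. the (P1_poly p (P1_inversion (Some z)))) holomorphic_on
      {z. P1_poly p (P1_inversion (Some z)) \<noteq> None}"
    by (simp only:) (rule holomorphic_transform, assumption, simp)
  have ne: "poly (reflect_poly p) z \<noteq> 0" if "P1_poly p (P1_inversion (Some z)) \<noteq> Some 0" for z
    using that deg by (cases "z = 0") (auto simp: poly_reflect_poly_nz)
  have "(\<lambda>z. z ^ degree p / poly (reflect_poly p) z) holomorphic_on
      {z. P1_poly p (P1_inversion (Some z)) \<noteq> Some 0}"
    using ne by (auto intro!: holomorphic_intros)
  then show "(\<lambda>z. P1_chart_infinity (P1_poly p (P1_inversion (Some z)))) holomorphic_on
      {z. P1_poly p (P1_inversion (Some z)) \<noteq> Some 0}"
  proof (rule holomorphic_transform)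
    fix z show "z ^ degree p / poly (reflect_poly p) z = P1_chart_infinity (P1_poly p (P1_inversion (Some z)))"
      using deg by (cases "z = 0") (auto simp: inverse_poly_inverse)
  qed
qed

text \<open>
  With \<open>p - b = (z - a) ^ k * r\<close> and \<open>r a \<noteq> 0\<close>, the order of vanishing is \<open>k\<close> in the affine charts. Passing
  to the other chart, at the source or at the target, changes \<open>z - a\<close> or \<open>p - b\<close> only by a holomorphic
  factor without zero there.
\<close>

lemma ramification_index_P1_poly_Some:
  assumes deg: "degree p > 0"
  shows "ramification_index P1 (P1_poly p) (Some a) = Polynomial.order a (p - [:poly p a:])"
proof -
  define b k where "b = poly p a" and "k = Polynomial.order a (p - [:b:])"
  have "p - [:b:] \<noteq> 0" using deg by auto
  then obtain r where r: "p - [:b:] = [:- a, 1:] ^ k * r" and ra: "\<not> [:- a, 1:] dvd r"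
    unfolding k_def using Polynomial.order_decomp by blast
  have "poly r a \<noteq> 0" using ra by (simp add: poly_eq_0_iff_dvd)
  have "poly (p - [:b:]) z = (z - a) ^ k * poly r z" for z
    unfolding r by (simp add: algebra_simps)
  then have fac: "poly p z - b = poly r z * (z - a) ^ k" for z
    by (simp add: algebra_simps)
  have fac_inverse: "poly p (inverse z) - b = (- a / z) ^ k * poly r (inverse z) * (z - inverse a) ^ k"
    if "z \<noteq> 0" "a \<noteq> 0" for z
  proof -
    have "inverse z - a = (- a / z) * (z - inverse a)"
      using that by (simp add: field_simps)
    then show ?thesis unfolding fac by (simp only: power_mult_distrib mult_ac)
  qed
  have inv: "inverse y - inverse b = - (y - b) / (y * b)" if "y \<noteq> 0" "b \<noteq> 0" for y
    using that by (simp add: field_simps)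
  note r0 = \<open>poly r a \<noteq> 0\<close>
  have pa: "P1_poly p (Some a) = Some b" by (simp add: b_def)
  have "ramification_index P1 (P1_poly p) (Some a) = k"
  proof (rule P1_ramification_indexI)
    fix a' b' assume "Some a = Some a'" "P1_poly p (Some a) = Some b'"
    then have [simp]: "a' = a" "b' = b" using pa by simp_all
    show "zorder (\<lambda>z. the (P1_poly p (Some z)) - b') a' = int k"
      by (rule zorder_eqI[of UNIV _ "poly r"]) (auto simp: fac r0 intro!: holomorphic_intros)
  next
    fix a' assume "Some a = Some a'" "P1_poly p (Some a) \<noteq> Some 0"
    then have [simp]: "a' = a" and b0: "b \<noteq> 0" using pa by simp_all
    let ?S = "{z. poly p z \<noteq> 0}" and ?g = "\<lambda>z. - poly r z / (poly p z * b)"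
    show "zorder (\<lambda>z. P1_chart_infinity (P1_poly p (Some z)) - P1_chart_infinity (P1_poly p (Some a))) a' = int k"
    proof (rule zorder_eqI[of ?S _ ?g])
      show "open ?S" by (intro open_Collect_neq continuous_intros)
      show "?g holomorphic_on ?S"
        using b0 by (auto intro!: holomorphic_intros)
      show "a' \<in> ?S" "?g a' \<noteq> 0" using b0 r0 by (auto simp: b_def)
      fix z assume "z \<in> ?S"
      then show "P1_chart_infinity (P1_poly p (Some z)) - P1_chart_infinity (P1_poly p (Some a))
          = ?g z * (z - a') powi int k"
        using inv[OF _ b0, of "poly p z"] by (simp add: pa fac del: P1_poly_simps(2)) (simp add: fac)
    qed
  next
    fix b' assume "Some a \<noteq> Some 0" "P1_poly p (Some a) = Some b'"
    then have a0: "a \<noteq> 0" and [simp]: "b' = b" by (auto simp: pa simp del: P1_poly_simps)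
    let ?g = "\<lambda>z. (- a / z) ^ k * poly r (inverse z)"
    show "zorder (\<lambda>z. the (P1_poly p (P1_inversion (Some z))) - b') (P1_chart_infinity (Some a)) = int k"
    proof (rule zorder_eqI[of "- {0}" _ ?g])
      show "?g holomorphic_on - {0}" by (auto intro!: holomorphic_intros)
      show "P1_chart_infinity (Some a) \<in> - {0}" "?g (P1_chart_infinity (Some a)) \<noteq> 0"
        using a0 r0 by auto
      fix z :: complex assume "z \<in> - {0}"
      then show "the (P1_poly p (P1_inversion (Some z))) - b' = ?g z * (z - P1_chart_infinity (Some a)) powi int k"
        using fac_inverse[of z] a0 by simp
    qed auto
  next
    assume "Some a \<noteq> Some 0" "P1_poly p (Some a) \<noteq> Some 0"
    then have a0: "a \<noteq> 0" and b0: "b \<noteq> 0" by (auto simp: pa simp del: P1_poly_simps)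
    let ?S = "{z. z \<noteq> 0 \<and> poly (reflect_poly p) z \<noteq> 0}"
      and ?g = "\<lambda>z. - ((- a / z) ^ k * poly r (inverse z)) / (poly p (inverse z) * b)"
    have ne: "poly p (inverse z) \<noteq> 0" if "z \<in> ?S" for z
      using that by (auto simp: poly_reflect_poly_nz)
    show "zorder (\<lambda>z. P1_chart_infinity (P1_poly p (P1_inversion (Some z))) - P1_chart_infinity (P1_poly p (Some a)))
        (P1_chart_infinity (Some a)) = int k"
    proof (rule zorder_eqI[of ?S _ ?g])
      show "open ?S" by (intro open_Collect_conj open_Collect_neq continuous_intros)
      show "?g holomorphic_on ?S"
      proof (intro holomorphic_intros)
        show "poly p (inverse z) * b \<noteq> 0" if "z \<in> ?S" for z using ne[OF that] b0 by simp
      qed auto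
      have "poly (reflect_poly p) (inverse a) \<noteq> 0"
        using a0 b0 by (simp add: poly_reflect_poly_nz b_def)
      then show "P1_chart_infinity (Some a) \<in> ?S" using a0 by simp
      show "?g (P1_chart_infinity (Some a)) \<noteq> 0"
        using a0 b0 r0 by (simp add: b_def)
      fix z assume z: "z \<in> ?S"
      then have "P1_chart_infinity (P1_poly p (P1_inversion (Some z))) - P1_chart_infinity (P1_poly p (Some a))
          = inverse (poly p (inverse z)) - inverse b"
        by (simp add: b_def)
      also have "\<dots> = - (poly p (inverse z) - b) / (poly p (inverse z) * b)"
        by (rule inv[OF ne[OF z] b0])
      also have "\<dots> = ?g z * (z - inverse a) ^ k"
        using fac_inverse[of z] a0 z by simp
      finally show "P1_chart_infinity (P1_poly p (P1_inversion (Some z))) - P1_chart_infinity (P1_poly p (Some a))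
          = ?g z * (z - P1_chart_infinity (Some a)) powi int k"
        by simp
    qed
  qed
  then show ?thesis by (simp add: k_def b_def)
qed

lemma ramification_index_P1_poly_None:
  assumes deg: "degree p > 0"
  shows "ramification_index P1 (P1_poly p) None = degree p"
proof (rule P1_ramification_indexI)
  let ?S = "{z. poly (reflect_poly p) z \<noteq> 0}"
  show "zorder (\<lambda>z. P1_chart_infinity (P1_poly p (P1_inversion (Some z))) - P1_chart_infinity (P1_poly p None))
      (P1_chart_infinity None) = int (degree p)"
  proof (rule zorder_eqI[of ?S _ "\<lambda>z. 1 / poly (reflect_poly p) z"])
    show "open ?S" by (intro open_Collect_neq continuous_intros)
    fix z assume "z \<in> ?S"
    then show "P1_chart_infinity (P1_poly p (P1_inversion (Some z))) - P1_chart_infinity (P1_poly p None)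
      = 1 / poly (reflect_poly p) z * (z - P1_chart_infinity None) powi int (degree p)"
      using deg by (cases "z = 0") (auto simp: inverse_poly_inverse)
  qed (use deg in \<open>auto intro!: holomorphic_intros\<close>)
qed auto

lemma ramification_profile_P1_poly_None:
  assumes "degree p > 0"
  shows "ramification_profile P1 (P1_poly p) None = {#degree p#}"
proof -
  have "{x. P1_poly p x = None} = {None}" by (auto simp: P1_poly_def)
  then show ?thesis by (simp add: ramification_profile_def ramification_index_P1_poly_None[OF assms])
qed

definition root_multiplicities :: "complex poly \<Rightarrow> nat multiset" where
  "root_multiplicities q = image_mset (\<lambda>a. Polynomial.order a q) (mset_set {a. poly q a = 0})"

lemma ramification_profile_P1_poly_Some:
  assumes "degree p > 0"
  shows "ramification_profile P1 (P1_poly p) (Some b) = root_multiplicities (p - [:b:])"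
proof -
  have "p - [:b:] \<noteq> 0" using assms by auto
  then have fin: "finite {a. poly p a = b}" using poly_roots_finite[of "p - [:b:]"] by simp
  have "{x. P1_poly p x = Some b} = Some ` {a. poly (p - [:b:]) a = 0}"
    by (auto simp: P1_poly_def)
  then show ?thesis
    unfolding ramification_profile_def root_multiplicities_def topspace_P1 using fin
    by (auto simp: image_mset_mset_set[symmetric] multiset.map_comp ramification_index_P1_poly_Some[OF assms]
        intro!: image_mset_cong)
qed

text \<open>
  A complex polynomial has as many roots as its degree, counted with multiplicity, and a root that
  is not a root of the derivative is simple.
\<close>

lemma root_multiplicities_squarefree:
  assumes "\<And>a. poly q a = 0 \<Longrightarrow> poly (pderiv q) a \<noteq> 0"
  shows "root_multiplicities q = replicate_mset (degree q) 1"
proof -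
  have q: "rsquarefree q" using assms by (auto simp: rsquarefree_roots)
  then have q0: "q \<noteq> 0" by (auto simp: rsquarefree_def)
  have o: "Polynomial.order a q = 1" if "poly q a = 0" for a
    using rsquarefree_root_order[OF q that q0] .
  have "proots q = mset_set {a. poly q a = 0}"
    using q0 o poly_roots_finite[OF q0] by (auto simp: multiset_eq_iff count_mset_set' Polynomial.order_root)
  then have "card {a. poly q a = 0} = degree q"
    using size_proots_complex[of q] by simp
  moreover have "root_multiplicities q = image_mset (\<lambda>_. 1) (mset_set {a. poly q a = 0})"
    unfolding root_multiplicities_def using o poly_roots_finite[OF q0] by (intro image_mset_cong) auto
  ultimately show ?thesis by (simp add: image_mset_const_eq)
qed

lemma openin_P1_preimage:
  assumes "continuous_map euclidean (fst P1) g"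
  shows "open {z. g z \<noteq> None}" "open {z. g z \<noteq> Some b}"
proof -
  have "openin (fst P1) (- {None})"
    by (simp add: openin_P1_iff vimage_def)
  moreover have "openin (fst P1) (- {Some b})" for b
    by (simp add: openin_P1_iff vimage_def Collect_neg_eq open_Compl)
  ultimately show "open {z. g z \<noteq> None}" "open {z. g z \<noteq> Some b}"
    using assms openin_continuous_map_preimage[OF assms, of "- {None}"]
      openin_continuous_map_preimage[OF assms, of "- {Some b}"] by auto
qed

text \<open>
  Composing with inversion exchanges the roles of the two charts of the target. The coordinates
  agree except at the one value where inversion leaves the chart, and near \<open>a\<close> this value is not
  taken.
\<close>

lemma zorder_P1_inversion:
  assumes g: "continuous_map euclidean (fst P1) g"
  shows "g a \<noteq> Some 0 \<Longrightarrow> zorder (\<lambda>z. the (P1_inversion (g z)) - the (P1_inversion (g a))) a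
      = zorder (\<lambda>z. P1_chart_infinity (g z) - P1_chart_infinity (g a)) a"
    and "g a \<noteq> None \<Longrightarrow> zorder (\<lambda>z. P1_chart_infinity (P1_inversion (g z)) - P1_chart_infinity (P1_inversion (g a))) a
      = zorder (\<lambda>z. the (g z) - the (g a)) a"
proof -
  have ev: "\<forall>\<^sub>F z in at a. g z \<noteq> y" if "g a \<noteq> y" for y
  proof -
    have "open {z. g z \<noteq> y}" using openin_P1_preimage[OF g] by (cases y) auto
    then have "\<forall>\<^sub>F z in nhds a. g z \<noteq> y" using that by (auto simp: eventually_nhds)
    then show ?thesis by (rule eventually_at_filter[THEN iffD2, OF eventually_mono]) auto
  qed
  show "zorder (\<lambda>z. the (P1_inversion (g z)) - the (P1_inversion (g a))) a
      = zorder (\<lambda>z. P1_chart_infinity (g z) - P1_chart_infinity (g a)) a" if "g a \<noteq> Some 0"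
    using that by (intro zorder_cong eventually_mono[OF ev[OF that]]) (simp_all add: P1_chart_infinity_eq)
  have ci: "P1_chart_infinity (P1_inversion y) = the y" if "y \<noteq> None" for y
    using that by auto
  show "zorder (\<lambda>z. P1_chart_infinity (P1_inversion (g z)) - P1_chart_infinity (P1_inversion (g a))) a
      = zorder (\<lambda>z. the (g z) - the (g a)) a" if "g a \<noteq> None"
    using that by (intro zorder_cong eventually_mono[OF ev[OF that]]) (simp_all add: ci)
qed

lemma ramification_index_P1_inversion:
  assumes f: "continuous_map (fst P1) (fst P1) f"
  shows "ramification_index P1 (P1_inversion \<circ> f) x = ramification_index P1 f x"
proof -
  have c1: "continuous_map euclidean (fst P1) (\<lambda>z. f (Some z))"
    using continuous_map_compose[OF continuous_map_Some_P1 f] by (simp add: o_def)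
  have c2: "continuous_map euclidean (fst P1) (\<lambda>z. f (P1_inversion (Some z)))"
    using continuous_map_compose[OF continuous_map_inversion_Some f] by (simp add: o_def)
  have V: "y \<in> range Some \<longleftrightarrow> y \<noteq> None" "y \<in> UNIV - {Some 0} \<longleftrightarrow> y \<noteq> Some 0" for y :: "complex option"
    by (cases y; auto)+
  have inv: "P1_inversion y \<noteq> None \<longleftrightarrow> y \<noteq> Some 0" "P1_inversion y \<noteq> Some 0 \<longleftrightarrow> y \<noteq> None" for y
    by (auto simp: P1_inversion_eq_iff)
  have z1: "zorder (\<lambda>z. the (P1_inversion (f (Some z))) - the (P1_inversion (f x))) (the x)
      = zorder (\<lambda>z. P1_chart_infinity (f (Some z)) - P1_chart_infinity (f x)) (the x)"
    if "x \<noteq> None" "f x \<noteq> Some 0"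
    using that zorder_P1_inversion(1)[OF c1, of "the x"] by simp
  have z2: "zorder (\<lambda>z. P1_chart_infinity (P1_inversion (f (Some z))) - P1_chart_infinity (P1_inversion (f x))) (the x)
      = zorder (\<lambda>z. the (f (Some z)) - the (f x)) (the x)"
    if "x \<noteq> None" "f x \<noteq> None"
    using that zorder_P1_inversion(2)[OF c1, of "the x"] by simp
  have s: "P1_inversion (Some (P1_chart_infinity x)) = x" if "x \<noteq> Some 0"
    using that by (cases x) auto
  have z3: "zorder (\<lambda>z. the (P1_inversion (f (P1_inversion (Some z)))) - the (P1_inversion (f x))) (P1_chart_infinity x)
      = zorder (\<lambda>z. P1_chart_infinity (f (P1_inversion (Some z))) - P1_chart_infinity (f x)) (P1_chart_infinity x)"
    if "x \<noteq> Some 0" "f x \<noteq> Some 0"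
    using that(2) zorder_P1_inversion(1)[OF c2, of "P1_chart_infinity x"] unfolding s[OF that(1)] by blast
  have z4: "zorder (\<lambda>z. P1_chart_infinity (P1_inversion (f (P1_inversion (Some z)))) - P1_chart_infinity (P1_inversion (f x))) (P1_chart_infinity x)
      = zorder (\<lambda>z. the (f (P1_inversion (Some z))) - the (f x)) (P1_chart_infinity x)"
    if "x \<noteq> Some 0" "f x \<noteq> None"
    using that(2) zorder_P1_inversion(2)[OF c2, of "P1_chart_infinity x"] unfolding s[OF that(1)] by blast
  have "(\<forall>(U, \<phi>)\<in>snd P1. \<forall>(V, \<psi>)\<in>snd P1. x \<in> U \<and> (P1_inversion \<circ> f) x \<in> V \<longrightarrow>
      zorder (\<lambda>z. \<psi> ((P1_inversion \<circ> f) (inv_into U \<phi> z)) - \<psi> ((P1_inversion \<circ> f) x)) (\<phi> x) = int k) \<longleftrightarrow>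
    (\<forall>(U, \<phi>)\<in>snd P1. \<forall>(V, \<psi>)\<in>snd P1. x \<in> U \<and> f x \<in> V \<longrightarrow>
      zorder (\<lambda>z. \<psi> (f (inv_into U \<phi> z)) - \<psi> (f x)) (\<phi> x) = int k)" (is "?l k \<longleftrightarrow> ?r k") for k
  proof -
    have l: "?l k \<longleftrightarrow>
      (x \<noteq> None \<and> f x \<noteq> Some 0 \<longrightarrow> zorder (\<lambda>z. P1_chart_infinity (f (Some z)) - P1_chart_infinity (f x)) (the x) = int k) \<and>
      (x \<noteq> None \<and> f x \<noteq> None \<longrightarrow> zorder (\<lambda>z. the (f (Some z)) - the (f x)) (the x) = int k) \<and>
      (x \<noteq> Some 0 \<and> f x \<noteq> Some 0 \<longrightarrow> zorder (\<lambda>z. P1_chart_infinity (f (P1_inversion (Some z))) - P1_chart_infinity (f x)) (P1_chart_infinity x) = int k) \<and>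
      (x \<noteq> Some 0 \<and> f x \<noteq> None \<longrightarrow> zorder (\<lambda>z. the (f (P1_inversion (Some z))) - the (f x)) (P1_chart_infinity x) = int k)"
      unfolding snd_P1
      by (simp only: ball_simps case_prod_conv o_apply inv_into_P1_charts V inv simp_thms z1 z2 z3 z4 conj_assoc
          cong: imp_cong conj_cong)
    show ?thesis
      unfolding l unfolding snd_P1
      by (simp only: ball_simps case_prod_conv o_apply inv_into_P1_charts V inv simp_thms conj_assoc) blast
  qed
  then show ?thesis unfolding ramification_index_def by presburger
qed

lemma ramification_profile_P1_inversion:
  assumes "continuous_map (fst P1) (fst P1) f"
  shows "ramification_profile P1 (P1_inversion \<circ> f) y = ramification_profile P1 f (P1_inversion y)"
  unfolding ramification_profile_def o_apply P1_inversion_eq_iff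
  by (intro image_mset_cong ramification_index_P1_inversion[OF assms, unfolded o_def])

lemma holomorphic_map_P1_inversion:
  assumes f: "holomorphic_map P1 P1 f"
  shows "holomorphic_map P1 P1 (P1_inversion \<circ> f)"
proof -
  have ne: "P1_inversion y \<noteq> None \<longleftrightarrow> y \<noteq> Some 0" "P1_inversion y \<noteq> Some 0 \<longleftrightarrow> y \<noteq> None" for y
    by (auto simp: P1_inversion_eq_iff)
  have 1: "(\<lambda>z. the (P1_inversion (g z))) holomorphic_on {z. P1_inversion (g z) \<noteq> None}"
    if "(\<lambda>z. P1_chart_infinity (g z)) holomorphic_on {z. g z \<noteq> Some 0}" for g :: "complex \<Rightarrow> complex option"
    unfolding ne by (rule holomorphic_transform[OF that]) (simp add: P1_chart_infinity_eq)
  have 2: "(\<lambda>z. P1_chart_infinity (P1_inversion (g z))) holomorphic_on {z. P1_inversion (g z) \<noteq> Some 0}"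
    if "(\<lambda>z. the (g z)) holomorphic_on {z. g z \<noteq> None}" for g :: "complex \<Rightarrow> complex option"
    unfolding ne by (rule holomorphic_transform[OF that]) auto
  show ?thesis
    using f continuous_map_compose[OF _ continuous_map_inversion]
    unfolding holomorphic_map_P1_iff o_apply by (intro conjI 1 2) blast+
qed

lemma hurwitz_number_P1_neq_0:
  assumes "holomorphic_map P1 P1 f" and "f x \<noteq> f y"
    and "\<And>i. i < length ps \<Longrightarrow> ramification_profile P1 f (branch_point i) = ps ! i"
    and "\<And>p. p \<notin> branch_point ` {..<length ps} \<Longrightarrow> ramification_profile P1 f p = replicate_mset m 1"
  shows "hurwitz_number 0 m ps \<noteq> 0"
proof (rule hurwitz_number_neq_0)
  have "(P1, f) \<in> hurwitz_covers 0 m ps"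
    unfolding hurwitz_covers_def using assms compact_riemann_surface_P1 surface_genus_P1 by auto
  then show "hurwitz_covers 0 m ps \<noteq> {}" by blast
qed

lemma degree_diff_const: "degree (p - [:b:]) = degree (p :: complex poly)"
proof (cases "degree p = 0")
  case True
  then show ?thesis by (metis degree_diff_le degree_pCons_0 le_zero_eq order.refl)
next
  case False
  have eq: "p - [:b:] = p + [:- b:]" by simp
  show ?thesis unfolding eq by (rule degree_add_eq_left) (use False in simp)
qed

lemma P1_poly_nonconstant: "P1_poly p None \<noteq> P1_poly p (Some 0)"
  by simp

text \<open>
  The power map \<open>z ^ m\<close> is ramified over infinity and 0 only.
\<close>

lemma hurwitz_number_total_ramification:
  assumes "m > 0"
  shows "hurwitz_number 0 m [{#m#}, {#m#}] \<noteq> 0"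
proof -
  define p :: "complex poly" where "p = Polynomial.monom 1 m"
  have deg: "degree p = m" by (simp add: p_def degree_monom_eq)
  then have d0: "degree p > 0" using assms by simp
  have "{a. poly p a = 0} = {0}" using assms by (auto simp: p_def poly_monom)
  moreover have "Polynomial.order 0 p = m"
    using order_power_n_n[of "0::complex" m] by (simp add: p_def monom_altdef)
  ultimately have z: "root_multiplicities p = {#m#}" by (simp add: root_multiplicities_def)
  have "root_multiplicities (p - [:b:]) = replicate_mset m 1" if "b \<noteq> 0" for b
  proof -
    have "poly (pderiv (p - [:b:])) a \<noteq> 0" if "poly (p - [:b:]) a = 0" for a
    proof -
      have "a \<noteq> 0" using that \<open>b \<noteq> 0\<close> assms by (auto simp: p_def poly_monom)
      then show ?thesis using assms by (simp add: p_def pderiv_diff pderiv_monom poly_monom)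
    qed
    then show ?thesis using root_multiplicities_squarefree degree_diff_const deg by metis
  qed
  then have u: "ramification_profile P1 (P1_poly p) x = replicate_mset m 1"
    if "x \<notin> branch_point ` {..<length [{#m#}, {#m#}]}" for x
    using that by (cases x) (auto simp: ramification_profile_P1_poly_Some[OF d0] lessThan_Suc)
  show ?thesis
    by (rule hurwitz_number_P1_neq_0[OF holomorphic_map_P1_poly[OF d0] P1_poly_nonconstant _ u])
       (auto simp: less_Suc_eq ramification_profile_P1_poly_None[OF d0] deg ramification_profile_P1_poly_Some[OF d0] z)
qed

text \<open>
  A polynomial is totally ramified over infinity; if its critical values are among 0 and 1, it is
  unramified elsewhere. The profiles occur in a second order as well, because inversion of the target
  exchanges infinity with 0 and fixes 1. Both orders are needed: the edge of full weight at a vertex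
  may lie above or below the vertex, whereas the positions of the branch points are fixed.
\<close>

lemma hurwitz_number_critical_values_0_1:
  fixes p :: "complex poly"
  assumes d0: "degree p = m" "m > 0"
    and unram: "\<And>a. poly (pderiv p) a = 0 \<Longrightarrow> poly p a = 0 \<or> poly p a = 1"
  shows "hurwitz_number 0 m [{#m#}, root_multiplicities p, root_multiplicities (p - 1)] \<noteq> 0"
    and "hurwitz_number 0 m [root_multiplicities p, {#m#}, root_multiplicities (p - 1)] \<noteq> 0"
proof -
  have d: "degree p > 0" using assms by simp
  have "root_multiplicities (p - [:b:]) = replicate_mset m 1" if "b \<noteq> 0" "b \<noteq> 1" for b
  proof -
    have "poly (pderiv (p - [:b:])) a \<noteq> 0" if "poly (p - [:b:]) a = 0" for a
      using that unram[of a] \<open>b \<noteq> 0\<close> \<open>b \<noteq> 1\<close> by (auto simp: pderiv_diff)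
    then show ?thesis using root_multiplicities_squarefree degree_diff_const d0 by metis
  qed
  then have u: "ramification_profile P1 (P1_poly p) x = replicate_mset m 1"
    if "x \<notin> {None, Some 0, Some 1}" for x
    using that by (cases x) (auto simp: ramification_profile_P1_poly_Some[OF d])
  have bp: "branch_point ` {..<length [a, b, c]} = {None, Some 0, Some 1}" for a b c :: "nat multiset"
    by (auto simp: lessThan_Suc)
  have one: "p - 1 = p - [:1:]" by (simp add: one_pCons)
  have nth: "ramification_profile P1 f (branch_point i) = [a, b, c] ! i"
    if "i < length [a, b, c]" "ramification_profile P1 f None = a" "ramification_profile P1 f (Some 0) = b"
      "ramification_profile P1 f (Some 1) = c" for f a b c i
    using that by (auto simp: less_Suc_eq)
  note h = holomorphic_map_P1_poly[OF d]
  note inv = ramification_profile_P1_inversion[OF continuous_map_P1_poly[OF d]]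
  have prof: "ramification_profile P1 (P1_poly p) None = {#m#}"
      "ramification_profile P1 (P1_poly p) (Some 0) = root_multiplicities p"
      "ramification_profile P1 (P1_poly p) (Some 1) = root_multiplicities (p - 1)"
    using ramification_profile_P1_poly_None[OF d] ramification_profile_P1_poly_Some[OF d]
    by (simp_all add: d0 one)
  show "hurwitz_number 0 m [{#m#}, root_multiplicities p, root_multiplicities (p - 1)] \<noteq> 0"
    by (rule hurwitz_number_P1_neq_0[OF h P1_poly_nonconstant nth[OF _ prof]])
       (use u bp in auto)
  have "P1_inversion x \<notin> {None, Some 0, Some 1}" if "x \<notin> {None, Some 0, Some 1}" for x
    using that by (auto simp: P1_inversion_def split: option.splits if_splits)
  then have u': "ramification_profile P1 (P1_inversion \<circ> P1_poly p) x = replicate_mset m 1"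
    if "x \<notin> {None, Some 0, Some 1}" for x
    unfolding inv using u that by blast
  have "(P1_inversion \<circ> P1_poly p) None \<noteq> (P1_inversion \<circ> P1_poly p) (Some 0)"
    using P1_poly_nonconstant by (metis P1_inversion_simps(4) o_apply)
  then show "hurwitz_number 0 m [root_multiplicities p, {#m#}, root_multiplicities (p - 1)] \<noteq> 0"
    by (rule hurwitz_number_P1_neq_0[OF holomorphic_map_P1_inversion[OF h] _ nth])
       (use u' bp in \<open>auto simp: inv prof\<close>)
qed

text \<open>
  The polynomial \<open>z\<^sup>2 + 1\<close> has the single critical point 0, with value 1.
\<close>

lemma hurwitz_number_degree_2:
  "hurwitz_number 0 2 [{#2#}, {#1, 1#}, {#2#}] \<noteq> 0"
  "hurwitz_number 0 2 [{#1, 1#}, {#2#}, {#2#}] \<noteq> 0"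
proof -
  define p :: "complex poly" where "p = [:1, 0, 1:]"
  have "root_multiplicities p = replicate_mset (degree p) 1"
    by (rule root_multiplicities_squarefree) (auto simp: p_def pderiv_pCons)
  then have 1: "root_multiplicities p = {#1, 1#}" by (simp add: p_def numeral_2_eq_2)
  have "p - 1 = [:- 0, 1:] ^ 2" by (simp add: p_def one_pCons power2_eq_square)
  moreover have "{a. poly ([:- 0, 1:] ^ 2) a = 0} = {0 :: complex}" by auto
  moreover have "Polynomial.order (0::complex) ([:- 0, 1:] ^ 2) = 2" by (rule order_power_n_n)
  ultimately have 2: "root_multiplicities (p - 1) = {#2#}"
    unfolding root_multiplicities_def by (simp del: minus_zero)
  have "degree p = 2" by (simp add: p_def)
  moreover have "poly p a = 0 \<or> poly p a = 1" if "poly (pderiv p) a = 0" for a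
    using that by (simp add: p_def pderiv_pCons)
  ultimately show "hurwitz_number 0 2 [{#2#}, {#1, 1#}, {#2#}] \<noteq> 0"
      "hurwitz_number 0 2 [{#1, 1#}, {#2#}, {#2#}] \<noteq> 0"
    using hurwitz_number_critical_values_0_1[of p 2] unfolding 1 2 by auto
qed

lemma root_multiplicities_cubic:
  assumes "a \<noteq> b" "c \<noteq> 0"
  shows "root_multiplicities ([:- a, 1:] ^ 2 * Polynomial.smult c [:- b, 1:]) = {#1, 2#}"
proof -
  let ?p = "[:- a, 1:] ^ 2 * Polynomial.smult c [:- b, 1:]"
  have ne: "?p \<noteq> 0" using assms by (metis mult_eq_0_iff pCons_eq_0_iff power_not_zero smult_eq_0_iff zero_neq_one)
  have o: "Polynomial.order x ?p = Polynomial.order x ([:- a, 1:] ^ 2) + Polynomial.order x [:- b, 1:]" for x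
    unfolding order_mult[OF ne] order_smult[OF assms(2)] ..
  have "Polynomial.order a ?p = 2"
    unfolding o using order_power_n_n[of a 2] assms by (simp add: order_0I)
  moreover have "Polynomial.order b ?p = 1"
    unfolding o using order_power_n_n[of b 1] assms by (simp add: order_0I)
  moreover have "{x. poly ?p x = 0} = {a, b}" using assms by auto
  ultimately show ?thesis unfolding root_multiplicities_def using assms by simp
qed

text \<open>
  The polynomial \<open>3 z\<^sup>2 - 2 z\<^sup>3\<close> has the critical points 0 and 1, with the values 0 and 1.
\<close>

lemma hurwitz_number_degree_3:
  "hurwitz_number 0 3 [{#3#}, {#1, 2#}, {#2, 1#}] \<noteq> 0"
  "hurwitz_number 0 3 [{#1, 2#}, {#3#}, {#2, 1#}] \<noteq> 0"
proof -
  define p :: "complex poly" where "p = [:0, 0, 3, - 2:]"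
  have "p = [:- 0, 1:] ^ 2 * Polynomial.smult (- 2) [:- (3 / 2), 1:]"
    by (simp add: p_def power2_eq_square)
  then have 1: "root_multiplicities p = {#1, 2#}"
    using root_multiplicities_cubic[of 0 "3 / 2" "- 2"] by simp
  have "p - 1 = [:- 1, 1:] ^ 2 * Polynomial.smult (- 2) [:- (- 1 / 2), 1:]"
    by (simp add: p_def power2_eq_square one_pCons)
  moreover have "(1::complex) \<noteq> - 1 / 2" by (simp add: field_simps)
  ultimately have 2: "root_multiplicities (p - 1) = {#1, 2#}"
    using root_multiplicities_cubic[of 1 "- 1 / 2" "- 2"] by simp
  have "degree p = 3" by (simp add: p_def)
  moreover have "poly p a = 0 \<or> poly p a = 1" if "poly (pderiv p) a = 0" for a
  proof -
    have "a * (1 - a) = 0" using that by (simp add: p_def pderiv_pCons algebra_simps)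
    then show ?thesis by (auto simp: p_def)
  qed
  ultimately show "hurwitz_number 0 3 [{#3#}, {#1, 2#}, {#2, 1#}] \<noteq> 0"
      "hurwitz_number 0 3 [{#1, 2#}, {#3#}, {#2, 1#}] \<noteq> 0"
    using hurwitz_number_critical_values_0_1[of p 3] unfolding 1 2 by (auto simp: add_mset_commute)
qed

section \<open>Models of piecewise straight curves\<close>

lemma closed_edge_dom: "closed (edge_dom e)"
proof (cases "len e")
  case (real r)
  then have "edge_dom e = {0..r}" by (auto simp: edge_dom_def)
  then show ?thesis by simp
next
  case PInf
  then have "edge_dom e = {0..}" by (auto simp: edge_dom_def)
  then show ?thesis by simp
next
  case MInf
  then have "edge_dom e = {}" by (auto simp: edge_dom_def)
  then show ?thesis by simp
qed

definition direction :: "('v::real_vector) edge \<times> bool \<Rightarrow> 'v" where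
  "direction d = dpar d 1 - dpar d 0"

text \<open>
  \<open>P\<close> contains the vectors that count as unit vectors, at most two opposite ones on each line through
  the origin; for the lattice length these are the primitive vectors. The predicate \<open>pos\<close> selects one
  of each pair, so that every bounded edge can be given one preferred orientation.
\<close>

locale straight_curve =
  fixes C :: "'v::euclidean_space set" and P :: "'v set" and pos :: "'v \<Rightarrow> bool"
  assumes closed_curve: "closed C"
    and zero_notin_P: "0 \<notin> P"
    and uminus_P: "u \<in> P \<Longrightarrow> - u \<in> P"
    and parallel_P: "u \<in> P \<Longrightarrow> r *\<^sub>R u \<in> P \<Longrightarrow> r = 1 \<or> r = - 1"
    and pos_uminus: "u \<in> P \<Longrightarrow> pos (- u) \<longleftrightarrow> \<not> pos u"
begin

definition line_point :: "'v \<Rightarrow> bool" where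
  "line_point q \<longleftrightarrow> (\<exists>u\<in>P. \<exists>\<epsilon>>0. \<forall>x. dist x q < \<epsilon> \<longrightarrow> (x \<in> C \<longleftrightarrow> (\<exists>t. x = q + t *\<^sub>R u)))"

definition germs :: "'v \<Rightarrow> 'v set" where
  "germs v = {u \<in> P. \<exists>\<epsilon>>0. \<forall>t. 0 < t \<and> t < \<epsilon> \<longrightarrow> v + t *\<^sub>R u \<in> C}"

text \<open>
  The last condition excludes a whole line contained in \<open>C - S\<close>: it would be a component without
  vertices, and an edge of a metric graph has at least one end vertex.
\<close>

definition vertex_set :: "'v set \<Rightarrow> bool" where
  "vertex_set S \<longleftrightarrow> finite S \<and> S \<noteq> {} \<and> S \<subseteq> C \<and> (\<forall>q\<in>C - S. line_point q) \<and> (\<forall>v\<in>S. finite (germs v)) \<and>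
     (\<forall>q u. u \<in> P \<longrightarrow> (\<exists>t. q + t *\<^sub>R u \<notin> C - S))"

definition segment :: "'v set \<Rightarrow> 'v \<Rightarrow> 'v \<Rightarrow> ereal \<Rightarrow> bool" where
  "segment S p u l \<longleftrightarrow> p \<in> S \<and> u \<in> P \<and> 0 < l \<and>
     (\<forall>t. 0 < t \<and> ereal t < l \<longrightarrow> p + t *\<^sub>R u \<in> C - S) \<and>
     (l < \<infinity> \<longrightarrow> p + real_of_ereal l *\<^sub>R u \<in> S)"

text \<open>
  A bounded edge can be traversed from both of its ends; only the positive traversal is included, so
  that the edge occurs once. The parametrisation is affine on all of the real line, which makes an
  edge equal to another as soon as start, direction and length agree.
\<close>

definition segments :: "'v set \<Rightarrow> 'v edge set" where
  "segments S = {Edge l (\<lambda>t. p + t *\<^sub>R u) | p u l. segment S p u l \<and> (l < \<infinity> \<longrightarrow> pos u)}"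

lemma segment_inner: "segment S p u l \<Longrightarrow> 0 < t \<Longrightarrow> ereal t < l \<Longrightarrow> p + t *\<^sub>R u \<in> C - S"
  and segment_start: "segment S p u l \<Longrightarrow> p \<in> S"
  and segment_direction: "segment S p u l \<Longrightarrow> u \<in> P"
  and segment_length: "segment S p u l \<Longrightarrow> 0 < l"
  and segment_end: "segment S p u l \<Longrightarrow> l < \<infinity> \<Longrightarrow> p + real_of_ereal l *\<^sub>R u \<in> S"
  unfolding segment_def by blast+

lemma segment_length_unique:
  assumes "segment S p u l" "segment S p u l'"
  shows "l = l'"
proof -
  have le: "k \<le> k'" if s: "segment S p u k" "segment S p u k'" for k k'
  proof (rule ccontr)
    assume "\<not> k \<le> k'"
    then obtain r where r: "k' = ereal r" "ereal r < k"
      using segment_length[OF s(2)] by (cases k; cases k') auto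
    then have "0 < r" using segment_length[OF s(2)] by simp
    then show False using segment_inner[OF s(1) _ r(2)] segment_end[OF s(2)] r(1) by simp
  qed
  show ?thesis using le[OF assms] le[OF assms(2,1)] by simp
qed

lemma segment_reverse:
  assumes "segment S p u (ereal r)"
  shows "segment S (p + r *\<^sub>R u) (- u) (ereal r)"
  unfolding segment_def
proof (intro conjI allI impI)
  fix t assume "0 < t \<and> ereal t < ereal r"
  then have "p + (r - t) *\<^sub>R u \<in> C - S" using segment_inner[OF assms, of "r - t"] by simp
  then show "p + r *\<^sub>R u + t *\<^sub>R - u \<in> C - S" by (simp add: algebra_simps)
qed (use segment_start[OF assms] segment_direction[OF assms] segment_length[OF assms] segment_end[OF assms]
      uminus_P in auto)

lemma segment_germ:
  assumes "segment S p u l"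
  shows "u \<in> germs p"
proof -
  obtain \<epsilon> where "0 < \<epsilon>" "ereal \<epsilon> < l"
    using segment_length[OF assms] ereal_dense2[of 0 l] by (metis ereal_less(2))
  then have "\<forall>t. 0 < t \<and> t < \<epsilon> \<longrightarrow> p + t *\<^sub>R u \<in> C"
    using segment_inner[OF assms] by (meson DiffD1 less_ereal.simps(1) order_less_trans)
  then show ?thesis using \<open>0 < \<epsilon>\<close> segment_direction[OF assms] by (auto simp: germs_def)
qed

lemma segment_backward_germ:
  assumes "segment S p u l" "0 < t" "ereal t < l"
  shows "- u \<in> germs (p + t *\<^sub>R u)"
proof -
  have "p + t *\<^sub>R u + s *\<^sub>R (- u) \<in> C" if "0 < s" "s < t" for s
  proof -
    have "ereal (t - s) < l" using that assms(3) by (cases l) auto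
    then show ?thesis using segment_inner[OF assms(1), of "t - s"] that by (simp add: algebra_simps)
  qed
  then show ?thesis using assms(2) uminus_P[OF segment_direction[OF assms(1)]] by (auto simp: germs_def)
qed

definition model :: "'v set \<Rightarrow> 'v mgraph" where
  "model S = \<lparr>verts = S, edges = segments S, genus = (\<lambda>_. 0)\<rparr>"

lemma model_simps [simp]: "verts (model S) = S" "edges (model S) = segments S" "genus (model S) = (\<lambda>_. 0)"
  by (simp_all add: model_def)

lemma parallel_cases:
  assumes "u \<in> P" "w \<in> P" "t \<noteq> 0" "t *\<^sub>R u = s *\<^sub>R w"
  shows "u = w \<or> u = - w"
proof -
  have "u = (s / t) *\<^sub>R w"
  proof -
    have "u = (1 / t) *\<^sub>R (t *\<^sub>R u)" using assms(3) by simp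
    also have "\<dots> = (s / t) *\<^sub>R w" unfolding assms(4) by simp
    finally show ?thesis .
  qed
  then show ?thesis using parallel_P[of w "s / t"] assms(1,2) by auto
qed

lemma line_point_germs:
  assumes "line_point q"
  obtains u where "u \<in> P" "germs q = {u, - u}"
proof -
  obtain u \<epsilon> where u: "u \<in> P" "\<epsilon> > 0" and loc: "\<And>x. dist x q < \<epsilon> \<Longrightarrow> x \<in> C \<longleftrightarrow> (\<exists>t. x = q + t *\<^sub>R u)"
    using assms unfolding line_point_def by blast
  have u0: "u \<noteq> 0" using u zero_notin_P by auto
  have "germs q = {u, - u}"
  proof (rule equalityI; rule subsetI)
    fix w assume "w \<in> germs q"
    then obtain \<delta> where w: "w \<in> P" "\<delta> > 0" "\<And>t. 0 < t \<Longrightarrow> t < \<delta> \<Longrightarrow> q + t *\<^sub>R w \<in> C"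
      unfolding germs_def by blast
    have w0: "norm w > 0" using w zero_notin_P by auto
    define t where "t = min (\<delta> / 2) (\<epsilon> / (2 * norm w))"
    have t: "0 < t" "t < \<delta>" "t * norm w < \<epsilon>"
      using w(2) u(2) w0 by (auto simp: t_def min_def field_simps split: if_splits)
    have "dist (q + t *\<^sub>R w) q < \<epsilon>" using t by (simp add: dist_norm)
    then obtain s where "q + t *\<^sub>R w = q + s *\<^sub>R u" using loc w(3)[OF t(1,2)] by blast
    then have "t *\<^sub>R w = s *\<^sub>R u" by simp
    then show "w \<in> {u, - u}" using parallel_cases[OF w(1) u(1), of t s] t by blast
  next
    fix w assume w: "w \<in> {u, - u}"
    then have "norm w = norm u" by auto
    have "q + t *\<^sub>R w \<in> C" if "0 < t" "t < \<epsilon> / norm u" for t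
    proof -
      have "dist (q + t *\<^sub>R w) q < \<epsilon>"
        using that u0 \<open>norm w = norm u\<close> by (simp add: dist_norm field_simps)
      moreover have "\<exists>s. q + t *\<^sub>R w = q + s *\<^sub>R u"
        using w by (auto intro: exI[of _ t] exI[of _ "- t"])
      ultimately show ?thesis using loc by blast
    qed
    then show "w \<in> germs q"
      unfolding germs_def using w u u0 uminus_P by (auto intro!: exI[of _ "\<epsilon> / norm u"])
  qed
  then show thesis using that u by blast
qed

lemma vertex_set_superset:
  assumes S: "vertex_set S" and S': "finite S'" "S \<subseteq> S'" "S' \<subseteq> C"
  shows "vertex_set S'"
proof -
  have "finite (germs v)" if "v \<in> S'" for v
  proof (cases "v \<in> S")
    case False
    then have "line_point v" using that S S' unfolding vertex_set_def by blast
    then show ?thesis by (metis line_point_germs finite.emptyI finite.insertI)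
  qed (use S in \<open>auto simp: vertex_set_def\<close>)
  then show ?thesis using assms unfolding vertex_set_def by blast
qed

context
  fixes S :: "'v set"
  assumes S: "vertex_set S"
begin

lemma S_facts: "finite S" "S \<noteq> {}" "S \<subseteq> C" "q \<in> C - S \<Longrightarrow> line_point q" "v \<in> S \<Longrightarrow> finite (germs v)"
  "u \<in> P \<Longrightarrow> \<exists>t. q + t *\<^sub>R u \<notin> C - S"
  using S unfolding vertex_set_def by blast+

text \<open>
  At a point of \<open>C - S\<close> the curve is a line. If \<open>C\<close> also contains further points
  arbitrarily close on the line with direction \<open>u\<close>, then the two lines are the same, so that \<open>C - S\<close> can be followed along \<open>u\<close> through
  the point.
\<close>

lemma line_at:
  assumes q: "q \<in> C - S" and u: "u \<in> P"
    and acc: "\<And>\<delta>. \<delta> > 0 \<Longrightarrow> \<exists>t. t \<noteq> 0 \<and> \<bar>t\<bar> < \<delta> \<and> q + t *\<^sub>R u \<in> C"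
  shows "\<exists>\<delta>>0. \<forall>t. \<bar>t\<bar> < \<delta> \<longrightarrow> q + t *\<^sub>R u \<in> C - S"
proof -
  obtain w \<epsilon> where w: "w \<in> P" "\<epsilon> > 0" and loc: "\<And>x. dist x q < \<epsilon> \<Longrightarrow> x \<in> C \<longleftrightarrow> (\<exists>t. x = q + t *\<^sub>R w)"
    using S_facts(4)[OF q] unfolding line_point_def by blast
  obtain \<eta> where \<eta>: "\<eta> > 0" "\<And>x. dist x q < \<eta> \<Longrightarrow> x \<notin> S"
    using finite_imp_closed[OF S_facts(1)] q unfolding closed_def open_dist
    by (metis ComplD ComplI DiffD2)
  have u0: "norm u > 0" using u zero_notin_P by auto
  define \<delta> where "\<delta> = min \<epsilon> \<eta> / norm u"
  have \<delta>: "\<delta> > 0" using u0 w \<eta> by (simp add: \<delta>_def)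
  have near: "dist (q + t *\<^sub>R u) q < \<epsilon>" "dist (q + t *\<^sub>R u) q < \<eta>" if "\<bar>t\<bar> < \<delta>" for t
    using that u0 by (auto simp: \<delta>_def dist_norm field_simps)
  obtain t where t: "t \<noteq> 0" "\<bar>t\<bar> < \<delta>" "q + t *\<^sub>R u \<in> C" using acc[OF \<delta>] by blast
  then obtain s where "q + t *\<^sub>R u = q + s *\<^sub>R w" using loc near by blast
  then have uw: "u = w \<or> u = - w" using parallel_cases[OF u w(1) t(1), of s] by simp
  have "q + t *\<^sub>R u \<in> C - S" if "\<bar>t\<bar> < \<delta>" for t
  proof -
    have "\<exists>s. q + t *\<^sub>R u = q + s *\<^sub>R w"
      using uw by (auto intro: exI[of _ t] exI[of _ "- t"])
    then show ?thesis using loc near[OF that] \<eta>(2) by blast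
  qed
  then show ?thesis using \<delta> by blast
qed

text \<open>
  The first point at which the ray leaves \<open>C - S\<close> belongs to \<open>C\<close>, as \<open>C\<close> is closed. It cannot belong
  to \<open>C - S\<close>, because there the curve is a line with the direction of arrival, and the ray would go on
  inside \<open>C - S\<close>.
\<close>

lemma run:
  assumes q: "q \<in> C - S" and u: "u \<in> germs q"
  obtains l :: ereal where "0 < l" "\<And>t. 0 \<le> t \<Longrightarrow> ereal t < l \<Longrightarrow> q + t *\<^sub>R u \<in> C - S"
    "l < \<infinity> \<Longrightarrow> q + real_of_ereal l *\<^sub>R u \<in> S"
proof (cases "\<forall>t\<ge>0. q + t *\<^sub>R u \<in> C - S")
  case True
  then show thesis using that[of \<infinity>] by simp
next
  case False
  obtain \<epsilon> where uP: "u \<in> P" and \<epsilon>: "\<epsilon> > 0" "\<And>t. 0 < t \<Longrightarrow> t < \<epsilon> \<Longrightarrow> q + t *\<^sub>R u \<in> C"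
    using u unfolding germs_def by blast
  define T where "T = {t. 0 \<le> t \<and> q + t *\<^sub>R u \<notin> C - S}"
  have T: "T \<noteq> {}" "bdd_below T" using False by (auto simp: T_def)
  define l where "l = Inf T"
  have below: "q + t *\<^sub>R u \<in> C - S" if "0 \<le> t" "t < l" for t
    using that cInf_lower[OF _ T(2), of t] by (force simp: l_def T_def)
  have "\<exists>\<delta>>0. \<forall>t. \<bar>t\<bar> < \<delta> \<longrightarrow> q + t *\<^sub>R u \<in> C - S"
  proof (rule line_at[OF q uP])
    fix \<delta> :: real assume "\<delta> > 0"
    then show "\<exists>t. t \<noteq> 0 \<and> \<bar>t\<bar> < \<delta> \<and> q + t *\<^sub>R u \<in> C"
      using \<epsilon> by (intro exI[of _ "min \<delta> \<epsilon> / 2"]) auto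
  qed
  then obtain \<delta> where \<delta>: "\<delta> > 0" "\<And>t. \<bar>t\<bar> < \<delta> \<Longrightarrow> q + t *\<^sub>R u \<in> C - S" by blast
  have "\<delta> \<le> l"
    unfolding l_def by (rule cInf_greatest[OF T(1)]) (use \<delta>(2) in \<open>force simp: T_def\<close>)
  then have l: "l > 0" using \<delta> by simp
  have "closed {t. q + t *\<^sub>R u \<in> C}"
    using continuous_closed_vimage[OF closed_curve, of "\<lambda>t. q + t *\<^sub>R u"] by (simp add: vimage_def)
  moreover have "{0..<l} \<subseteq> {t. q + t *\<^sub>R u \<in> C}" using below by auto
  ultimately have "closure {0..<l} \<subseteq> {t. q + t *\<^sub>R u \<in> C}" by (simp add: closure_minimal)
  moreover have "l \<in> closure {0..<l}" using l by simp
  ultimately have lC: "q + l *\<^sub>R u \<in> C" by blast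
  have "q + l *\<^sub>R u \<in> S"
  proof (rule ccontr)
    assume "q + l *\<^sub>R u \<notin> S"
    with lC have "q + l *\<^sub>R u \<in> C - S" by simp
    then have "\<exists>\<delta>>0. \<forall>t. \<bar>t\<bar> < \<delta> \<longrightarrow> q + l *\<^sub>R u + t *\<^sub>R u \<in> C - S"
    proof (rule line_at[OF _ uP])
      fix \<delta> :: real assume "\<delta> > 0"
      then show "\<exists>t. t \<noteq> 0 \<and> \<bar>t\<bar> < \<delta> \<and> q + l *\<^sub>R u + t *\<^sub>R u \<in> C"
        using below[of "l - min \<delta> l / 2"] l
        by (intro exI[of _ "- min \<delta> l / 2"]) (auto simp: algebra_simps)
    qed
    then obtain \<eta> where \<eta>: "\<eta> > 0" "\<And>t. \<bar>t\<bar> < \<eta> \<Longrightarrow> q + l *\<^sub>R u + t *\<^sub>R u \<in> C - S" by blast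
    have "l + \<eta> \<le> t" if "t \<in> T" for t
    proof (rule ccontr)
      assume "\<not> l + \<eta> \<le> t"
      moreover have "l \<le> t" using that cInf_lower[OF _ T(2)] by (simp add: l_def)
      ultimately have "q + l *\<^sub>R u + (t - l) *\<^sub>R u \<in> C - S" using \<eta>(2) by simp
      then show False using that by (simp add: T_def algebra_simps)
    qed
    then have "l + \<eta> \<le> l" unfolding l_def[symmetric] by (metis T(1) cInf_greatest l_def)
    then show False using \<eta> by simp
  qed
  then show thesis using that[of "ereal l"] l below by simp
qed

lemma segments_cross:
  assumes "segment S p u l" "segment S p' u l'"
    and "0 < t" "ereal t < l" "0 < t'" "ereal t' < l'" and eq: "p + t *\<^sub>R u = p' + t' *\<^sub>R u"
  shows "p = p'"
proof -
  have "\<not> t < t'" if "segment S p u l" "segment S p' u l'" "0 < t" "ereal t' < l'" "p + t *\<^sub>R u = p' + t' *\<^sub>R u"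
    for p p' t t' l l'
  proof
    assume "t < t'"
    then have "ereal (t' - t) < l'" using that(3,4) by (cases l') auto
    then have "p' + (t' - t) *\<^sub>R u \<in> C - S" using segment_inner[OF that(2), of "t' - t"] \<open>t < t'\<close> by simp
    moreover have "p' + (t' - t) *\<^sub>R u = p" using that(5) by (simp add: algebra_simps)
    ultimately show False using segment_start[OF that(1)] by simp
  qed
  from this[of p l p' l' t t'] this[of p' l' p l t' t] have "t = t'"
    using assms by (metis less_linear)
  then show ?thesis using eq by simp
qed

text \<open>
  Both segments follow the line that the curve is at the common point. With equal directions they
  start at the same vertex, as neither has a vertex in its interior. With opposite directions they
  would be one bounded edge traversed in both ways, but only one of these directions is positive.
\<close>

lemma segments_meet:
  assumes e: "e \<in> segments S" and e': "e' \<in> segments S" and q: "q \<in> cell e" "q \<in> cell e'"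
  shows "e = e'"
proof -
  obtain p u l where 1: "e = Edge l (\<lambda>t. p + t *\<^sub>R u)" "segment S p u l" "l < \<infinity> \<longrightarrow> pos u"
    using e unfolding segments_def by blast
  obtain p' u' l' where 2: "e' = Edge l' (\<lambda>t. p' + t *\<^sub>R u')" "segment S p' u' l'" "l' < \<infinity> \<longrightarrow> pos u'"
    using e' unfolding segments_def by blast
  obtain t where t: "0 < t" "ereal t < l" "q = p + t *\<^sub>R u" using q(1) unfolding 1(1) cell_def by auto
  obtain t' where t': "0 < t'" "ereal t' < l'" "q = p' + t' *\<^sub>R u'" using q(2) unfolding 2(1) cell_def by auto
  have qC: "q \<in> C - S" using segment_inner[OF 1(2) t(1,2)] t(3) by simp
  have "u' = u \<or> u' = - u"
  proof -
    obtain w where w: "w \<in> P" "germs q = {w, - w}" using line_point_germs S_facts(4)[OF qC] by blast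
    have "- u \<in> germs q" "- u' \<in> germs q"
      using segment_backward_germ[OF 1(2) t(1,2)] segment_backward_germ[OF 2(2) t'(1,2)] t(3) t'(3) by simp_all
    then have "- u = w \<or> - u = - w" "- u' = w \<or> - u' = - w" unfolding w(2) by blast+
    then show ?thesis by (metis minus_minus)
  qed
  then show "e = e'"
  proof
    assume u': "u' = u"
    have p: "p = p'" by (rule segments_cross[OF 1(2) 2(2)[unfolded u'] t(1,2) t'(1,2)]) (use t(3) t'(3) u' in simp)
    have "l = l'" by (rule segment_length_unique[OF 1(2) 2(2)[unfolded u' p[symmetric]]])
    then show ?thesis using 1(1) 2(1) p u' by simp
  next
    assume u': "u' = - u"
    have pp: "p + (t + t') *\<^sub>R u = p'" "p' + (t + t') *\<^sub>R u' = p"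
      using t(3) t'(3) u' by (simp_all add: algebra_simps)
    have "l < \<infinity>"
    proof (rule ccontr)
      assume "\<not> l < \<infinity>"
      then show False
        using segment_inner[OF 1(2), of "t + t'"] segment_start[OF 2(2)] t(1) t'(1) by (simp add: pp)
    qed
    moreover have "l' < \<infinity>"
    proof (rule ccontr)
      assume "\<not> l' < \<infinity>"
      then show False
        using segment_inner[OF 2(2), of "t + t'"] segment_start[OF 1(2)] t(1) t'(1) by (simp add: pp)
    qed
    ultimately show ?thesis using 1(3) 2(3) u' pos_uminus[OF segment_direction[OF 1(2)]] by auto
  qed
qed

lemma segment_edge:
  assumes "segment S p u l" "l < \<infinity> \<Longrightarrow> pos u"
  shows "Edge l (\<lambda>t. p + t *\<^sub>R u) \<in> segments S"
  unfolding segments_def using assms by blast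

text \<open>
  Both traversals of an edge are described alike, by start, direction and length.
\<close>

lemma dedges_model:
  assumes "d \<in> dedges (model S)"
  shows "segment S (dpar d 0) (direction d) (len (fst d))"
    and "dpar d t = dpar d 0 + t *\<^sub>R direction d"
    and "cell (fst d) = dpar d ` {t. 0 < t \<and> ereal t < len (fst d)}"
    and "snd d \<or> len (fst d) < \<infinity>"
    and "direction (fst d, b) = (if b = snd d then direction d else - direction d)"
proof -
  obtain e b' where d: "d = (e, b')" by (cases d)
  have e: "e \<in> segments S" "b' \<or> len e < \<infinity>" using assms unfolding d dedges_def by auto
  obtain p u l where 1: "e = Edge l (\<lambda>t. p + t *\<^sub>R u)" "segment S p u l"
    using e(1) unfolding segments_def by blast
  have dir: "direction (e, True) = u" "direction (e, False) = - u"
    by (simp_all add: direction_def 1(1) algebra_simps)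
  show "snd d \<or> len (fst d) < \<infinity>" using e by (simp add: d)
  show "direction (fst d, b) = (if b = snd d then direction d else - direction d)"
    using dir by (cases b; cases b') (simp_all add: d)
  have "segment S (dpar d 0) (direction d) (len (fst d)) \<and> (\<forall>t. dpar d t = dpar d 0 + t *\<^sub>R direction d) \<and>
      cell (fst d) = dpar d ` {t. 0 < t \<and> ereal t < len (fst d)}"
  proof (cases b')
    case True
    then show ?thesis using 1(2) dir by (auto simp: d cell_def 1(1))
  next
    case False
    then obtain r where r: "l = ereal r" "r > 0"
      using e(2) segment_length[OF 1(2)] 1(1) by (cases l) auto
    have "(\<lambda>t. r - t) ` {t. 0 < t \<and> t < r} = {t. 0 < t \<and> t < r}"
      by (auto simp: image_iff intro!: exI[of _ "r - _"])
    then have "(\<lambda>t. p + t *\<^sub>R u) ` {t. 0 < t \<and> t < r} = (\<lambda>t. p + t *\<^sub>R u) ` (\<lambda>t. r - t) ` {t. 0 < t \<and> t < r}"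
      by simp
    then have "cell e = dpar (e, False) ` {t. 0 < t \<and> t < r}"
      by (simp add: cell_def 1(1) r image_image)
    then show ?thesis using False dir segment_reverse[of S p u r] 1(2)
      by (simp add: d 1(1) r algebra_simps)
  qed
  then show "segment S (dpar d 0) (direction d) (len (fst d))"
    "dpar d t = dpar d 0 + t *\<^sub>R direction d"
    "cell (fst d) = dpar d ` {t. 0 < t \<and> ereal t < len (fst d)}"
    by blast+
qed

lemma segments_dedges: "e \<in> segments S \<Longrightarrow> (e, True) \<in> dedges (model S)"
  by (simp add: dedges_def)

lemma dedges_unique:
  assumes "d \<in> dedges (model S)" "d' \<in> dedges (model S)" "dpar d 0 = dpar d' 0" "direction d = direction d'"
  shows "d = d'"
proof -
  have len: "len (fst d) = len (fst d')"
    using segment_length_unique dedges_model(1)[OF assms(1)] dedges_model(1)[OF assms(2)] assms(3,4) by metis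
  have par: "dpar d = dpar d'"
  proof
    fix t show "dpar d t = dpar d' t"
      by (simp only: dedges_model(2)[OF assms(1), of t] dedges_model(2)[OF assms(2), of t] assms(3,4))
  qed
  obtain t where "0 < t" "ereal t < len (fst d)"
    using segment_length[OF dedges_model(1)[OF assms(1)]] ereal_dense2[of 0 "len (fst d)"] by (metis ereal_less(2))
  then have "dpar d t \<in> cell (fst d)" "dpar d t \<in> cell (fst d')"
    unfolding dedges_model(3)[OF assms(1)] dedges_model(3)[OF assms(2)] len par by blast+
  moreover have "fst d \<in> segments S" "fst d' \<in> segments S" using assms by (auto simp: dedges_def)
  ultimately have f: "fst d = fst d'" using segments_meet by blast
  have "direction d \<noteq> - direction d"
  proof
    assume "direction d = - direction d"
    then have "2 *\<^sub>R direction d = 0" by (metis add.right_inverse scaleR_2)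
    then show False using segment_direction[OF dedges_model(1)[OF assms(1)]] zero_notin_P by simp
  qed
  then have "snd d = snd d'"
    using dedges_model(5)[OF assms(1), of "snd d'"] assms(4) unfolding f by (metis prod.collapse)
  with f show ?thesis by (simp add: prod_eq_iff)
qed

lemma metric_graph_model: "metric_graph (model S)"
proof -
  have "inj_on (\<lambda>e. (par e 0, direction (e, True))) (segments S)"
    using dedges_unique[OF segments_dedges segments_dedges] by (auto simp: inj_on_def)
  moreover have "(par e 0, direction (e, True)) \<in> Sigma S germs" if "e \<in> segments S" for e
    using dedges_model(1)[OF segments_dedges[OF that]] segment_start segment_germ by fastforce
  then have "(\<lambda>e. (par e 0, direction (e, True))) ` segments S \<subseteq> Sigma S germs" by blast
  ultimately have "finite (segments S)"
    using S_facts(1,5) by (meson finite_SigmaI finite_imageD finite_subset)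
  moreover have "0 < len e \<and> inj_on (par e) {t. 0 < t \<and> ereal t < len e} \<and>
        cell e \<inter> S = {} \<and> par e 0 \<in> S \<and> (len e < \<infinity> \<longrightarrow> par e (real_of_ereal (len e)) \<in> S)"
    if "e \<in> segments S" for e
  proof -
    obtain p u l where 1: "e = Edge l (\<lambda>t. p + t *\<^sub>R u)" "segment S p u l"
      using \<open>e \<in> segments S\<close> unfolding segments_def by blast
    have "u \<noteq> 0" using segment_direction[OF 1(2)] zero_notin_P by auto
    then have "inj_on (par e) {t. 0 < t \<and> ereal t < len e}" by (simp add: 1(1) inj_on_def)
    moreover have "cell e \<inter> S = {}" using segment_inner[OF 1(2)] by (force simp: 1(1) cell_def)
    ultimately show ?thesis
      using segment_start[OF 1(2)] segment_length[OF 1(2)] segment_end[OF 1(2)] by (simp add: 1(1))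
  qed
  moreover have "cell e \<inter> cell e' = {}" if "e \<in> segments S" "e' \<in> segments S" "e \<noteq> e'" for e e'
    using segments_meet[OF that(1,2)] that(3) by blast
  ultimately show ?thesis
    unfolding metric_graph_def model_simps using S_facts(1,2) by blast
qed

text \<open>
  This turns sums over the edges at a vertex of the model into sums over the directions in which the
  curve leaves the vertex, and the latter can be read off from the equation of the curve.
\<close>

lemma bij_betw_outgoing_germs:
  assumes v: "v \<in> S"
  shows "bij_betw direction (outgoing (model S) v) (germs v)"
proof -
  have "d = d'" if "d \<in> outgoing (model S) v" "d' \<in> outgoing (model S) v" "direction d = direction d'" for d d'
    by (rule dedges_unique) (use that in \<open>simp_all add: outgoing_def\<close>)
  moreover have "direction d \<in> germs v" if "d \<in> outgoing (model S) v" for d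
    using segment_germ[OF dedges_model(1), of d] that by (simp add: outgoing_def)
  moreover have "\<exists>d\<in>outgoing (model S) v. direction d = u" if u: "u \<in> germs v" for u
  proof -
    obtain \<epsilon> where uP: "u \<in> P" and \<epsilon>: "\<epsilon> > 0" "\<And>t. 0 < t \<Longrightarrow> t < \<epsilon> \<Longrightarrow> v + t *\<^sub>R u \<in> C"
      using u unfolding germs_def by blast
    have u0: "norm u > 0" using uP zero_notin_P by auto
    have "closed (S - {v})" using S_facts(1) by (simp add: finite_imp_closed)
    then obtain \<eta> where \<eta>: "\<eta> > 0" "\<And>x. dist x v < \<eta> \<Longrightarrow> x \<notin> S - {v}"
      unfolding closed_def open_dist by (metis ComplD ComplI DiffD2 singletonI)
    \<comment> \<open>Up to \<open>t0\<close> the ray stays in the curve and meets no vertex.\<close>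
    define t0 where "t0 = min \<epsilon> (\<eta> / norm u) / 2"
    have t0: "0 < t0" "t0 < \<epsilon>" "t0 * norm u < \<eta>"
      using \<epsilon>(1) \<eta>(1) u0 by (auto simp: t0_def min_def field_simps)
    have start: "v + t *\<^sub>R u \<in> C - S" if "0 < t" "t \<le> t0" for t
    proof -
      have "t * norm u \<le> t0 * norm u" using that by (intro mult_right_mono) auto
      then have "dist (v + t *\<^sub>R u) v < \<eta>" using that t0 by (simp add: dist_norm)
      then have "v + t *\<^sub>R u \<notin> S - {v}" by (rule \<eta>(2))
      moreover have "v + t *\<^sub>R u \<noteq> v" using that u0 by auto
      ultimately show ?thesis using \<epsilon>(2)[of t] that t0 by auto
    qed
    define q where "q = v + t0 *\<^sub>R u"
    have q: "q \<in> C - S" using start[of t0] t0 by (simp add: q_def)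
    have "q + t *\<^sub>R u \<in> C" if "0 < t" "t < \<epsilon> - t0" for t
      using \<epsilon>(2)[of "t0 + t"] that t0 by (simp add: q_def algebra_simps)
    then have "u \<in> germs q" using uP t0 unfolding germs_def by (auto intro!: exI[of _ "\<epsilon> - t0"])
    then obtain l where l: "0 < l" "\<And>t. 0 \<le> t \<Longrightarrow> ereal t < l \<Longrightarrow> q + t *\<^sub>R u \<in> C - S"
      "l < \<infinity> \<Longrightarrow> q + real_of_ereal l *\<^sub>R u \<in> S"
      using run[OF q] by blast
    have inner: "v + t *\<^sub>R u \<in> C - S" if "0 < t" "ereal t < ereal t0 + l" for t
    proof (cases "t \<le> t0")
      case False
      have "ereal (t - t0) < l" using that(2) by (cases l) auto
      then show ?thesis using l(2)[of "t - t0"] False by (simp add: q_def algebra_simps)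
    qed (use start that in blast)
    have "ereal t0 + l < \<infinity> \<Longrightarrow> v + real_of_ereal (ereal t0 + l) *\<^sub>R u \<in> S"
      using l(1,3) by (cases l) (auto simp: q_def algebra_simps)
    moreover have "0 < ereal t0 + l" using t0 l(1) by (cases l) auto
    ultimately have seg: "segment S v u (ereal t0 + l)" using v uP inner by (auto simp: segment_def)
    \<comment> \<open>A bounded edge in a negative direction belongs to the model with the opposite orientation.\<close>
    show ?thesis
    proof (cases "l < \<infinity> \<and> \<not> pos u")
      case False
      let ?e = "Edge (ereal t0 + l) (\<lambda>t. v + t *\<^sub>R u)"
      have "?e \<in> segments S" by (rule segment_edge[OF seg]) (use False in auto)
      then have "(?e, True) \<in> outgoing (model S) v" by (simp add: outgoing_def dedges_def)
      moreover have "direction (?e, True) = u" by (simp add: direction_def)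
      ultimately show ?thesis by blast
    next
      case True
      then obtain r where r: "l = ereal r" using l(1) by (cases l) auto
      define p where "p = v + (t0 + r) *\<^sub>R u"
      let ?e = "Edge (ereal (t0 + r)) (\<lambda>t. p + t *\<^sub>R (- u))"
      have "segment S p (- u) (ereal (t0 + r))"
        using segment_reverse[of S v u "t0 + r"] seg by (simp add: r p_def)
      then have "?e \<in> segments S" by (rule segment_edge) (use True pos_uminus[OF uP] in simp)
      then have "(?e, False) \<in> outgoing (model S) v" by (simp add: outgoing_def dedges_def p_def)
      moreover have "direction (?e, False) = u" by (simp add: direction_def algebra_simps)
      ultimately show ?thesis by blast
    qed
  qed
  ultimately show ?thesis unfolding bij_betw_def inj_on_def by blast
qed

text \<open>
  Starting from a point of \<open>C - S\<close>, one of the two directions of the curve leads to a vertex, since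
  the whole line is not contained in \<open>C - S\<close>. The edge that leaves this vertex in the reverse direction
  passes through the point.
\<close>

lemma points_model: "points (model S) = C"
proof (intro equalityI subsetI)
  fix x assume "x \<in> points (model S)"
  then consider "x \<in> S" | e where "e \<in> segments S" "x \<in> cell e" by (auto simp: points_def)
  then show "x \<in> C"
  proof cases
    case 1
    then show ?thesis using S_facts(3) by blast
  next
    case 2
    note d = dedges_model[OF segments_dedges[OF 2(1)], unfolded fst_conv]
    obtain t where t: "0 < t" "ereal t < len e" "x = dpar (e, True) t" using 2(2) by (auto simp: cell_def)
    show ?thesis unfolding t(3) d(2)[of t] using segment_inner[OF d(1) t(1,2)] by blast
  qed
next
  fix q assume "q \<in> C"
  show "q \<in> points (model S)"
  proof (cases "q \<in> S")
    case False
    then have q: "q \<in> C - S" using \<open>q \<in> C\<close> by blast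
    obtain w where w: "w \<in> P" "germs q = {w, - w}" using line_point_germs S_facts(4)[OF q] by blast
    obtain r u where u: "u \<in> germs q" and r: "0 < r" "q + r *\<^sub>R u \<in> S"
      and run: "\<And>t. 0 \<le> t \<Longrightarrow> t < r \<Longrightarrow> q + t *\<^sub>R u \<in> C - S"
    proof -
      have "w \<in> germs q" "- w \<in> germs q" unfolding w(2) by simp_all
      obtain l where l: "0 < l" "\<And>t. 0 \<le> t \<Longrightarrow> ereal t < l \<Longrightarrow> q + t *\<^sub>R w \<in> C - S"
        "l < \<infinity> \<Longrightarrow> q + real_of_ereal l *\<^sub>R w \<in> S"
        using run[OF q \<open>w \<in> germs q\<close>] by blast
      obtain k where k: "0 < k" "\<And>t. 0 \<le> t \<Longrightarrow> ereal t < k \<Longrightarrow> q + t *\<^sub>R (- w) \<in> C - S"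
        "k < \<infinity> \<Longrightarrow> q + real_of_ereal k *\<^sub>R (- w) \<in> S"
        using run[OF q \<open>- w \<in> germs q\<close>] by blast
      have "\<not> (l = \<infinity> \<and> k = \<infinity>)"
      proof
        assume lk: "l = \<infinity> \<and> k = \<infinity>"
        have "q + t *\<^sub>R w \<in> C - S" for t
          using l(2)[of t] k(2)[of "- t"] lk by (cases "0 \<le> t") auto
        then show False using S_facts(6)[OF w(1)] by blast
      qed
      then consider "l < \<infinity>" | "k < \<infinity>" by auto
      then show thesis
      proof cases
        case 1
        then obtain r where "l = ereal r" using l(1) by (cases l) auto
        then show thesis using that[OF \<open>w \<in> germs q\<close>, of r] l by simp
      next
        case 2
        then obtain r where "k = ereal r" using k(1) by (cases k) auto
        then show thesis using that[OF \<open>- w \<in> germs q\<close>, of r] k by simp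
      qed
    qed
    define p where "p = q + r *\<^sub>R u"
    have bck: "p + t *\<^sub>R (- u) = q + (r - t) *\<^sub>R u" for t by (simp add: p_def algebra_simps)
    have "- u \<in> germs p"
      unfolding germs_def using uminus_P u r(1) run bck
      by (intro CollectI conjI exI[of _ r]) (auto simp: germs_def)
    then have "- u \<in> direction ` outgoing (model S) p"
      using bij_betw_outgoing_germs[of p] r(2) by (simp add: bij_betw_def p_def)
    then obtain d where "d \<in> dedges (model S)" "dpar d 0 = p" "direction d = - u"
      by (auto simp: outgoing_def)
    then have d: "segment S p (- u) (len (fst d))" "dpar d r = q"
        "cell (fst d) = dpar d ` {t. 0 < t \<and> ereal t < len (fst d)}" "fst d \<in> segments S"
      using dedges_model(1,3)[of d] dedges_model(2)[of d r] by (auto simp: p_def dedges_def)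
    have "ereal r < len (fst d)"
    proof (rule ccontr)
      assume "\<not> ereal r < len (fst d)"
      then obtain s where s: "len (fst d) = ereal s" "0 < s" "s \<le> r"
        using segment_length[OF d(1)] by (cases "len (fst d)") auto
      then have "q + (r - s) *\<^sub>R u \<in> S" using segment_end[OF d(1)] bck[of s] by simp
      then show False using run[of "r - s"] s by simp
    qed
    then have "q \<in> cell (fst d)" unfolding d(3) using d(2) r(1) by blast
    then show ?thesis using d(4) by (auto simp: points_def)
  qed (simp add: points_def)
qed

lemma segment_edge_dom:
  assumes "e \<in> segments S" "t \<in> edge_dom e"
  shows "par e t \<in> C"
proof -
  note d = dedges_model[OF segments_dedges[OF assms(1)], unfolded fst_conv]
  have t: "0 \<le> t" "ereal t \<le> len e" using assms(2) by (auto simp: edge_dom_def)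
  have par: "par e t = dpar (e, True) 0 + t *\<^sub>R direction (e, True)" using d(2)[of t] by simp
  consider "t = 0" | "0 < t" "ereal t < len e" | "ereal t = len e" using t by fastforce
  then show ?thesis
  proof cases
    case 1
    then show ?thesis using segment_start[OF d(1)] S_facts(3) by auto
  next
    case 2
    then show ?thesis unfolding par using segment_inner[OF d(1)] by blast
  next
    case 3
    then have "len e < \<infinity>" "real_of_ereal (len e) = t" by (auto simp flip: 3)
    then show ?thesis unfolding par using segment_end[OF d(1)] S_facts(3) by auto
  qed
qed

lemma par_segment_at: "e \<in> segments S \<Longrightarrow> par e t = par e 0 + t *\<^sub>R direction (e, True)"
  using dedges_model(2)[OF segments_dedges, of e t] by simp

lemma par_segment: "e \<in> segments S \<Longrightarrow> par e = (\<lambda>t. par e 0 + t *\<^sub>R direction (e, True))"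
  using par_segment_at by (rule ext)

text \<open>
  A subset of \<open>C\<close> whose traces on the finitely many edges are closed is a finite union of points and of
  images of closed sets under injective affine maps, hence closed.
\<close>

lemma graph_topology_model: "graph_topology (model S) = top_of_set C"
proof -
  have "openin (graph_topology (model S)) U \<longleftrightarrow> openin (top_of_set C) U" for U
  proof
    assume U: "openin (top_of_set C) U"
    then obtain W where W: "open W" "U = C \<inter> W" by (auto simp: openin_open)
    have "openin (top_of_set (edge_dom e)) {t \<in> edge_dom e. par e t \<in> U}" if e: "e \<in> segments S" for e
    proof -
      have "open (par e -` W)"
        by (subst par_segment[OF e]) (intro continuous_open_vimage W(1) continuous_intros)
      moreover have "{t \<in> edge_dom e. par e t \<in> U} = edge_dom e \<inter> par e -` W"
        using segment_edge_dom[OF e] W(2) by auto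
      ultimately show ?thesis by (auto simp: openin_open)
    qed
    then show "openin (graph_topology (model S)) U"
      using W(2) by (simp add: openin_graph_topology points_model)
  next
    assume "openin (graph_topology (model S)) U"
    then have U: "U \<subseteq> C" "\<And>e. e \<in> segments S \<Longrightarrow> openin (top_of_set (edge_dom e)) {t \<in> edge_dom e. par e t \<in> U}"
      by (auto simp: openin_graph_topology points_model)
    have "closed (par e ` {t \<in> edge_dom e. par e t \<notin> U})" if e: "e \<in> segments S" for e
    proof -
      let ?T = "{t \<in> edge_dom e. par e t \<notin> U}" and ?u = "direction (e, True)"
      have "closedin (top_of_set (edge_dom e)) (edge_dom e - {t \<in> edge_dom e. par e t \<in> U})"
        using closedin_diff[OF closedin_topspace U(2)[OF e]] by simp
      moreover have "edge_dom e - {t \<in> edge_dom e. par e t \<in> U} = ?T" by blast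
      ultimately have "closed ?T" using closedin_closed_trans closed_edge_dom by metis
      moreover have "?u \<noteq> 0"
        using segment_direction[OF dedges_model(1)[OF segments_dedges[OF e]]] zero_notin_P by auto
      then have "linear (\<lambda>t. t *\<^sub>R ?u)" "inj (\<lambda>t. t *\<^sub>R ?u)"
        by (auto simp: linear_iff scaleR_add_left inj_def)
      ultimately have "closed ((\<lambda>t. t *\<^sub>R ?u) ` ?T)" by (rule closed_injective_linear_image)
      then have "closed ((+) (par e 0) ` (\<lambda>t. t *\<^sub>R ?u) ` ?T)" by (rule closed_translation)
      moreover have "par e ` ?T = (+) (par e 0) ` (\<lambda>t. t *\<^sub>R ?u) ` ?T"
        unfolding image_image using par_segment[OF e] by metis
      ultimately show ?thesis by simp
    qed
    moreover have "finite (segments S)" using metric_graph_model by (simp add: metric_graph_def)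
    ultimately have cl: "closed ((S - U) \<union> (\<Union>e\<in>segments S. par e ` {t \<in> edge_dom e. par e t \<notin> U}))"
      using S_facts(1) by (intro closed_Un finite_imp_closed closed_UN) auto
    have "C - U = (S - U) \<union> (\<Union>e\<in>segments S. par e ` {t \<in> edge_dom e. par e t \<notin> U})"
    proof (intro equalityI subsetI)
      fix x assume "x \<in> C - U"
      then have "x \<notin> U" "x \<in> S \<or> (\<exists>e\<in>segments S. x \<in> cell e)"
        using points_model by (auto simp: points_def)
      then show "x \<in> (S - U) \<union> (\<Union>e\<in>segments S. par e ` {t \<in> edge_dom e. par e t \<notin> U})"
        by (force simp: cell_def edge_dom_def)
    next
      fix x assume "x \<in> (S - U) \<union> (\<Union>e\<in>segments S. par e ` {t \<in> edge_dom e. par e t \<notin> U})"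
      then show "x \<in> C - U" using S_facts(3) segment_edge_dom by auto
    qed
    then have "closed (C - U)" using cl by simp
    moreover have "U = C \<inter> - (C - U)" using U(1) by blast
    ultimately show "openin (top_of_set C) U" unfolding openin_open by (metis open_Compl)
  qed
  then show ?thesis by (simp add: topology_eq)
qed

text \<open>
  An inner point of a segment lies on an edge of \<open>X\<close>, which has the same direction there up to sign.
  The segment stays on this edge, as it meets no vertex of \<open>X\<close> in its interior.
\<close>

lemma refines_model:
  assumes X: "metric_graph X" "points X = C" "verts X \<subseteq> S" "genus X = (\<lambda>_. 0)"
    and straight: "\<And>e. e \<in> edges X \<Longrightarrow> \<exists>p u. u \<in> P \<and> (\<forall>t\<in>edge_dom e. par e t = p + t *\<^sub>R u)"
  shows "refines (model S) X"
  unfolding refines_def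
proof (intro conjI ballI)
  fix e assume "e \<in> edges (model S)"
  then have e: "e \<in> segments S" by simp
  define p u where "p = par e 0" and "u = direction (e, True)"
  have seg: "segment S p u (len e)"
    using dedges_model(1)[OF segments_dedges[OF e]] by (simp add: p_def u_def)
  have par: "par e t = p + t *\<^sub>R u" for t unfolding p_def u_def by (rule par_segment_at[OF e])
  have u: "u \<in> P" using segment_direction[OF seg] .
  obtain t0 where t0: "0 < t0" "ereal t0 < len e"
    using segment_length[OF seg] ereal_dense2[of 0 "len e"] by (metis ereal_less(2))
  define q where "q = p + t0 *\<^sub>R u"
  have q: "q \<in> C - S" unfolding q_def by (rule segment_inner[OF seg t0])
  then have "q \<in> points X" "q \<notin> verts X" using X(2,3) by auto
  then obtain e' where e': "e' \<in> edges X" "q \<in> cell e'" by (auto simp: points_def)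
  obtain p' u' where u': "u' \<in> P" and par': "\<And>t. t \<in> edge_dom e' \<Longrightarrow> par e' t = p' + t *\<^sub>R u'"
    using straight[OF e'(1)] by blast
  obtain s0 where s0: "0 < s0" "ereal s0 < len e'" "q = par e' s0" using e'(2) by (auto simp: cell_def)
  have dom: "s \<in> edge_dom e'" if "0 \<le> s" "ereal s \<le> len e'" for s using that by (simp add: edge_dom_def)
  have q': "q = p' + s0 *\<^sub>R u'" using s0 dom par' by simp
  have in_C: "p' + s *\<^sub>R u' \<in> C" if "0 < s" "ereal s < len e'" for s
  proof -
    have "par e' s \<in> cell e'" using that by (auto simp: cell_def)
    then have "par e' s \<in> C" unfolding X(2)[symmetric] points_def using e'(1) by blast
    then show ?thesis using par' dom that by simp
  qed
  have "- u' \<in> germs q"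
  proof -
    have "q + s *\<^sub>R (- u') \<in> C" if "0 < s" "s < s0" for s
    proof -
      have "ereal (s0 - s) < len e'" using that s0(2) by (cases "len e'") auto
      then show ?thesis using in_C[of "s0 - s"] that by (simp add: q' algebra_simps)
    qed
    then show ?thesis using s0(1) uminus_P[OF u'] by (auto simp: germs_def)
  qed
  moreover have "- u \<in> germs q" unfolding q_def by (rule segment_backward_germ[OF seg t0])
  moreover obtain w where "germs q = {w, - w}" using line_point_germs S_facts(4)[OF q] by blast
  ultimately have "- u = w \<or> - u = - w" "- u' = w \<or> - u' = - w" by blast+
  then have "u = u' \<or> u = - u'" by (metis minus_minus)
  then obtain \<sigma> :: real where \<sigma>: "\<sigma> \<in> {1, -1}" "u = \<sigma> *\<^sub>R u'" by (metis insertCI scaleR_minus1_left scaleR_one)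
  have shift: "p + t *\<^sub>R u = p' + (s0 + \<sigma> * (t - t0)) *\<^sub>R u'" for t
    using q' by (simp add: q_def \<sigma>(2) algebra_simps)
  have ends: "p' \<in> S" "len e' < \<infinity> \<Longrightarrow> p' + real_of_ereal (len e') *\<^sub>R u' \<in> S"
  proof -
    have l: "0 < len e'" using X(1) e'(1) by (auto simp: metric_graph_def)
    have "par e' 0 \<in> verts X" using X(1) e'(1) by (auto simp: metric_graph_def)
    moreover have "ereal 0 \<le> len e'" using l by (simp add: zero_ereal_def[symmetric])
    ultimately show "p' \<in> S" using par'[OF dom[of 0]] X(3) by auto
    assume fin: "len e' < \<infinity>"
    then have "par e' (real_of_ereal (len e')) \<in> verts X" using X(1) e'(1) by (auto simp: metric_graph_def)
    moreover obtain r where "len e' = ereal r" using fin l by (cases "len e'") auto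
    ultimately show "p' + real_of_ereal (len e') *\<^sub>R u' \<in> S"
      using par'[OF dom[of r]] l X(3) by auto
  qed
  \<comment> \<open>The segment cannot leave the edge, because it would have to pass through an end vertex.\<close>
  have stay: "0 < s0 + \<sigma> * (t - t0) \<and> ereal (s0 + \<sigma> * (t - t0)) < len e'" if t: "0 < t" "ereal t < len e" for t
  proof (rule ccontr)
    assume out: "\<not> (0 < s0 + \<sigma> * (t - t0) \<and> ereal (s0 + \<sigma> * (t - t0)) < len e')"
    have between: "ereal r < len e \<and> 0 < r" if "min t t0 \<le> r" "r \<le> max t t0" for r
      using that t t0 by (cases "len e") (auto simp: min_def max_def split: if_splits)
    have "\<exists>r. min t t0 \<le> r \<and> r \<le> max t t0 \<and> p + r *\<^sub>R u \<in> S"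
    proof (cases "0 < s0 + \<sigma> * (t - t0)")
      case False
      define r where "r = t0 - \<sigma> * s0"
      have "min t t0 \<le> r \<and> r \<le> max t t0" using False \<sigma>(1) s0(1) by (auto simp: r_def)
      moreover have "s0 + \<sigma> * (r - t0) = 0" using \<sigma>(1) by (auto simp: r_def)
      then have "p + r *\<^sub>R u = p'" unfolding shift by simp
      ultimately show ?thesis using ends(1) by metis
    next
      case True
      then obtain k where k: "len e' = ereal k" "k \<le> s0 + \<sigma> * (t - t0)" using out s0(2) by (cases "len e'") auto
      define r where "r = t0 + \<sigma> * (k - s0)"
      have "min t t0 \<le> r \<and> r \<le> max t t0" using \<sigma>(1) s0(2) k by (auto simp: r_def)
      moreover have "s0 + \<sigma> * (r - t0) = k" using \<sigma>(1) by (auto simp: r_def)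
      then have "p + r *\<^sub>R u = p' + k *\<^sub>R u'" unfolding shift by simp
      ultimately show ?thesis using ends(2) k(1) by (metis ereal_less(4) real_of_ereal.simps(1) less_ereal.simps(4))
    qed
    then show False using between segment_inner[OF seg] by blast
  qed
  define a where "a = s0 - \<sigma> * t0"
  have "a + \<sigma> * t \<in> edge_dom e' \<and> par e t = par e' (a + \<sigma> * t)" if t: "t \<in> edge_dom e" for t
  proof -
    have "a + \<sigma> * t \<in> edge_dom e'"
    proof -
      \<comment> \<open>The ends of the segment are limits of inner points, and the domain of an edge is closed.\<close>
      have cl: "closed ((\<lambda>t. a + \<sigma> * t) -` edge_dom e')"
        by (intro continuous_closed_vimage closed_edge_dom continuous_intros)
      have sub: "(\<lambda>r. t0 + r * (t - t0)) ` {0..<1} \<subseteq> (\<lambda>t. a + \<sigma> * t) -` edge_dom e'"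
      proof (intro image_subsetI, simp only: vimage_eq)
        fix r :: real assume r: "r \<in> {0..<1}"
        have t': "0 \<le> t" "ereal t \<le> len e" using t by (auto simp: edge_dom_def)
        let ?t = "t0 + r * (t - t0)"
        have conv: "?t = (1 - r) * t0 + r * t" by (simp add: algebra_simps)
        have "0 < (1 - r) * t0" "0 \<le> r * t" using r t0(1) t'(1) by auto
        then have pos: "0 < ?t" unfolding conv by linarith
        have "ereal ?t < len e"
        proof (cases "len e")
          case (real k)
          then have "(1 - r) * t0 < (1 - r) * k" "r * t \<le> r * k" using r t0(2) t'(2) by (auto intro: mult_left_mono)
          then show ?thesis unfolding conv real by (simp add: algebra_simps)
        qed (use t0 in auto)
        from stay[OF pos this] show "a + \<sigma> * ?t \<in> edge_dom e'"
          by (auto simp: edge_dom_def a_def algebra_simps intro: less_imp_le)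
      qed
      have "closed ((\<lambda>r. t0 + r * (t - t0)) -` (\<lambda>t. a + \<sigma> * t) -` edge_dom e')"
        by (intro continuous_closed_vimage cl continuous_intros)
      then have "closure {0..<1} \<subseteq> (\<lambda>r. t0 + r * (t - t0)) -` (\<lambda>t. a + \<sigma> * t) -` edge_dom e'"
        using sub by (intro closure_minimal) auto
      moreover have "(1::real) \<in> closure {0..<1}" by simp
      ultimately have "1 \<in> (\<lambda>r. t0 + r * (t - t0)) -` (\<lambda>t. a + \<sigma> * t) -` edge_dom e'" by blast
      then show ?thesis by simp
    qed
    moreover have "par e t = p' + (a + \<sigma> * t) *\<^sub>R u'"
      unfolding par shift by (simp add: a_def algebra_simps)
    ultimately show ?thesis using par' by simp
  qed
  then show "\<exists>e'\<in>edges X. \<exists>a. \<exists>\<sigma>\<in>{1, - 1}. \<forall>t\<in>edge_dom e. a + \<sigma> * t \<in> edge_dom e' \<and> par e t = par e' (a + \<sigma> * t)"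
    using e'(1) \<sigma>(1) by blast
qed (use X metric_graph_model points_model in auto)

lemma segments_straight:
  assumes "e \<in> segments S"
  shows "\<exists>p u. u \<in> P \<and> (\<forall>t\<in>edge_dom e. par e t = p + t *\<^sub>R u)"
  using par_segment_at[OF assms] segment_direction[OF dedges_model(1)[OF segments_dedges[OF assms]]]
  by (intro exI[of _ "par e 0"] exI[of _ "direction (e, True)"]) blast

end

text \<open>
  The common refinement is the model whose vertices are those of both models.
\<close>

lemma same_metric_graph_model:
  assumes S: "vertex_set S" and X: "metric_graph X" "points X = C" "genus X = (\<lambda>_. 0)"
    and straight: "\<And>e. e \<in> edges X \<Longrightarrow> \<exists>p u. u \<in> P \<and> (\<forall>t\<in>edge_dom e. par e t = p + t *\<^sub>R u)"
  shows "same_metric_graph X (model S)"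
proof -
  have "verts X \<subseteq> C" unfolding X(2)[symmetric] points_def by blast
  moreover have "finite (verts X)" using X(1) by (simp add: metric_graph_def)
  ultimately have V: "verts X \<subseteq> C" "finite (verts X)" .
  have S': "vertex_set (S \<union> verts X)"
    using vertex_set_superset[OF S, of "S \<union> verts X"] S_facts(1,3)[OF S] V by simp
  have "refines (model (S \<union> verts X)) X"
    by (rule refines_model[OF S' X(1,2) _ X(3) straight]) auto
  moreover have "refines (model (S \<union> verts X)) (model S)"
    by (rule refines_model[OF S' metric_graph_model[OF S] points_model[OF S]]) (use segments_straight[OF S] in auto)
  ultimately show ?thesis unfolding same_metric_graph_def by blast
qed

end

section \<open>Smooth plane tropical curves\<close>

lemma lattice_point_nth [simp]: "lattice_point a $ 1 = real (fst a)" "lattice_point a $ 2 = real (snd a)"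
  by (simp_all add: lattice_point_def vector_2)

lemma inner_real2: "x \<bullet> y = x $ 1 * y $ 1 + x $ 2 * y $ 2" for x y :: "real ^ 2"
  by (simp add: inner_vec_def sum_2)

lemma real2_eq_iff: "x = y \<longleftrightarrow> x $ 1 = y $ 1 \<and> x $ 2 = y $ 2" for x y :: "real ^ 2"
  by (simp add: vec_eq_iff forall_2)

lemma lattice_point_eq_iff [simp]: "lattice_point a = lattice_point b \<longleftrightarrow> a = b"
  by (auto simp: real2_eq_iff prod_eq_iff)

text \<open>
  Twice the signed area of the triangle with corners \<open>a\<close>, \<open>b\<close>, \<open>e\<close>.
\<close>

definition det3 :: "nat \<times> nat \<Rightarrow> nat \<times> nat \<Rightarrow> nat \<times> nat \<Rightarrow> int" where
  "det3 a b e = (int (fst b) - int (fst a)) * (int (snd e) - int (snd a))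
     - (int (snd b) - int (snd a)) * (int (fst e) - int (fst a))"

text \<open>
  The vector \<open>b - a\<close> rotated clockwise by a right angle. For a triangle \<open>a b e\<close> of positive orientation it is
  the outer normal of the side \<open>a b\<close>, which is the direction of the edge of the curve dual to this
  side.
\<close>

definition edge_normal :: "nat \<times> nat \<Rightarrow> nat \<times> nat \<Rightarrow> real ^ 2" where
  "edge_normal a b = vector [real (snd b) - real (snd a), real (fst a) - real (fst b)]"

lemma edge_normal_nth [simp]: "edge_normal a b $ 1 = real (snd b) - real (snd a)"
  "edge_normal a b $ 2 = real (fst a) - real (fst b)"
  by (simp_all add: edge_normal_def vector_2)

lemma det3_cycle: "det3 b e a = det3 a b e" and det3_swap: "det3 b a e = - det3 a b e"
  by (simp_all add: det3_def algebra_simps)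

lemma inner_edge_normal: "lattice_point e \<bullet> edge_normal a b = lattice_point a \<bullet> edge_normal a b - real_of_int (det3 a b e)"
  by (simp add: inner_real2 det3_def algebra_simps)

lemma inner_edge_normal_same: "lattice_point b \<bullet> edge_normal a b = lattice_point a \<bullet> edge_normal a b"
  by (simp add: inner_real2 algebra_simps)

text \<open>
  The determinant is an integral combination of the coordinates of \<open>b - a\<close>, so a common divisor of
  these divides 1.
\<close>

lemma primitive_edge_normal:
  assumes "\<bar>det3 a b e\<bar> = 1" shows "primitive (edge_normal a b)"
proof -
  have "coprime (int (snd b) - int (snd a)) (int (fst a) - int (fst b))"
  proof (rule coprimeI)
    fix k assume k: "k dvd int (snd b) - int (snd a)" "k dvd int (fst a) - int (fst b)"
    have "k dvd (int (fst a) - int (fst b)) * (- (int (snd e) - int (snd a)))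
       - (int (snd b) - int (snd a)) * (int (fst e) - int (fst a))"
      by (rule dvd_diff[OF dvd_mult2[OF k(2)] dvd_mult2[OF k(1)]])
    also have "\<dots> = det3 a b e" by (simp add: det3_def algebra_simps)
    finally have "k dvd \<bar>det3 a b e\<bar>" by simp
    then show "is_unit k" unfolding assms .
  qed
  then show ?thesis
    unfolding primitive_def edge_normal_def
    by (intro exI[of _ "int (snd b) - int (snd a)"] exI[of _ "int (fst a) - int (fst b)"]) simp
qed

lemma orthogonal_edge_normal:
  assumes "a \<noteq> b" "lattice_point a \<bullet> x = lattice_point b \<bullet> x"
  shows "\<exists>t. x = t *\<^sub>R edge_normal a b"
proof (cases "fst a = fst b")
  case True
  then have "snd a \<noteq> snd b" using assms(1) by (simp add: prod_eq_iff)
  then have "x $ 2 = 0" "real (snd b) - real (snd a) \<noteq> 0" using assms(2) True by (auto simp: inner_real2)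
  then show ?thesis using True
    by (intro exI[of _ "x $ 1 / (real (snd b) - real (snd a))"]) (simp add: real2_eq_iff)
next
  case False
  then have ne: "real (fst a) - real (fst b) \<noteq> 0" by simp
  have "(real (fst a) - real (fst b)) * x $ 1 = (real (snd b) - real (snd a)) * x $ 2"
    using assms(2) by (simp add: inner_real2 algebra_simps)
  then show ?thesis using ne
    by (intro exI[of _ "x $ 2 / (real (fst a) - real (fst b))"]) (simp add: real2_eq_iff field_simps)
qed

lemma det3_orthogonal:
  assumes "det3 a b e \<noteq> 0" "lattice_point a \<bullet> x = lattice_point b \<bullet> x" "lattice_point a \<bullet> x = lattice_point e \<bullet> x"
  shows "x = 0"
proof -
  have "a \<noteq> b" using assms(1) by (auto simp: det3_def)
  then obtain t where t: "x = t *\<^sub>R edge_normal a b" using orthogonal_edge_normal assms(2) by blast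
  have "t * real_of_int (det3 a b e) = 0"
  proof -
    have "t * (lattice_point a \<bullet> edge_normal a b) = t * (lattice_point e \<bullet> edge_normal a b)"
      using assms(3) unfolding t inner_scaleR_right .
    also have "lattice_point e \<bullet> edge_normal a b = lattice_point a \<bullet> edge_normal a b - real_of_int (det3 a b e)"
      by (rule inner_edge_normal)
    finally show ?thesis by (simp add: right_diff_distrib)
  qed
  then show ?thesis using assms(1) t by simp
qed

definition positive_direction :: "real ^ 2 \<Rightarrow> bool" where
  "positive_direction u \<longleftrightarrow> u $ 2 > 0 \<or> (u $ 2 = 0 \<and> u $ 1 > 0)"

lemma primitive_nonzero: "\<not> primitive 0"
proof
  assume "primitive 0"
  then obtain a b :: int where "coprime a b" "(0 :: real ^ 2) = vector [real_of_int a, real_of_int b]"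
    unfolding primitive_def by blast
  then have "coprime a b" "a = 0" "b = 0" by (simp_all add: real2_eq_iff vector_2)
  then show False by simp
qed

lemma primitive_uminus: "primitive u \<Longrightarrow> primitive (- u)"
  unfolding primitive_def
  by (metis (no_types, opaque_lifting) coprime_minus_left_iff coprime_minus_right_iff of_int_minus real2_eq_iff vector_2 vector_uminus_component)

lemma primitive_parallel:
  assumes "primitive u" "primitive (r *\<^sub>R u)"
  shows "r = 1 \<or> r = -1"
proof -
  obtain a b :: int where u: "coprime a b" "u = vector [real_of_int a, real_of_int b]"
    using assms(1) unfolding primitive_def by blast
  obtain a' b' :: int where u': "coprime a' b'" "r *\<^sub>R u = vector [real_of_int a', real_of_int b']"
    using assms(2) unfolding primitive_def by blast
  have ab: "real_of_int a' = r * real_of_int a" "real_of_int b' = r * real_of_int b"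
    using u u' by (simp_all add: real2_eq_iff vector_2)
  then have "real_of_int (a * b') = real_of_int (a' * b)" by simp
  then have "a * b' = a' * b" by (simp only: of_int_eq_iff)
  then have "\<bar>a\<bar> * \<bar>b'\<bar> = \<bar>a'\<bar> * \<bar>b\<bar>" by (simp flip: abs_mult)
  then have "\<bar>a\<bar> = \<bar>a'\<bar> \<and> \<bar>b'\<bar> = \<bar>b\<bar>"
    using coprime_crossproduct_int[of a b a' b'] u u' by (simp add: mult.commute)
  then have abs: "\<bar>real_of_int a'\<bar> = \<bar>real_of_int a\<bar>" "\<bar>real_of_int b'\<bar> = \<bar>real_of_int b\<bar>" by linarith+
  have "a \<noteq> 0 \<or> b \<noteq> 0" using u(1) by auto
  then have "\<bar>r\<bar> = 1" using abs unfolding ab abs_mult by auto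
  then show ?thesis by linarith
qed

lemma primitive_nth_int:
  fixes u :: "real ^ 2"
  assumes "primitive u" shows "\<exists>k::int. u $ 2 = real_of_int k"
  using assms unfolding primitive_def by (auto simp: vector_2)

text \<open>
  The second condition says that the Newton polygon is two-dimensional.
\<close>

locale smooth_plane_curve =
  fixes A :: "(nat \<times> nat) set" and c :: "nat \<times> nat \<Rightarrow> real"
  assumes finite_A: "finite A"
    and not_collinear: "w \<noteq> 0 \<Longrightarrow> \<exists>a\<in>A. lattice_point a \<bullet> w \<noteq> k"
    and unimodular: "unimodular_triangulation (dual_subdivision A c)"
begin

abbreviation M :: "real ^ 2 \<Rightarrow> (nat \<times> nat) set" where "M \<equiv> maximal_terms A c"

abbreviation C :: "(real ^ 2) set" where "C \<equiv> plane_tropical_curve A c"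

lemma A_nonempty: "A \<noteq> {}"
proof -
  have "vector [1, 0] \<noteq> (0 :: real ^ 2)" by (simp add: real2_eq_iff vector_2)
  then show ?thesis using not_collinear by blast
qed

lemma maximal_terms_iff: "a \<in> M p \<longleftrightarrow> a \<in> A \<and> (\<forall>b\<in>A. trop_term c p b \<le> trop_term c p a)"
proof -
  have "trop_term c p a = trop_poly A c p \<longleftrightarrow> (\<forall>b\<in>A. trop_term c p b \<le> trop_term c p a)" if a: "a \<in> A"
  proof
    assume "trop_term c p a = trop_poly A c p"
    then show "\<forall>b\<in>A. trop_term c p b \<le> trop_term c p a"
      unfolding trop_poly_def using finite_A by simp
  next
    assume "\<forall>b\<in>A. trop_term c p b \<le> trop_term c p a"
    then show "trop_term c p a = trop_poly A c p"
      unfolding trop_poly_def using finite_A a by (intro Max_eqI[symmetric]) auto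
  qed
  then show ?thesis by (auto simp: maximal_terms_def)
qed

lemma M_facts: "M p \<subseteq> A" "finite (M p)" "M p \<noteq> {}"
proof -
  show "M p \<subseteq> A" by (auto simp: maximal_terms_def)
  then show "finite (M p)" using finite_A finite_subset by blast
  have "trop_poly A c p \<in> trop_term c p ` A"
    unfolding trop_poly_def using finite_A A_nonempty by (intro Max_in) auto
  then obtain a where "a \<in> A" "trop_poly A c p = trop_term c p a" by blast
  then have "a \<in> M p" by (simp add: maximal_terms_def)
  then show "M p \<noteq> {}" by blast
qed

lemma M_tie: "a \<in> M p \<Longrightarrow> b \<in> M p \<Longrightarrow> trop_term c p a = trop_term c p b"
  by (simp add: maximal_terms_def)

lemma trop_term_shift: "trop_term c (p + x) a = trop_term c p a + lattice_point a \<bullet> x"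
  by (simp add: trop_term_def inner_add_right)

lemma lattice_triangle_measure:
  "measure lebesgue (convex hull {lattice_point a, lattice_point b, lattice_point e}) = \<bar>real_of_int (det3 a b e)\<bar> / 2"
proof -
  have "compact (convex hull {lattice_point a, lattice_point b, lattice_point e})"
    by (intro compact_convex_hull finite_imp_compact) auto
  then have "convex hull {lattice_point a, lattice_point b, lattice_point e} \<in> sets borel"
    by (simp add: borel_compact)
  then have "measure lebesgue (convex hull {lattice_point a, lattice_point b, lattice_point e})
      = measure lborel (convex hull {lattice_point a, lattice_point b, lattice_point e})"
    by (simp add: measure_completion)
  then show ?thesis by (simp add: content_triangle det3_def algebra_simps abs_minus_commute)
qed

text \<open>
  The barycentric coordinates of a lattice point are quotients of determinants by \<open>det3 x y z\<close>, hence
  integers between 0 and 1.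
\<close>

lemma unimodular_lattice_triangle:
  assumes "\<bar>det3 x y z\<bar> = 1"
    and m: "lattice_point m \<in> convex hull {lattice_point x, lattice_point y, lattice_point z}"
  shows "m \<in> {x, y, z}"
proof -
  obtain r s t where rst: "0 \<le> r" "0 \<le> s" "0 \<le> t" "r + s + t = (1::real)"
    and eq: "lattice_point m = r *\<^sub>R lattice_point x + s *\<^sub>R lattice_point y + t *\<^sub>R lattice_point z"
    using m by (auto simp: convex_hull_3)
  have c: "real (fst m) = r * real (fst x) + s * real (fst y) + t * real (fst z)"
      "real (snd m) = r * real (snd x) + s * real (snd y) + t * real (snd z)"
    using arg_cong[OF eq, of "\<lambda>v :: real ^ 2. v $ 1"] arg_cong[OF eq, of "\<lambda>v :: real ^ 2. v $ 2"] by simp_all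
  have r: "r = 1 - s - t" using rst by simp
  have d: "real_of_int (det3 m y z) = r * real_of_int (det3 x y z)"
      "real_of_int (det3 x m z) = s * real_of_int (det3 x y z)"
      "real_of_int (det3 x y m) = t * real_of_int (det3 x y z)"
    by (simp_all add: det3_def c r algebra_simps)
  have z1: "k = 0 \<or> k = 1" if "0 \<le> k" "k \<le> 1" "real_of_int i = k * real_of_int (det3 x y z)" for k i
  proof -
    have "real_of_int (det3 x y z) = 1 \<or> real_of_int (det3 x y z) = -1" using assms(1) by linarith
    then have "k = real_of_int i \<or> k = real_of_int (- i)" using that(3) by auto
    then obtain j :: int where "k = real_of_int j" by blast
    then show ?thesis using that(1,2) by auto
  qed
  have "r = 0 \<or> r = 1" "s = 0 \<or> s = 1" "t = 0 \<or> t = 1" using z1 d rst by auto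
  then have "(r = 1 \<and> s = 0 \<and> t = 0) \<or> (r = 0 \<and> s = 1 \<and> t = 0) \<or> (r = 0 \<and> s = 0 \<and> t = 1)"
    using rst(4) by auto
  then show ?thesis using eq by auto
qed

text \<open>
  The cell dual to \<open>p\<close> has interior points, so it is a triangle of area 1/2. All exponents in \<open>M p\<close> are
  lattice points of it, and it has no lattice points besides its corners.
\<close>

lemma M_triangle:
  assumes abe: "a \<in> M p" "b \<in> M p" "e \<in> M p" "det3 a b e \<noteq> 0"
  shows "M p = {a, b, e} \<and> \<bar>det3 a b e\<bar> = 1"
proof -
  define Q where "Q = convex hull (lattice_point ` M p)"
  let ?T = "convex hull {lattice_point a, lattice_point b, lattice_point e}"
  have T: "?T \<subseteq> Q" unfolding Q_def using abe by (intro hull_mono) auto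
  have "interior ?T \<noteq> {}"
  proof
    assume "interior ?T = {}"
    then have "negligible ?T" by (simp add: negligible_convex_interior)
    then have "measure lebesgue ?T = 0" by (simp add: negligible_imp_measure0)
    then show False using abe(4) by (simp add: lattice_triangle_measure)
  qed
  then have "interior Q \<noteq> {}" using interior_mono[OF T] by blast
  moreover have "Q \<in> dual_subdivision A c" by (simp add: Q_def dual_subdivision_def)
  ultimately obtain x y z where Q: "Q = convex hull {lattice_point x, lattice_point y, lattice_point z}"
    "measure lebesgue Q = 1 / 2"
    using unimodular unfolding unimodular_triangulation_def by blast
  then have det: "\<bar>det3 x y z\<bar> = 1"
    using lattice_triangle_measure[of x y z] by (metis of_int_abs of_int_eq_1_iff divide_cancel_right zero_neq_numeral)
  have sub: "M p \<subseteq> {x, y, z}"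
  proof
    fix m assume "m \<in> M p"
    then have "lattice_point m \<in> Q" unfolding Q_def by (simp add: hull_inc)
    then show "m \<in> {x, y, z}" using unimodular_lattice_triangle[OF det] Q(1) by simp
  qed
  have "a \<noteq> b" "b \<noteq> e" "a \<noteq> e" using abe(4) by (auto simp: det3_def)
  then have "card {a, b, e} = 3" by simp
  moreover have "card {x, y, z} \<le> 3" by (simp add: card_insert_if)
  moreover have "{a, b, e} \<subseteq> {x, y, z}" using sub abe by blast
  ultimately have eq: "{a, b, e} = {x, y, z}"
    by (intro card_seteq) simp_all
  have "\<bar>det3 a b e\<bar> = 1"
  proof -
    have "lattice_point ` {a, b, e} = lattice_point ` {x, y, z}" by (simp only: eq)
    then have "measure lebesgue ?T = 1 / 2" using Q by simp
    then show ?thesis unfolding lattice_triangle_measure by simp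
  qed
  moreover have "M p = {a, b, e}" using sub abe unfolding eq[symmetric] by blast
  ultimately show ?thesis by blast
qed

text \<open>
  Moving from \<open>p\<close> along the line on which \<open>a\<close> and \<open>b\<close> tie, in a direction in which some other term gains
  on these two, one reaches a point where a further term \<open>e\<close> catches up for the
  first time. There the dual cell is a unimodular triangle, which contains all of \<open>M p\<close>.
\<close>

lemma M_segment:
  assumes ab: "a \<in> M p" "b \<in> M p" "a \<noteq> b" and col: "\<And>e. e \<in> M p \<Longrightarrow> det3 a b e = 0"
  obtains e t where "M p = {a, b}" "M (p + t *\<^sub>R edge_normal a b) = {a, b, e}" "\<bar>det3 a b e\<bar> = 1"
proof -
  let ?w = "edge_normal a b" and ?v = "\<lambda>x. lattice_point x \<bullet> edge_normal a b"
  have "?w \<noteq> 0" using ab(3) by (auto simp: real2_eq_iff prod_eq_iff)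
  then obtain a' where a': "a' \<in> A" "?v a' \<noteq> ?v a" using not_collinear by blast
  \<comment> \<open>The sign of the direction in which the term of \<open>a'\<close> gains on those of \<open>a\<close> and \<open>b\<close>.\<close>
  define \<sigma> :: real where "\<sigma> = (if ?v a' > ?v a then 1 else - 1)"
  have \<sigma>: "\<sigma> * ?v a' > \<sigma> * ?v a" using a'(2) by (simp add: \<sigma>_def)
  define B where "B = {x \<in> A. \<sigma> * ?v x > \<sigma> * ?v a}"
  \<comment> \<open>The time at which the term of \<open>x\<close> catches up with that of \<open>a\<close>.\<close>
  define h where "h x = (trop_term c p a - trop_term c p x) / (\<sigma> * ?v x - \<sigma> * ?v a)" for x
  have "a' \<in> B" using a' \<sigma> by (simp add: B_def)
  then have B: "finite B" "B \<noteq> {}" using finite_A by (simp add: B_def, blast)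
  obtain e where e: "e \<in> B" "\<And>x. x \<in> B \<Longrightarrow> h e \<le> h x"
    using arg_min_if_finite(1)[OF B, of h] arg_min_least[OF B, of _ h] by blast
  define s where "s = h e"
  define p' where "p' = p + (s * \<sigma>) *\<^sub>R ?w"
  have val: "trop_term c p' x = trop_term c p x + s * (\<sigma> * ?v x)" for x
    by (simp add: p'_def trop_term_shift)
  have max_a: "trop_term c p x \<le> trop_term c p a" if "x \<in> A" for x using ab(1) that by (simp add: maximal_terms_iff)
  have s0: "0 \<le> s" using e(1) max_a by (auto simp: s_def h_def B_def)
  have le: "trop_term c p' x \<le> trop_term c p' a" if "x \<in> A" for x
  proof (cases "x \<in> B")
    case True
    then have "s \<le> h x" "0 < \<sigma> * ?v x - \<sigma> * ?v a" using e(2) by (auto simp: s_def B_def)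
    then have "s * (\<sigma> * ?v x - \<sigma> * ?v a) \<le> trop_term c p a - trop_term c p x"
      by (simp add: h_def pos_le_divide_eq)
    then show ?thesis by (simp add: val algebra_simps)
  next
    case False
    then have "\<sigma> * ?v x \<le> \<sigma> * ?v a" using that by (simp add: B_def not_less)
    then have "s * (\<sigma> * ?v x) \<le> s * (\<sigma> * ?v a)" using s0 by (rule mult_left_mono)
    then show ?thesis using max_a[OF that] by (simp add: val)
  qed
  have maxI: "x \<in> M p'" if "x \<in> A" "trop_term c p' x = trop_term c p' a" for x
    using le that by (simp add: maximal_terms_iff)
  have sub: "M p \<subseteq> M p'"
  proof
    fix x assume x: "x \<in> M p"
    then have "?v x = ?v a" using col[OF x] inner_edge_normal[of x a b] by simp
    then have "trop_term c p' x = trop_term c p' a" using M_tie[OF x ab(1)] by (simp add: val)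
    then show "x \<in> M p'" using x M_facts(1) maxI by blast
  qed
  have "e \<in> M p'"
  proof (rule maxI)
    show "e \<in> A" using e(1) by (simp add: B_def)
    have ne: "\<sigma> * ?v e - \<sigma> * ?v a \<noteq> 0" using e(1) by (auto simp: B_def)
    have "s * (\<sigma> * ?v e - \<sigma> * ?v a) = trop_term c p a - trop_term c p e"
      by (simp only: s_def h_def times_divide_eq_left nonzero_mult_div_cancel_right[OF ne])
    then show "trop_term c p' e = trop_term c p' a" by (simp add: val algebra_simps)
  qed
  have de: "det3 a b e \<noteq> 0" using e(1) inner_edge_normal[of e a b] by (auto simp: B_def)
  have M': "M p' = {a, b, e} \<and> \<bar>det3 a b e\<bar> = 1"
    using M_triangle[OF _ _ \<open>e \<in> M p'\<close> de] sub ab by blast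
  moreover have "e \<notin> M p" using col de by blast
  ultimately have "M p = {a, b}" using sub ab(1,2) by blast
  then show thesis using that[of "s * \<sigma>" e] M' unfolding p'_def by blast
qed

lemma curve_iff: "p \<in> C \<longleftrightarrow> (\<exists>a\<in>M p. \<exists>b\<in>M p. a \<noteq> b)"
proof -
  have "card (M p) \<ge> 2 \<longleftrightarrow> \<not> card (M p) \<le> Suc 0" by linarith
  then show ?thesis
    unfolding plane_tropical_curve_def mem_Collect_eq card_le_Suc0_iff_eq[OF M_facts(2)] by blast
qed

text \<open>
  In the second case the triangle \<open>a b e\<close> at some other point of the same line serves two purposes: it
  shows that the direction of the line is primitive, and it provides a trivalent point on the
  line.
\<close>

lemma curve_cases:
  assumes "p \<in> C"
  obtains (vertex) a b e where "M p = {a, b, e}" "det3 a b e = 1"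
  | (edge) a b e t where "M p = {a, b}" "a \<noteq> b" "M (p + t *\<^sub>R edge_normal a b) = {a, b, e}" "\<bar>det3 a b e\<bar> = 1"
proof -
  obtain a b where ab: "a \<in> M p" "b \<in> M p" "a \<noteq> b" using assms curve_iff by blast
  show thesis
  proof (cases "\<exists>e\<in>M p. det3 a b e \<noteq> 0")
    case True
    then obtain e where e: "e \<in> M p" "det3 a b e \<noteq> 0" by blast
    then have t: "M p = {a, b, e}" "\<bar>det3 a b e\<bar> = 1" using M_triangle[OF ab(1,2)] by blast+
    have "det3 a b e = 1 \<or> det3 b a e = 1"
      using t(2) det3_swap[of b a e] by linarith
    moreover have "M p = {b, a, e}" using t(1) by (simp add: insert_commute)
    ultimately show thesis using vertex t(1) by blast
  next
    case False
    show thesis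
    proof (rule M_segment[OF ab])
      show "det3 a b e = 0" if "e \<in> M p" for e using False that by blast
    next
      fix e t assume "M p = {a, b}" "M (p + t *\<^sub>R edge_normal a b) = {a, b, e}" "\<bar>det3 a b e\<bar> = 1"
      then show thesis using edge ab(3) by blast
    qed
  qed
qed

lemma trop_term_diff: "trop_term c x a = trop_term c q a + lattice_point a \<bullet> (x - q)"
  using trop_term_shift[of q "x - q" a] by simp

text \<open>
  Near \<open>q\<close>, the terms that are not maximal at \<open>q\<close> are too small to matter, and the others compete with
  their linear parts.
\<close>

lemma M_near:
  obtains \<epsilon> where "\<epsilon> > 0"
    "\<And>x. dist x q < \<epsilon> \<Longrightarrow> M x = {a \<in> M q. \<forall>b\<in>M q. lattice_point b \<bullet> (x - q) \<le> lattice_point a \<bullet> (x - q)}"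
proof -
  obtain a0 where a0: "a0 \<in> M q" using M_facts(3) by blast
  define U where "U = (\<Inter>b\<in>A - M q. {x. trop_term c x b < trop_term c x a0})"
  have "open U"
    unfolding U_def trop_term_def
    by (intro open_INT open_Collect_less continuous_intros ballI) (use finite_A in auto)
  moreover have "q \<in> U"
  proof -
    have "trop_term c q b < trop_term c q a0" if b: "b \<in> A - M q" for b
    proof -
      have "\<not> (\<forall>d\<in>A. trop_term c q d \<le> trop_term c q b)" using b maximal_terms_iff by blast
      then obtain d where "d \<in> A" "trop_term c q b < trop_term c q d" by (meson not_le)
      moreover have "trop_term c q d \<le> trop_term c q a0" using a0 \<open>d \<in> A\<close> by (simp add: maximal_terms_iff)
      ultimately show ?thesis by simp
    qed
    then show ?thesis by (simp add: U_def)
  qed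
  ultimately obtain \<epsilon> where \<epsilon>: "\<epsilon> > 0" "\<And>x. dist x q < \<epsilon> \<Longrightarrow> x \<in> U" unfolding open_dist by blast
  have "M x = {a \<in> M q. \<forall>b\<in>M q. lattice_point b \<bullet> (x - q) \<le> lattice_point a \<bullet> (x - q)}" (is "_ = ?R")
    if x: "dist x q < \<epsilon>" for x
  proof -
    have less: "trop_term c x b < trop_term c x a0" if "b \<in> A" "b \<notin> M q" for b
      using \<epsilon>(2)[OF x] that by (simp add: U_def)
    have cmp: "trop_term c x b \<le> trop_term c x a \<longleftrightarrow> lattice_point b \<bullet> (x - q) \<le> lattice_point a \<bullet> (x - q)"
      if "a \<in> M q" "b \<in> M q" for a b
      using M_tie[OF that] trop_term_diff[of x a q] trop_term_diff[of x b q] by simp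
    show ?thesis
    proof (intro equalityI subsetI)
      fix a assume a: "a \<in> M x"
      then have "a \<in> M q"
        using less[of a] a0 M_facts(1) unfolding maximal_terms_iff[of a x] by (meson not_le subsetD)
      moreover have "trop_term c x b \<le> trop_term c x a" if "b \<in> M q" for b
        using a M_facts(1)[of q] that unfolding maximal_terms_iff by blast
      ultimately show "a \<in> ?R" using cmp by simp
    next
      fix a assume a: "a \<in> ?R"
      then have aq: "a \<in> M q" by simp
      have le: "trop_term c x b \<le> trop_term c x a" if "b \<in> M q" for b using a cmp[OF aq that] that by simp
      have "trop_term c x b \<le> trop_term c x a" if "b \<in> A" for b
        using le[of b] le[OF a0] less[OF that] by (cases "b \<in> M q") auto
      then show "a \<in> M x" using aq M_facts(1) unfolding maximal_terms_iff[of a x] by blast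
    qed
  qed
  then show thesis using that \<epsilon>(1) by blast
qed

text \<open>
  Near \<open>q\<close> the curve is the translate to \<open>q\<close> of the fan of all \<open>x\<close> with this property.
\<close>

abbreviation top_tied :: "real ^ 2 \<Rightarrow> real ^ 2 \<Rightarrow> bool" where
  "top_tied q x \<equiv> \<exists>a\<in>M q. \<exists>b\<in>M q. a \<noteq> b \<and> lattice_point a \<bullet> x = lattice_point b \<bullet> x \<and>
     (\<forall>e\<in>M q. lattice_point e \<bullet> x \<le> lattice_point a \<bullet> x)"

lemma curve_near:
  obtains \<epsilon> where "\<epsilon> > 0"
    "\<And>x. dist x q < \<epsilon> \<Longrightarrow> x \<in> C \<longleftrightarrow> top_tied q (x - q)"
proof -
  obtain \<epsilon> where \<epsilon>: "\<epsilon> > 0"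
    "\<And>x. dist x q < \<epsilon> \<Longrightarrow> M x = {a \<in> M q. \<forall>b\<in>M q. lattice_point b \<bullet> (x - q) \<le> lattice_point a \<bullet> (x - q)}"
    by (rule M_near) blast
  have "x \<in> C \<longleftrightarrow> top_tied q (x - q)" if "dist x q < \<epsilon>" for x
  proof
    assume "x \<in> C"
    then obtain a b where ab: "a \<in> M x" "b \<in> M x" "a \<noteq> b" using curve_iff by blast
    then have "a \<in> M q" "b \<in> M q" "\<forall>e\<in>M q. lattice_point e \<bullet> (x - q) \<le> lattice_point a \<bullet> (x - q)"
        "\<forall>e\<in>M q. lattice_point e \<bullet> (x - q) \<le> lattice_point b \<bullet> (x - q)"
      unfolding \<epsilon>(2)[OF that] by blast+
    moreover from this have "lattice_point a \<bullet> (x - q) = lattice_point b \<bullet> (x - q)" by (intro antisym) blast+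
    ultimately show "\<exists>a\<in>M q. \<exists>b\<in>M q. a \<noteq> b \<and> lattice_point a \<bullet> (x - q) = lattice_point b \<bullet> (x - q) \<and>
       (\<forall>e\<in>M q. lattice_point e \<bullet> (x - q) \<le> lattice_point a \<bullet> (x - q))"
      using ab(3) by blast
  next
    assume "\<exists>a\<in>M q. \<exists>b\<in>M q. a \<noteq> b \<and> lattice_point a \<bullet> (x - q) = lattice_point b \<bullet> (x - q) \<and>
       (\<forall>e\<in>M q. lattice_point e \<bullet> (x - q) \<le> lattice_point a \<bullet> (x - q))"
    then obtain a b where ab: "a \<in> M q" "b \<in> M q" "a \<noteq> b"
        "lattice_point a \<bullet> (x - q) = lattice_point b \<bullet> (x - q)"
        "\<forall>e\<in>M q. lattice_point e \<bullet> (x - q) \<le> lattice_point a \<bullet> (x - q)"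
      by blast
    then have "a \<in> M x" "b \<in> M x" unfolding \<epsilon>(2)[OF that] by simp_all
    then show "x \<in> C" using ab(3) curve_iff by blast
  qed
  then show thesis using that \<epsilon>(1) by blast
qed

lemma closed_C: "closed C"
  unfolding closed_def open_dist
proof
  fix q assume q: "q \<in> - C"
  obtain \<epsilon> where \<epsilon>: "\<epsilon> > 0" "\<And>x. dist x q < \<epsilon> \<Longrightarrow> x \<in> C \<longleftrightarrow> top_tied q (x - q)"
    by (rule curve_near) blast
  have "x \<in> - C" if "dist x q < \<epsilon>" for x using \<epsilon>(2)[OF that] q curve_iff[of q] by blast
  then show "\<exists>e>0. \<forall>y. dist y q < e \<longrightarrow> y \<in> - C" using \<epsilon>(1) by blast
qed

lemma straight_curve_C: "straight_curve C (Collect primitive) positive_direction"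
proof
  show "closed C" by (rule closed_C)
  show "0 \<notin> Collect primitive" using primitive_nonzero by simp
  show "- u \<in> Collect primitive" if "u \<in> Collect primitive" for u using that primitive_uminus by simp
  show "r = 1 \<or> r = - 1" if "u \<in> Collect primitive" "r *\<^sub>R u \<in> Collect primitive" for u r
    using that primitive_parallel by simp
  show "positive_direction (- u) \<longleftrightarrow> \<not> positive_direction u" if "u \<in> Collect primitive" for u
  proof -
    have "u \<noteq> 0" using that primitive_nonzero by auto
    then have "u $ 1 \<noteq> 0 \<or> u $ 2 \<noteq> 0" by (simp add: real2_eq_iff)
    then show ?thesis by (auto simp: positive_direction_def)
  qed
qed

end

sublocale smooth_plane_curve \<subseteq> straight_curve "plane_tropical_curve A c" "Collect primitive" positive_direction
  by (rule straight_curve_C)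

context smooth_plane_curve begin

lemma edge_point:
  assumes M: "M q = {a, b}" and ab: "a \<noteq> b" and det: "\<bar>det3 a b e\<bar> = 1"
  shows "line_point q" and "germs q = {edge_normal a b, - edge_normal a b}"
proof -
  let ?u = "edge_normal a b"
  obtain \<epsilon> where \<epsilon>: "\<epsilon> > 0" "\<And>x. dist x q < \<epsilon> \<Longrightarrow> x \<in> C \<longleftrightarrow> top_tied q (x - q)"
    by (rule curve_near) blast
  have loc: "x \<in> C \<longleftrightarrow> (\<exists>t. x = q + t *\<^sub>R ?u)" if x: "dist x q < \<epsilon>" for x
  proof -
    have "x \<in> C \<longleftrightarrow> lattice_point a \<bullet> (x - q) = lattice_point b \<bullet> (x - q)"
      unfolding \<epsilon>(2)[OF x] M using ab by auto
    also have "\<dots> \<longleftrightarrow> (\<exists>t. x - q = t *\<^sub>R ?u)"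
      using orthogonal_edge_normal[OF ab, of "x - q"] inner_edge_normal_same[of b a]
      by (metis inner_scaleR_right)
    also have "\<dots> \<longleftrightarrow> (\<exists>t. x = q + t *\<^sub>R ?u)" by (simp add: algebra_simps)
    finally show ?thesis .
  qed
  have u: "?u \<in> Collect primitive" using primitive_edge_normal[OF det] by simp
  show lp: "line_point q" unfolding line_point_def using u \<epsilon>(1) loc by blast
  obtain w where w: "germs q = {w, - w}" using line_point_germs[OF lp] by blast
  have u0: "norm ?u > 0" using u zero_notin_P by auto
  have "?u \<in> germs q"
  proof -
    have "q + t *\<^sub>R ?u \<in> C" if "0 < t" "t < \<epsilon> / norm ?u" for t
    proof -
      have "dist (q + t *\<^sub>R ?u) q < \<epsilon>" using that u0 by (simp add: dist_norm pos_less_divide_eq)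
      then show ?thesis using loc by blast
    qed
    then show ?thesis using u \<epsilon>(1) u0 unfolding germs_def by (intro CollectI conjI exI[of _ "\<epsilon> / norm ?u"]) auto
  qed
  then have "?u = w \<or> ?u = - w" using w by blast
  then show "germs q = {?u, - ?u}" unfolding w by (auto simp: insert_commute)
qed

lemma edge_normal_germ:
  assumes M: "M q = {a, b, e}" and det: "det3 a b e = 1"
  shows "edge_normal a b \<in> germs q"
proof -
  let ?u = "edge_normal a b"
  obtain \<epsilon> where \<epsilon>: "\<epsilon> > 0" "\<And>x. dist x q < \<epsilon> \<Longrightarrow> x \<in> C \<longleftrightarrow> top_tied q (x - q)"
    by (rule curve_near) blast
  have u: "?u \<in> Collect primitive" using primitive_edge_normal[of a b e] det by simp
  have u0: "norm ?u > 0" using u zero_notin_P by auto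
  have ab: "a \<noteq> b" using det by (auto simp: det3_def)
  have e: "lattice_point e \<bullet> ?u = lattice_point a \<bullet> ?u - 1" using inner_edge_normal[of e a b] det by simp
  have b: "lattice_point b \<bullet> ?u = lattice_point a \<bullet> ?u" by (rule inner_edge_normal_same)
  have "q + t *\<^sub>R ?u \<in> C" if t: "0 < t" "t < \<epsilon> / norm ?u" for t
  proof -
    have "dist (q + t *\<^sub>R ?u) q < \<epsilon>" using t u0 by (simp add: dist_norm pos_less_divide_eq)
    moreover have "\<exists>a\<in>M q. \<exists>b\<in>M q. a \<noteq> b \<and>
       lattice_point a \<bullet> (q + t *\<^sub>R ?u - q) = lattice_point b \<bullet> (q + t *\<^sub>R ?u - q) \<and>
       (\<forall>e\<in>M q. lattice_point e \<bullet> (q + t *\<^sub>R ?u - q) \<le> lattice_point a \<bullet> (q + t *\<^sub>R ?u - q))"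
      unfolding M using ab t(1)
      by (intro bexI[of _ a] bexI[of _ b]) (simp_all add: b e mult_left_mono)
    ultimately show ?thesis using \<epsilon>(2) by blast
  qed
  then show ?thesis using u \<epsilon>(1) u0 unfolding germs_def by (intro CollectI conjI exI[of _ "\<epsilon> / norm ?u"]) auto
qed

lemma direction_edge_normal:
  assumes det: "det3 a b e = 1" and u: "primitive u" "lattice_point a \<bullet> u = lattice_point b \<bullet> u"
    "lattice_point e \<bullet> u \<le> lattice_point a \<bullet> u"
  shows "u = edge_normal a b"
proof -
  have ab: "a \<noteq> b" using det by (auto simp: det3_def)
  obtain t where t: "u = t *\<^sub>R edge_normal a b" using orthogonal_edge_normal[OF ab u(2)] by blast
  have "primitive (edge_normal a b)" using primitive_edge_normal[of a b e] det by simp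
  then have t1: "t = 1 \<or> t = -1" using primitive_parallel u(1) t by blast
  have "lattice_point e \<bullet> edge_normal a b = lattice_point a \<bullet> edge_normal a b - 1"
    using inner_edge_normal[of e a b] det by simp
  then have "t \<noteq> -1" using u(3) unfolding t by auto
  then show ?thesis using t1 t by simp
qed

text \<open>
  The three outer normals of a triangle, scaled to the lengths of the sides, add up to zero. This is
  the balancing condition, the origin of harmonicity.
\<close>

lemma germs_vertex:
  assumes M: "M q = {a, b, e}" and det: "det3 a b e = 1"
  shows "germs q = {edge_normal a b, edge_normal b e, edge_normal e a}"
proof -
  have M': "M q = {b, e, a}" "M q = {e, a, b}" using M by (simp_all add: insert_commute)
  have det': "det3 b e a = 1" "det3 e a b = 1" using det det3_cycle by metis+
  have "{edge_normal a b, edge_normal b e, edge_normal e a} \<subseteq> germs q"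
    using edge_normal_germ[OF M det] edge_normal_germ[OF M'(1) det'(1)] edge_normal_germ[OF M'(2) det'(2)] by blast
  moreover have "u \<in> {edge_normal a b, edge_normal b e, edge_normal e a}" if u: "u \<in> germs q" for u
  proof -
    obtain \<epsilon> where \<epsilon>: "\<epsilon> > 0" "\<And>x. dist x q < \<epsilon> \<Longrightarrow> x \<in> C \<longleftrightarrow> top_tied q (x - q)"
      by (rule curve_near) blast
    obtain \<delta> where \<delta>: "\<delta> > 0" "\<And>t. 0 < t \<Longrightarrow> t < \<delta> \<Longrightarrow> q + t *\<^sub>R u \<in> C" and prim: "primitive u"
      using u unfolding germs_def by blast
    have u0: "norm u > 0" using prim primitive_nonzero by auto
    have "0 < \<epsilon> / norm u" using \<epsilon>(1) u0 by simp
    then obtain t where t: "0 < t" "t < \<delta>" "t < \<epsilon> / norm u"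
      using field_lbound_gt_zero[OF \<delta>(1)] by blast
    have near: "dist (q + t *\<^sub>R u) q < \<epsilon>" using t u0 by (simp add: dist_norm pos_less_divide_eq)
    obtain i j where ij: "i \<in> M q" "j \<in> M q" "i \<noteq> j"
        "lattice_point i \<bullet> (q + t *\<^sub>R u - q) = lattice_point j \<bullet> (q + t *\<^sub>R u - q)"
        "\<forall>e\<in>M q. lattice_point e \<bullet> (q + t *\<^sub>R u - q) \<le> lattice_point i \<bullet> (q + t *\<^sub>R u - q)"
      using \<epsilon>(2)[OF near] \<delta>(2)[OF t(1,2)] by blast
    have tie: "lattice_point i \<bullet> u = lattice_point j \<bullet> u" using ij(4) t(1) by simp
    have le: "lattice_point x \<bullet> u \<le> lattice_point i \<bullet> u" if "x \<in> {a, b, e}" for x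
    proof -
      have "lattice_point x \<bullet> (q + t *\<^sub>R u - q) \<le> lattice_point i \<bullet> (q + t *\<^sub>R u - q)"
        using ij(5) that unfolding M by blast
      then show ?thesis using t(1) by simp
    qed
    have "{i, j} = {a, b} \<or> {i, j} = {b, e} \<or> {i, j} = {e, a}" using ij(1-3) unfolding M by blast
    then consider "lattice_point a \<bullet> u = lattice_point b \<bullet> u" "lattice_point e \<bullet> u \<le> lattice_point a \<bullet> u"
      | "lattice_point b \<bullet> u = lattice_point e \<bullet> u" "lattice_point a \<bullet> u \<le> lattice_point b \<bullet> u"
      | "lattice_point e \<bullet> u = lattice_point a \<bullet> u" "lattice_point b \<bullet> u \<le> lattice_point e \<bullet> u"
      using tie le[of a] le[of b] le[of e] unfolding doubleton_eq_iff by (elim disjE) simp_all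
    then show ?thesis
      using direction_edge_normal[OF det prim] direction_edge_normal[OF det'(1) prim]
        direction_edge_normal[OF det'(2) prim] by cases auto
  qed
  ultimately show ?thesis by blast
qed

definition trivalent :: "(real ^ 2) set" where
  "trivalent = {p. \<exists>a b e. M p = {a, b, e} \<and> det3 a b e = 1}"

text \<open>
  All trivalent points, and the points over \<open>Y\<close> on edges that are not horizontal (an edge dual to
  \<open>a b\<close> is horizontal if \<open>fst a = fst b\<close>). Points on horizontal edges must be left out: at such a
  vertex all edges would be contracted by the projection.
\<close>

definition cover_vertices :: "real set \<Rightarrow> (real ^ 2) set" where
  "cover_vertices Y = trivalent \<union> {p. p $ 2 \<in> Y \<and> (\<exists>a b e. M p = {a, b} \<and> fst a \<noteq> fst b \<and> \<bar>det3 a b e\<bar> = 1)}"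

lemma trivalentI:
  assumes "M p = {a, b, e}" "\<bar>det3 a b e\<bar> = 1" shows "p \<in> trivalent"
proof -
  have "det3 a b e = 1 \<or> det3 b a e = 1" using assms(2) det3_swap[of b a e] by linarith
  moreover have "M p = {b, a, e}" using assms(1) by (simp add: insert_commute)
  ultimately show ?thesis unfolding trivalent_def using assms(1) by blast
qed

text \<open>
  A point at which three terms with affinely independent exponents tie is determined by these
  terms, and there are finitely many sets of terms.
\<close>

lemma finite_trivalent: "finite trivalent"
proof -
  have "inj_on M trivalent"
  proof (rule inj_onI)
    fix p p' assume p: "p \<in> trivalent" "M p = M p'"
    then obtain a b e where M: "M p = {a, b, e}" "M p' = {a, b, e}" and det: "det3 a b e = 1"
      unfolding trivalent_def by blast
    have tie: "lattice_point x \<bullet> (p' - p) = lattice_point y \<bullet> (p' - p)" if "x \<in> {a, b, e}" "y \<in> {a, b, e}" for x y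
      using M_tie[of x p y] M_tie[of x p' y] trop_term_diff[of p' x p] trop_term_diff[of p' y p] that M by simp
    have "p' - p = 0" by (rule det3_orthogonal[of a b e]) (use det tie in auto)
    then show "p = p'" by simp
  qed
  moreover have "M ` trivalent \<subseteq> Pow A" using M_facts(1) by blast
  ultimately show ?thesis using finite_A by (meson finite_Pow_iff finite_imageD finite_subset)
qed

lemma finite_cover_vertices:
  assumes "finite Y" shows "finite (cover_vertices Y)"
proof -
  let ?E = "{p. p $ 2 \<in> Y \<and> (\<exists>a b e. M p = {a, b} \<and> fst a \<noteq> fst b \<and> \<bar>det3 a b e\<bar> = 1)}"
  have "inj_on (\<lambda>p. (p $ 2, M p)) ?E"
  proof (rule inj_onI)
    fix p p' assume p: "p \<in> ?E" "(p $ 2, M p) = (p' $ 2, M p')"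
    then obtain a b where M: "M p = {a, b}" "M p' = {a, b}" and ab: "fst a \<noteq> fst b" and y: "p $ 2 = p' $ 2"
      by auto
    have "lattice_point a \<bullet> (p' - p) = lattice_point b \<bullet> (p' - p)"
      using M_tie[of a p b] M_tie[of a p' b] trop_term_diff[of p' a p] trop_term_diff[of p' b p] M by simp
    then have "p $ 1 = p' $ 1" using ab y by (simp add: inner_real2)
    then show "p = p'" using y by (simp add: real2_eq_iff)
  qed
  moreover have "(\<lambda>p. (p $ 2, M p)) ` ?E \<subseteq> Y \<times> Pow A" using M_facts(1) by blast
  ultimately have "finite ?E"
    using assms finite_A by (meson finite_Pow_iff finite_SigmaI finite_imageD finite_subset)
  then show ?thesis unfolding cover_vertices_def using finite_trivalent by blast
qed

lemma finite_germs:
  assumes "p \<in> C" shows "finite (germs p)"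
  using assms
proof (cases rule: curve_cases)
  case (vertex a b e)
  show ?thesis unfolding germs_vertex[OF vertex] by simp
next
  case (edge a b e t)
  show ?thesis unfolding edge_point(2)[OF edge(1,2,4)] by simp
qed

lemma cover_vertices_subset: "cover_vertices Y \<subseteq> C"
proof -
  have "p \<in> C" if "M p = {a, b, e}" "det3 a b e = 1" for p a b e
  proof -
    have "a \<noteq> b" using that(2) by (auto simp: det3_def)
    then show ?thesis using that(1) unfolding curve_iff by blast
  qed
  moreover have "p \<in> C" if "M p = {a, b}" "fst a \<noteq> fst b" for p a b
  proof -
    have "a \<noteq> b" using that(2) by blast
    then show ?thesis using that(1) unfolding curve_iff by blast
  qed
  ultimately show ?thesis unfolding cover_vertices_def trivalent_def by blast
qed

text \<open>
  In particular no edge extends to infinity in both directions, as \<open>vertex_set\<close> demands.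
\<close>

lemma line_through_germ_meets_trivalent:
  assumes "q \<in> C" "u \<in> germs q" shows "\<exists>t. q + t *\<^sub>R u \<in> trivalent"
  using assms(1)
proof (cases rule: curve_cases)
  case (vertex a b e)
  then have "q \<in> trivalent" unfolding trivalent_def by blast
  then have "q + 0 *\<^sub>R u \<in> trivalent" by simp
  then show ?thesis by blast
next
  case (edge a b e t)
  have "u = edge_normal a b \<or> u = - edge_normal a b" using assms(2) edge_point(2)[OF edge(1,2,4)] by blast
  moreover have "q + t *\<^sub>R edge_normal a b \<in> trivalent" using trivalentI edge(3,4) by blast
  then have "q + t *\<^sub>R edge_normal a b \<in> trivalent" "q + (- t) *\<^sub>R (- edge_normal a b) \<in> trivalent" by simp_all
  ultimately show ?thesis by blast
qed

lemma vertex_set_cover_vertices: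
  assumes Y: "finite Y" and C: "C \<noteq> {}"
  shows "vertex_set (cover_vertices Y)"
  unfolding vertex_set_def
proof (intro conjI ballI allI impI)
  show "finite (cover_vertices Y)" by (rule finite_cover_vertices[OF Y])
  show sub: "cover_vertices Y \<subseteq> C" by (rule cover_vertices_subset)
  have tri: "trivalent \<subseteq> cover_vertices Y" by (auto simp: cover_vertices_def)
  show lp: "line_point q" if q: "q \<in> C - cover_vertices Y" for q
  proof -
    have "q \<in> C" using q by blast
    then show ?thesis
    proof (cases rule: curve_cases)
      case (vertex a b e)
      then have "q \<in> trivalent" unfolding trivalent_def by blast
      then show ?thesis using q tri by blast
    next
      case (edge a b e t)
      show ?thesis by (rule edge_point(1)[OF edge(1,2,4)])
    qed
  qed
  show "finite (germs v)" if "v \<in> cover_vertices Y" for v using finite_germs that sub by blast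
  show "\<exists>t. q + t *\<^sub>R u \<notin> C - cover_vertices Y" if u: "u \<in> Collect primitive" for q u
  proof (rule ccontr)
    assume "\<not> ?thesis"
    then have all: "q + t *\<^sub>R u \<in> C - cover_vertices Y" for t by blast
    then have "q \<in> C" "u \<in> germs q" using all[of 0] u unfolding germs_def by (auto intro: exI[of _ 1])
    then show False using line_through_germ_meets_trivalent[of q u] all tri by blast
  qed
  obtain q where "q \<in> C" using C by blast
  moreover have "germs q \<noteq> {}"
    using \<open>q \<in> C\<close>
  proof (cases rule: curve_cases)
    case (vertex a b e)
    show ?thesis unfolding germs_vertex[OF vertex] by simp
  next
    case (edge a b e t)
    show ?thesis unfolding edge_point(2)[OF edge(1,2,4)] by simp
  qed
  ultimately show "cover_vertices Y \<noteq> {}" using line_through_germ_meets_trivalent tri by blast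
qed

end

section \<open>Curves of horizontal width 3\<close>

text \<open>
  The target of the projection is a straight curve, too, so that the construction of models applies
  to it.
\<close>

interpretation line: straight_curve "UNIV :: real set" "{1, -1}" "\<lambda>u. 0 < u"
  by standard auto

lemma line_germs [simp]: "line.germs y = {1, -1}"
  by (auto simp: line.germs_def intro: exI[of _ 1])

lemma line_vertex_set:
  assumes "finite Y" "Y \<noteq> {}"
  shows "line.vertex_set Y"
  unfolding line.vertex_set_def
proof (intro conjI allI impI ballI)
  show "line.line_point q" for q
    unfolding line.line_point_def
    by (intro bexI[of _ 1] exI[of _ 1] conjI allI impI iffI exI[of _ "_ - q"]) auto
  fix q u :: real assume u: "u \<in> {1, -1}"
  obtain y where "y \<in> Y" using assms by blast
  then have "q + ((y - q) * u) *\<^sub>R u \<notin> UNIV - Y" using u by auto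
  then show "\<exists>t. q + t *\<^sub>R u \<notin> UNIV - Y" by blast
qed (use assms in auto)

lemma real_line_model: "line.model {0} = real_line"
proof -
  have seg: "line.segment {0} p u l \<longleftrightarrow> p = 0 \<and> u \<in> {1, -1} \<and> l = \<infinity>" for p u l
  proof
    assume s: "line.segment {0} p u l"
    have "p = 0" using line.segment_start[OF s] by simp
    moreover have u: "u \<in> {1, -1}" using line.segment_direction[OF s] .
    moreover have "l = \<infinity>"
    proof (rule ccontr)
      assume "l \<noteq> \<infinity>"
      then obtain r where "l = ereal r" "0 < r" using line.segment_length[OF s] by (cases l) auto
      then show False using line.segment_end[OF s] \<open>p = 0\<close> u by auto
    qed
    ultimately show "p = 0 \<and> u \<in> {1, -1} \<and> l = \<infinity>" by simp
  next
    assume "p = 0 \<and> u \<in> {1, -1} \<and> l = \<infinity>"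
    then show "line.segment {0} p u l" by (auto simp: line.segment_def)
  qed
  have "line.segments {0} = {Edge \<infinity> (\<lambda>t. t), Edge \<infinity> (\<lambda>t. - t)}"
  proof (intro equalityI subsetI)
    fix e assume "e \<in> line.segments {0}"
    then obtain p u l where e: "e = Edge l (\<lambda>t. p + t *\<^sub>R u)" "line.segment {0} p u l"
      unfolding line.segments_def by blast
    from e(2) have "p = 0" "u = 1 \<or> u = - 1" "l = \<infinity>" unfolding seg by blast+
    then show "e \<in> {Edge \<infinity> (\<lambda>t. t), Edge \<infinity> (\<lambda>t. - t)}" unfolding e(1) by (elim disjE) simp_all
  next
    fix e :: "real edge" assume e: "e \<in> {Edge \<infinity> (\<lambda>t. t), Edge \<infinity> (\<lambda>t. - t)}"
    have 0: "line.vertex_set {0}" by (rule line_vertex_set) auto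
    have "Edge \<infinity> (\<lambda>t. 0 + t *\<^sub>R u) \<in> line.segments {0}" if "u = 1 \<or> u = - 1" for u
      by (rule line.segment_edge[OF 0]) (use that in \<open>auto simp: seg\<close>)
    from this[of 1] this[of "- 1"] show "e \<in> line.segments {0}" using e by auto
  qed
  then show ?thesis by (simp add: line.model_def real_line_def)
qed

lemma is_path_line_model:
  assumes "finite Y" "Y \<noteq> {}"
  shows "is_path (line.model Y)"
  unfolding is_path_def line.graph_topology_model[OF line_vertex_set[OF assms]]
  by (intro exI[of _ UNIV]) (auto simp: is_interval_univ homeomorphic_space_refl)

lemma same_metric_graph_real_line:
  assumes "finite Y" "Y \<noteq> {}"
  shows "same_metric_graph real_line (line.model Y)"
proof -
  have 0: "line.vertex_set {0}" by (rule line_vertex_set) auto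
  show ?thesis
    unfolding real_line_model[symmetric]
    by (rule line.same_metric_graph_model[OF line_vertex_set[OF assms] line.metric_graph_model[OF 0] line.points_model[OF 0]])
       (use line.segments_straight[OF 0] in auto)
qed

text \<open>
  The first coordinate of an exponent is the slope of its term along horizontal lines.
\<close>

locale trigonal_curve = smooth_plane_curve +
  assumes width: "a \<in> A \<Longrightarrow> fst a \<le> 3"
    and left_end: "\<exists>a\<in>A. fst a = 0" and right_end: "\<exists>a\<in>A. fst a = 3"
begin

lemma trop_term_line: "trop_term c (vector [x, y]) a = c a + real (snd a) * y + real (fst a) * x"
  by (simp add: trop_term_def inner_real2 vector_2)

text \<open>
  On a horizontal line, a term of larger slope dominates a term of smaller slope to the right of the
  point where the two agree.
\<close>

lemma crossing_order:
  fixes p p' :: "real ^ 2"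
  assumes "a \<in> M p" "fst a \<le> i" "b \<in> M p'" "i < fst b" "p $ 2 = p' $ 2"
  shows "p $ 1 \<le> p' $ 1"
proof -
  have "trop_term c p b \<le> trop_term c p a" "trop_term c p' a \<le> trop_term c p' b"
    using assms(1,3) by (simp_all add: maximal_terms_iff)
  then have "(real (fst b) - real (fst a)) * (p $ 1 - p' $ 1) \<le> 0"
    using assms(5) by (simp add: trop_term_def inner_real2 algebra_simps)
  moreover have "real (fst b) - real (fst a) > 0" using assms by simp
  ultimately show ?thesis by (simp add: mult_le_0_iff)
qed

text \<open>
  At \<open>p\<close> the slope of the tropical polynomial along the horizontal line jumps past \<open>i + 1/2\<close>. The number of
  such \<open>i < 3\<close> is the intersection multiplicity of the curve with the line at \<open>p\<close>.
\<close>

definition crosses :: "nat \<Rightarrow> real ^ 2 \<Rightarrow> bool" where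
  "crosses i p \<longleftrightarrow> (\<exists>a\<in>M p. fst a \<le> i) \<and> (\<exists>b\<in>M p. i < fst b)"

lemma crosses_unique:
  fixes p p' :: "real ^ 2"
  assumes "crosses i p" "crosses i p'" "p $ 2 = p' $ 2"
  shows "p = p'"
proof -
  obtain a b where "a \<in> M p" "fst a \<le> i" "b \<in> M p" "i < fst b" using assms(1) unfolding crosses_def by blast
  moreover obtain a' b' where "a' \<in> M p'" "fst a' \<le> i" "b' \<in> M p'" "i < fst b'"
    using assms(2) unfolding crosses_def by blast
  ultimately have "p $ 1 \<le> p' $ 1" "p' $ 1 \<le> p $ 1" using crossing_order assms(3) by metis+
  then show ?thesis using assms(3) by (simp add: real2_eq_iff)
qed

text \<open>
  Far to the left a term of slope 0 is maximal, far to the right a term of slope 3. The line is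
  covered by the closed sets where a term of slope at most \<open>i\<close> and where a term of larger slope is
  maximal, and by connectedness these sets meet.
\<close>

lemma crosses_exists:
  assumes i: "i < 3"
  obtains p :: "real ^ 2" where "crosses i p" "p $ 2 = y"
proof -
  define T where "T a x = trop_term c (vector [x, y]) a" for a x
  have T: "T a x = c a + real (snd a) * y + real (fst a) * x" for a x by (simp add: T_def trop_term_line)
  \<comment> \<open>\<open>L J\<close> is the set of \<open>x\<close> at which a term with slope in \<open>J\<close> is maximal.\<close>
  define L where "L J = (\<Union>a\<in>{a \<in> A. fst a \<in> J}. {x. \<forall>b\<in>A. T b x \<le> T a x})" for J
  have L: "x \<in> L J \<longleftrightarrow> (\<exists>a\<in>M (vector [x, y]). fst a \<in> J)" for x J
    unfolding L_def T_def Bex_def UN_iff mem_Collect_eq maximal_terms_iff by blast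
  have cl: "closed (L J)" for J
    unfolding L_def T Collect_ball_eq
    by (intro closed_UN closed_INT ballI closed_Collect_le continuous_intros) (use finite_A in auto)
  obtain a0 where a0: "a0 \<in> A" "fst a0 = 0" using left_end by blast
  obtain a3 where a3: "a3 \<in> A" "fst a3 = 3" using right_end by blast
  have low: "L {..i} \<noteq> {}"
  proof -
    have "\<forall>\<^sub>F x in at_bot. T b x < T a0 x" if "0 < fst b" for b
    proof -
      let ?K = "c a0 + real (snd a0) * y - c b - real (snd b) * y"
      have "T b x < T a0 x" if x: "x < min ?K 0" for x
      proof -
        have "real (fst b) * x \<le> 1 * x" using \<open>0 < fst b\<close> x by (intro mult_right_mono_neg) auto
        moreover have "T a0 x = c a0 + real (snd a0) * y" by (simp add: T a0(2))
        ultimately show ?thesis using x T[of b x] by linarith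
      qed
      then show ?thesis by (rule eventually_mono[OF eventually_gt_at_bot[of "min ?K 0"]])
    qed
    then have "\<forall>\<^sub>F x in at_bot. \<forall>b\<in>{b \<in> A. 0 < fst b}. T b x < T a0 x"
      using finite_A by (intro eventually_ball_finite) auto
    from eventually_happens'[OF trivial_limit_at_bot_linorder this]
    obtain x where x: "\<And>b. b \<in> A \<Longrightarrow> 0 < fst b \<Longrightarrow> T b x < T a0 x" by blast
    obtain a where a: "a \<in> M (vector [x, y])" using M_facts(3) by blast
    have "fst a = 0"
    proof (rule ccontr)
      assume "fst a \<noteq> 0"
      then have "T a x < T a0 x" using x a M_facts(1) by blast
      then show False using a a0(1) unfolding maximal_terms_iff T_def by (meson not_le)
    qed
    then have "x \<in> L {..i}" unfolding L by (intro bexI[OF _ a]) simp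
    then show ?thesis by blast
  qed
  have high: "L {i<..} \<noteq> {}"
  proof -
    have "\<forall>\<^sub>F x in at_top. T b x < T a3 x" if "fst b < 3" for b
    proof -
      let ?K = "c b + real (snd b) * y - c a3 - real (snd a3) * y"
      have "T b x < T a3 x" if x: "x > max ?K 0" for x
      proof -
        have "real (fst b) * x \<le> 2 * x" using \<open>fst b < 3\<close> x by (intro mult_right_mono) auto
        moreover have "T a3 x = c a3 + real (snd a3) * y + 3 * x" by (simp add: T a3(2))
        ultimately show ?thesis using x T[of b x] by linarith
      qed
      then show ?thesis by (rule eventually_mono[OF eventually_gt_at_top[of "max ?K 0"]])
    qed
    then have "\<forall>\<^sub>F x in at_top. \<forall>b\<in>{b \<in> A. fst b < 3}. T b x < T a3 x"
      using finite_A by (intro eventually_ball_finite) auto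
    from eventually_happens'[OF trivial_limit_at_top_linorder this]
    obtain x where x: "\<And>b. b \<in> A \<Longrightarrow> fst b < 3 \<Longrightarrow> T b x < T a3 x" by blast
    obtain a where a: "a \<in> M (vector [x, y])" using M_facts(3) by blast
    have "fst a = 3"
    proof (rule ccontr)
      assume "fst a \<noteq> 3"
      then have "fst a < 3" using width a M_facts(1) by fastforce
      then have "T a x < T a3 x" using x a M_facts(1) by blast
      then show False using a a3(1) unfolding maximal_terms_iff T_def by (meson not_le)
    qed
    then have "x \<in> L {i<..}" unfolding L using i by (intro bexI[OF _ a]) simp
    then show ?thesis by blast
  qed
  have "L {..i} \<union> L {i<..} = UNIV"
  proof -
    have "x \<in> L {..i} \<or> x \<in> L {i<..}" for x
    proof -
      obtain a where a: "a \<in> M (vector [x, y])" using M_facts(3) by blast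
      have "fst a \<in> {..i} \<or> fst a \<in> {i<..}" by auto
      then show ?thesis unfolding L using a by blast
    qed
    then show ?thesis by blast
  qed
  then have "L {..i} \<inter> L {i<..} \<noteq> {}"
    using connected_closedD[OF connected_UNIV, of "L {..i}" "L {i<..}"] cl low high by auto
  then obtain x where "x \<in> L {..i}" "x \<in> L {i<..}" by blast
  then have "crosses i (vector [x, y])" unfolding L crosses_def greaterThan_iff atMost_iff by blast
  then show thesis using that by (simp add: vector_2)
qed

text \<open>
  Double counting: each of the three values of \<open>i\<close> is crossed at exactly one point of the line.
\<close>

lemma sum_crossings:
  fixes X :: "(real ^ 2) set"
  assumes "finite X" and X: "\<And>p :: real ^ 2. p \<in> X \<longleftrightarrow> p $ 2 = y \<and> (\<exists>i<3. crosses i p)"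
  shows "(\<Sum>p\<in>X. card {i. i < 3 \<and> crosses i p}) = 3"
proof -
  have one: "card {p \<in> X. crosses i p} = 1" if i: "i < 3" for i
  proof -
    obtain p :: "real ^ 2" where p: "crosses i p" "p $ 2 = y" using crosses_exists[OF i] by blast
    have "{p \<in> X. crosses i p} = {p}"
    proof (intro equalityI subsetI)
      fix q assume "q \<in> {p \<in> X. crosses i p}"
      then have "crosses i q" "q $ 2 = y" using X by auto
      then show "q \<in> {p}" using crosses_unique[of i q p] p by simp
    qed (use X p i in auto)
    then show ?thesis by simp
  qed
  have "(\<Sum>p\<in>X. card {i \<in> {..<3}. crosses i p}) = 1 * card {..<3::nat}"
    using assms(1) one by (intro sum_multicount) auto
  then show ?thesis by simp
qed

lemma crosses_edge:
  assumes "M p = {a, b}" "fst a \<le> fst b"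
  shows "card {i. i < 3 \<and> crosses i p} = fst b - fst a"
proof -
  have "b \<in> A" using assms(1) M_facts(1)[of p] by blast
  then have "fst b \<le> 3" by (rule width)
  then have "{i. i < 3 \<and> crosses i p} = {fst a..<fst b}"
    unfolding crosses_def assms(1) using assms(2) by auto
  then show ?thesis by simp
qed

text \<open>
  The second coordinates of the directions at \<open>v\<close>; primitive vectors have integral coordinates, so
  the floor only changes the type. A multiset is used since different directions may have equal
  heights.
\<close>

definition heights :: "real ^ 2 \<Rightarrow> int multiset" where
  "heights v = image_mset (\<lambda>u :: real ^ 2. \<lfloor>u $ 2\<rfloor>) (mset_set (germs v))"

lemma heights_edge:
  assumes M: "M p = {a, b}" "a \<noteq> b" "\<bar>det3 a b e\<bar> = 1"
  shows "heights p = {#int (fst a) - int (fst b), int (fst b) - int (fst a)#}"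
proof -
  have u: "primitive (edge_normal a b)" by (rule primitive_edge_normal[OF M(3)])
  have "edge_normal a b \<noteq> - edge_normal a b"
  proof
    assume "edge_normal a b = - edge_normal a b"
    then have "edge_normal a b = 0" by (simp add: real2_eq_iff)
    then show False using u primitive_nonzero by simp
  qed
  moreover have "\<lfloor>real (fst a) - real (fst b)\<rfloor> = int (fst a) - int (fst b)"
      "\<lfloor>real (fst b) - real (fst a)\<rfloor> = int (fst b) - int (fst a)"
    by linarith+
  ultimately show ?thesis by (simp add: heights_def edge_point(2)[OF M])
qed

lemma heights_vertex:
  assumes M: "M p = {a, b, e}" "det3 a b e = 1"
  shows "heights p = {#int (fst a) - int (fst b), int (fst b) - int (fst e), int (fst e) - int (fst a)#}"
proof -
  have ne: "edge_normal a b \<noteq> edge_normal b e" if "det3 a b e = 1" for a b e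
  proof
    assume eq: "edge_normal a b = edge_normal b e"
    have "lattice_point e \<bullet> edge_normal a b = lattice_point b \<bullet> edge_normal a b"
      unfolding eq by (rule inner_edge_normal_same)
    also have "\<dots> = lattice_point a \<bullet> edge_normal a b" by (rule inner_edge_normal_same)
    finally show False using inner_edge_normal[of e a b] that by simp
  qed
  have "edge_normal a b \<noteq> edge_normal b e" "edge_normal b e \<noteq> edge_normal e a" "edge_normal e a \<noteq> edge_normal a b"
    using ne[of a b e] ne[of b e a] ne[of e a b] M(2) det3_cycle[of b e a] det3_cycle[of a b e] by simp_all
  moreover have "\<lfloor>real i - real j\<rfloor> = int i - int j" for i j
    by linarith
  ultimately show ?thesis by (simp add: heights_def germs_vertex[OF M])
qed

text \<open>
  This applies to the differences \<open>p\<close> and \<open>q\<close> of the first coordinates of two corners of a triangle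
  from that of the third.
\<close>

lemma small_coprime_triples:
  fixes p q :: int
  assumes "\<bar>p\<bar> \<le> 3" "\<bar>q\<bar> \<le> 3" "\<bar>p - q\<bar> \<le> 3" "coprime p q"
  shows "{#- p, p - q, q#} \<in> {{#1, - 1, 0#}, {#1, 1, - 2#}, {#- 1, - 1, 2#}, {#1, 2, - 3#}, {#- 1, - 2, 3#}}"
proof -
  have "p \<in> {-3, -2, -1, 0, 1, 2, 3}" "q \<in> {-3, -2, -1, 0, 1, 2, 3}" using assms(1,2) by auto
  then show ?thesis using assms(3,4) by (elim insertE emptyE; simp add: add_mset_commute)
qed

text \<open>
  The determinant 1 of the triangle is an integral combination of the differences of first
  coordinates, which are therefore coprime; the width bounds them by 3.
\<close>

lemma heights_cases:
  assumes v: "v \<in> cover_vertices Y"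
  shows "(\<exists>k\<in>{1, 2, 3}. heights v = {#k, - k#}) \<or>
    heights v \<in> {{#1, - 1, 0#}, {#1, 1, - 2#}, {#- 1, - 1, 2#}, {#1, 2, - 3#}, {#- 1, - 2, 3#}}"
  using v unfolding cover_vertices_def
proof
  assume "v \<in> trivalent"
  then obtain a b e where M: "M v = {a, b, e}" "det3 a b e = 1" unfolding trivalent_def by blast
  define p q where "p = int (fst b) - int (fst a)" and "q = int (fst e) - int (fst a)"
  have "fst a \<le> 3" "fst b \<le> 3" "fst e \<le> 3" using width M_facts(1)[of v] unfolding M(1) by blast+
  then have b: "\<bar>p\<bar> \<le> 3" "\<bar>q\<bar> \<le> 3" "\<bar>p - q\<bar> \<le> 3" unfolding p_def q_def by linarith+
  have "coprime p q"
  proof (rule coprimeI)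
    fix k assume k: "k dvd p" "k dvd q"
    have "k dvd p * (int (snd e) - int (snd a)) - q * (int (snd b) - int (snd a))"
      by (rule dvd_diff[OF dvd_mult2[OF k(1)] dvd_mult2[OF k(2)]])
    also have "\<dots> = det3 a b e" by (simp add: det3_def p_def q_def algebra_simps)
    finally show "is_unit k" unfolding M(2) .
  qed
  moreover have "heights v = {#- p, p - q, q#}" unfolding heights_vertex[OF M] by (simp add: p_def q_def)
  ultimately show ?thesis using small_coprime_triples[OF b] by simp
next
  assume "v \<in> {p :: real ^ 2. p $ 2 \<in> Y \<and> (\<exists>a b e. M p = {a, b} \<and> fst a \<noteq> fst b \<and> \<bar>det3 a b e\<bar> = 1)}"
  then obtain a b e where M: "M v = {a, b}" "fst a \<noteq> fst b" "\<bar>det3 a b e\<bar> = 1" by blast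
  then have h: "heights v = {#int (fst a) - int (fst b), int (fst b) - int (fst a)#}"
    by (intro heights_edge) auto
  have w: "fst a \<le> 3" "fst b \<le> 3" using width M_facts(1)[of v] unfolding M(1) by blast+
  define k where "k = \<bar>int (fst a) - int (fst b)\<bar>"
  have "k \<in> {1, 2, 3}" using w M(2) by (auto simp: k_def)
  moreover have "heights v = {#k, - k#}"
    unfolding h k_def by (cases "fst a \<le> fst b") (auto simp: add_mset_commute abs_if)
  ultimately show ?thesis by blast
qed

end

section \<open>The projection to the vertical coordinate\<close>

text \<open>
  \<open>Y\<close> is the set of vertices of the target; it contains the images of all trivalent points.
\<close>

locale trigonal_cover = trigonal_curve +
  fixes Y :: "real set"
  assumes finite_Y: "finite Y" and Y_nonempty: "Y \<noteq> {}"
    and trivalent_height: "p \<in> trivalent \<Longrightarrow> p $ 2 \<in> Y"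
    and curve_nonempty: "plane_tropical_curve A c \<noteq> {}"
begin

abbreviation S :: "(real ^ 2) set" where "S \<equiv> cover_vertices Y"
abbreviation G :: "(real ^ 2) mgraph" where "G \<equiv> model S"
abbreviation H :: "real mgraph" where "H \<equiv> line.model Y"
abbreviation f :: "real ^ 2 \<Rightarrow> real" where "f \<equiv> \<lambda>p. p $ 2"

lemma vertex_set_S: "vertex_set S"
  by (rule vertex_set_cover_vertices[OF finite_Y curve_nonempty])

lemma vertex_set_Y: "line.vertex_set Y"
  by (rule line_vertex_set[OF finite_Y Y_nonempty])

lemma S_height: "v \<in> S \<Longrightarrow> v $ 2 \<in> Y"
  using trivalent_height unfolding cover_vertices_def by blast

text \<open>
  The points of non-horizontal edges over \<open>Y\<close> are vertices by the choice of \<open>S\<close>, so an edge of the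
  source covers no vertex of the target with its interior.
\<close>

lemma interior_height:
  fixes q u :: "real ^ 2"
  assumes q: "q \<in> C - S" and u: "u \<in> germs q" "u $ 2 \<noteq> 0"
  shows "q $ 2 \<notin> Y"
proof
  assume qY: "q $ 2 \<in> Y"
  have "q \<in> C" using q by blast
  then show False
  proof (cases rule: curve_cases)
    case (vertex a b e)
    then have "q \<in> trivalent" unfolding trivalent_def by blast
    then show False using q unfolding cover_vertices_def by blast
  next
    case (edge a b e t)
    have "u = edge_normal a b \<or> u = - edge_normal a b" using u(1) edge_point(2)[OF edge(1,2,4)] by blast
    then have "fst a \<noteq> fst b" using u(2) by auto
    then have "q \<in> S" using qY edge(1,4) unfolding cover_vertices_def by blast
    then show False using q by blast
  qed
qed

definition slope :: "real ^ 2 \<Rightarrow> nat" where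
  "slope u = nat \<bar>\<lfloor>u $ 2\<rfloor>\<bar>"

lemma primitive_floor: "primitive (u :: real ^ 2) \<Longrightarrow> real_of_int \<lfloor>u $ 2\<rfloor> = (u $ 2 :: real)"
  using primitive_nth_int[of u] by auto

lemma real_slope:
  assumes "primitive (u :: real ^ 2)" shows "real (slope u) = \<bar>u $ 2\<bar>"
proof -
  have "real (slope u) = \<bar>real_of_int \<lfloor>u $ 2\<rfloor>\<bar>" by (simp add: slope_def)
  then show ?thesis unfolding primitive_floor[OF assms] .
qed

text \<open>
  The interior of a non-horizontal edge avoids \<open>Y\<close> under the projection and its ends are mapped to
  \<open>Y\<close>, so its image is exactly one edge of the target, stretched by the slope.
\<close>

lemma segment_projects:
  fixes v u :: "real ^ 2"
  assumes seg: "segment S v u l" and u: "u $ 2 \<noteq> (0 :: real)"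
  shows "line.segment Y (v $ 2) (sgn (u $ 2)) (ereal (real (slope u)) * l)"
proof -
  define k where "k = \<bar>u $ 2\<bar>"
  have k: "k > 0" "u $ 2 = k * sgn (u $ 2)" using u by (auto simp: k_def abs_mult_sgn mult.commute)
  have kk: "real (slope u) = k" using real_slope segment_direction[OF seg] by (simp add: k_def)
  have v: "v \<in> S" by (rule segment_start[OF seg])
  show ?thesis
    unfolding line.segment_def kk
  proof (intro conjI allI impI)
    show "v $ 2 \<in> Y" by (rule S_height[OF v])
    show "sgn (u $ 2) \<in> {1, - 1}" using u by (auto simp: sgn_if)
    show "0 < ereal k * l" using k(1) segment_length[OF seg] by (cases l) auto
    fix t assume t: "0 < t \<and> ereal t < ereal k * l"
    define s where "s = t / k"
    have s: "0 < s" "ereal s < l"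
      using t k(1) by (auto simp: s_def) (cases l; auto simp: pos_divide_less_eq mult.commute)
    have "- u \<in> germs (v + s *\<^sub>R u)" by (rule segment_backward_germ[OF seg s])
    then have "(v + s *\<^sub>R u) $ 2 \<notin> Y"
      by (rule interior_height[OF segment_inner[OF seg s]]) (use u in simp)
    moreover have "(v + s *\<^sub>R u) $ 2 = v $ 2 + t * sgn (u $ 2)"
    proof -
      have "s * u $ 2 = s * k * sgn (u $ 2)" using k(2) by (simp add: mult.assoc)
      then show ?thesis using k(1) by (simp add: s_def)
    qed
    ultimately show "v $ 2 + t *\<^sub>R sgn (u $ 2) \<in> UNIV - Y" by simp
  next
    assume "ereal k * l < \<infinity>"
    then obtain r where r: "l = ereal r" using k(1) segment_length[OF seg] by (cases l) auto
    have "(v + r *\<^sub>R u) $ 2 \<in> Y" using segment_end[OF seg] r by (intro S_height) simp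
    moreover have "k * r * sgn (u $ 2) = r * u $ 2" using k(2) by (metis mult.assoc mult.commute)
    then have "v $ 2 + real_of_ereal (ereal k * l) *\<^sub>R sgn (u $ 2) = (v + r *\<^sub>R u) $ 2"
      by (simp only: r times_ereal.simps real_of_ereal.simps real_scaleR_def vector_add_component vector_scaleR_component)
    ultimately show "v $ 2 + real_of_ereal (ereal k * l) *\<^sub>R sgn (u $ 2) \<in> Y" by (simp only:)
  qed
qed

lemmas dedges_G = dedges_model[OF vertex_set_S]
lemmas dedges_H = line.dedges_model[OF vertex_set_Y]

lemma dedges_G_primitive: "d \<in> dedges G \<Longrightarrow> primitive (direction d)"
  using segment_direction[OF dedges_G(1)] by simp

lemma dilates_over:
  fixes d :: "(real ^ 2) edge \<times> bool"
  assumes d: "d \<in> dedges G" "direction d $ 2 \<noteq> (0 :: real)" and d': "d' \<in> dedges H"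
    "dpar d' 0 = dpar d 0 $ 2" "direction d' = sgn (direction d $ 2)"
  shows "dilates f (slope (direction d)) d d'"
  unfolding dilates_def
proof (intro conjI ballI)
  show "len (fst d') = ereal (real (slope (direction d))) * len (fst d)"
    using line.segment_length_unique[OF dedges_H(1)[OF d'(1)]] segment_projects[OF dedges_G(1)[OF d(1)] d(2)]
      d'(2,3) by simp
  fix t
  have "dpar d' (real (slope (direction d)) * t) = dpar d 0 $ 2 + \<bar>direction d $ 2\<bar> * t * sgn (direction d $ 2)"
    using dedges_H(2)[OF d'(1), of "real (slope (direction d)) * t"] d'(2,3) real_slope[OF dedges_G_primitive[OF d(1)]]
    by simp
  also have "\<dots> = (dpar d 0 + t *\<^sub>R direction d) $ 2"
    by (simp add: mult_sgn_abs sgn_if)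
  also have "\<dots> = dpar d t $ 2" using dedges_G(2)[OF d(1), of t] by simp
  finally show "dpar d t $ 2 = dpar d' (real (slope (direction d)) * t)" by simp
qed

lemma outgoing_H:
  assumes "y \<in> Y"
  obtains d1 d2 where "outgoing H y = {d1, d2}" "direction d1 = 1" "direction d2 = -1"
proof -
  have b: "bij_betw direction (outgoing H y) {1, -1}"
    using line.bij_betw_outgoing_germs[OF vertex_set_Y assms] by simp
  then have im: "direction ` outgoing H y = {1, -1}" and inj: "inj_on direction (outgoing H y)"
    by (simp_all add: bij_betw_def)
  have "1 \<in> direction ` outgoing H y" "-1 \<in> direction ` outgoing H y" unfolding im by simp_all
  then obtain d1 d2 where d: "d1 \<in> outgoing H y" "direction d1 = 1" "d2 \<in> outgoing H y" "direction d2 = -1"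
    unfolding image_iff by metis
  have "outgoing H y = {d1, d2}"
  proof (intro equalityI subsetI)
    fix d assume dy: "d \<in> outgoing H y"
    then have "direction d = 1 \<or> direction d = -1" using im by blast
    then have "direction d = direction d1 \<or> direction d = direction d2" using d by simp
    then show "d \<in> {d1, d2}" using inj_onD[OF inj _ dy] d by blast
  qed (use d in blast)
  then show thesis using that d by blast
qed

lemma dilates_lift:
  fixes d :: "(real ^ 2) edge \<times> bool"
  assumes d: "d \<in> dedges G" "direction d $ 2 \<noteq> (0 :: real)"
  shows "\<exists>d'\<in>dedges H. dilates f (slope (direction d)) d d'"
proof -
  have y: "dpar d 0 $ 2 \<in> Y" using S_height segment_start[OF dedges_G(1)[OF d(1)]] by blast
  obtain d1 d2 where o: "outgoing H (dpar d 0 $ 2) = {d1, d2}" "direction d1 = 1" "direction d2 = -1"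
    by (rule outgoing_H[OF y])
  define d' where "d' = (if direction d $ 2 > 0 then d1 else d2)"
  have "d' \<in> outgoing H (dpar d 0 $ 2)" unfolding o d'_def by simp
  then have "d' \<in> dedges H" "dpar d' 0 = dpar d 0 $ 2" by (auto simp: outgoing_def)
  moreover have "direction d' = sgn (direction d $ 2)" using d(2) o(2,3) by (simp add: d'_def sgn_if)
  ultimately show ?thesis using dilates_over[OF d] by blast
qed

lemma edge_interior_point:
  assumes "d \<in> dedges G"
  obtains t where "0 < t" "ereal t < len (fst d)"
  using segment_length[OF dedges_G(1)[OF assms]] ereal_dense2[of 0 "len (fst d)"] by (metis ereal_less(2))

lemma dilates_direction:
  fixes d :: "(real ^ 2) edge \<times> bool"
  assumes d: "d \<in> dedges G" and d': "d' \<in> dedges H" and k: "dilates f k d d'"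
  shows "dpar d' 0 = dpar d 0 $ 2" and "direction d $ 2 = real k * direction d'"
proof -
  obtain t where t: "0 < t" "ereal t < len (fst d)" by (rule edge_interior_point[OF d])
  have eq: "dpar d s $ 2 = dpar d' (real k * s)" if "s \<in> edge_dom (fst d)" for s
    using k that by (simp add: dilates_def)
  have "0 \<le> len (fst d)" using segment_length[OF dedges_G(1)[OF d]] by simp
  then have "(0::real) \<in> edge_dom (fst d)" by (simp add: edge_dom_def zero_ereal_def[symmetric])
  from eq[OF this] show 0: "dpar d' 0 = dpar d 0 $ 2" by simp
  have "t \<in> edge_dom (fst d)" using t by (simp add: edge_dom_def less_imp_le)
  from eq[OF this] have "(dpar d 0 + t *\<^sub>R direction d) $ 2 = dpar d' 0 + (real k * t) *\<^sub>R direction d'"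
    using dedges_G(2)[OF d, of t] dedges_H(2)[OF d', of "real k * t"] by simp
  then show "direction d $ 2 = real k * direction d'" using 0 t by simp
qed

lemma direction_H: "d' \<in> dedges H \<Longrightarrow> direction d' = 1 \<or> direction d' = - 1"
  using line.segment_direction[OF dedges_H(1)] by blast

lemma contracted_iff:
  fixes d :: "(real ^ 2) edge \<times> bool"
  assumes d: "d \<in> dedges G"
  shows "contracted H f (fst d) \<longleftrightarrow> direction d $ 2 = (0 :: real)"
proof
  assume "contracted H f (fst d)"
  then obtain w where w: "\<And>x :: real ^ 2. x \<in> cell (fst d) \<Longrightarrow> x $ 2 = w" unfolding contracted_def by blast
  obtain t where t: "0 < t" "ereal t < len (fst d)" by (rule edge_interior_point[OF d])
  have "0 < t / 2" "ereal (t / 2) < ereal t" using t by simp_all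
  then have "0 < t / 2" "ereal (t / 2) < len (fst d)" using less_trans[OF _ t(2)] by blast+
  then have "dpar d t \<in> cell (fst d)" "dpar d (t / 2) \<in> cell (fst d)"
    using t unfolding dedges_G(3)[OF d] by blast+
  then have "dpar d t $ 2 = dpar d (t / 2) $ 2" using w by metis
  then show "direction d $ 2 = 0"
    using t(1) unfolding dedges_G(2)[OF d, of t] dedges_G(2)[OF d, of "t / 2"] by simp
next
  assume u: "direction d $ 2 = 0"
  have "dpar d 0 $ 2 \<in> Y" using S_height segment_start[OF dedges_G(1)[OF d]] by blast
  moreover have "x $ 2 = dpar d 0 $ 2" if "x \<in> cell (fst d)" for x :: "real ^ 2"
  proof -
    obtain t where "x = dpar d t" using \<open>x \<in> cell (fst d)\<close> unfolding dedges_G(3)[OF d] by blast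
    then show ?thesis using dedges_G(2)[OF d, of t] u by simp
  qed
  ultimately show "contracted H f (fst d)" unfolding contracted_def by auto
qed

text \<open>
  A factor of dilation is determined by the two directions, so the slope is the only candidate.
\<close>

lemma stretch_eq:
  fixes d :: "(real ^ 2) edge \<times> bool"
  assumes d: "d \<in> dedges G"
  shows "stretch H f (fst d) = slope (direction d)"
proof -
  define d1 where "d1 = (fst d, True)"
  have d1: "d1 \<in> dedges G" using d by (auto simp: d1_def dedges_def)
  have "direction d1 = direction d \<or> direction d1 = - direction d"
    using dedges_G(5)[OF d, of True] unfolding d1_def by presburger
  then have abs: "\<bar>direction d1 $ 2\<bar> = \<bar>direction d $ 2\<bar>" by auto
  have "real (slope (direction d1)) = real (slope (direction d))"
    using real_slope dedges_G_primitive d d1 abs by metis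
  then have s: "slope (direction d1) = slope (direction d)" by simp
  show ?thesis
  proof (cases "direction d $ 2 = 0")
    case True
    then show ?thesis using contracted_iff[OF d] by (simp add: stretch_def slope_def)
  next
    case False
    then have nz: "direction d1 $ 2 \<noteq> 0" using abs by auto
    have "(THE k. k > 0 \<and> (\<exists>d'\<in>dedges H. dilates f k d1 d')) = slope (direction d1)"
    proof (rule the_equality)
      have "real (slope (direction d1)) > 0" using real_slope[OF dedges_G_primitive[OF d1]] nz by simp
      then show "slope (direction d1) > 0 \<and> (\<exists>d'\<in>dedges H. dilates f (slope (direction d1)) d1 d')"
        using dilates_lift[OF d1 nz] by simp
      fix k assume "k > 0 \<and> (\<exists>d'\<in>dedges H. dilates f k d1 d')"
      then obtain d' where d': "d' \<in> dedges H" "dilates f k d1 d'" by blast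
      have "direction d1 $ 2 = real k * direction d'" by (rule dilates_direction(2)[OF d1 d'])
      then have "\<bar>direction d1 $ 2\<bar> = real k" using direction_H[OF d'(1)] by auto
      then have "real k = real (slope (direction d1))" using real_slope[OF dedges_G_primitive[OF d1]] by simp
      then show "k = slope (direction d1)" by simp
    qed
    then show ?thesis using contracted_iff[OF d] False s by (simp add: stretch_def d1_def)
  qed
qed

lemma outgoing_over_eq:
  fixes v :: "real ^ 2"
  assumes d': "d' \<in> outgoing H (v $ 2)"
  shows "outgoing_over G f v d' = {d \<in> outgoing G v. 0 < direction d $ 2 * direction d'}"
proof (intro equalityI subsetI)
  have dH: "d' \<in> dedges H" "dpar d' 0 = v $ 2" using d' by (auto simp: outgoing_def)
  fix d :: "(real ^ 2) edge \<times> bool"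
  {
    assume "d \<in> outgoing_over G f v d'"
    then obtain k where k: "d \<in> outgoing G v" "k > 0" "dilates f k d d'" by (auto simp: outgoing_over_def)
    then have "d \<in> dedges G" by (simp add: outgoing_def)
    then have "direction d $ 2 = real k * direction d'" by (rule dilates_direction(2)[OF _ dH(1) k(3)])
    then have "0 < direction d $ 2 * direction d'" using k(2) direction_H[OF dH(1)] by auto
    then show "d \<in> {d \<in> outgoing G v. 0 < direction d $ 2 * direction d'}" using k(1) by blast
  }
  {
    assume "d \<in> {d \<in> outgoing G v. 0 < direction d $ 2 * direction d'}"
    then have d: "d \<in> dedges G" "dpar d 0 = v" "0 < direction d $ 2 * direction d'" "d \<in> outgoing G v"
      by (auto simp: outgoing_def)
    have nz: "direction d $ 2 \<noteq> 0" using d(3) by auto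
    have "direction d' = sgn (direction d $ 2)"
      using d(3) direction_H[OF dH(1)] by (auto simp: sgn_if zero_less_mult_iff)
    then have "dilates f (slope (direction d)) d d'" using dilates_over[OF d(1) nz dH(1)] dH(2) d(2) by simp
    moreover have "real (slope (direction d)) > 0" using real_slope[OF dedges_G_primitive[OF d(1)]] nz by simp
    ultimately show "d \<in> outgoing_over G f v d'" using d(4) by (auto simp: outgoing_over_def)
  }
qed

lemma finite_outgoing: "finite (outgoing G v)"
proof -
  have "outgoing G v \<subseteq> segments S \<times> UNIV" by (auto simp: outgoing_def dedges_def)
  moreover have "finite (segments S)" using metric_graph_model[OF vertex_set_S] by (simp add: metric_graph_def)
  ultimately show ?thesis using finite_subset by fastforce
qed

lemma heights_outgoing:
  assumes "v \<in> S"
  shows "image_mset (\<lambda>d :: (real ^ 2) edge \<times> bool. \<lfloor>direction d $ 2\<rfloor>) (mset_set (outgoing G v)) = heights v"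
proof -
  have b: "bij_betw direction (outgoing G v) (germs v)" by (rule bij_betw_outgoing_germs[OF vertex_set_S assms])
  then have "image_mset direction (mset_set (outgoing G v)) = mset_set (germs v)"
    by (simp add: image_mset_mset_set bij_betw_def)
  then show ?thesis unfolding heights_def by (metis (no_types, lifting) image_mset.compositionality o_def image_mset_cong)
qed

lemma stretch_outgoing: "(d :: (real ^ 2) edge \<times> bool) \<in> outgoing G v \<Longrightarrow> stretch H f (fst d) = nat \<bar>\<lfloor>direction d $ 2\<rfloor>\<bar>"
  using stretch_eq[of d] by (simp add: outgoing_def slope_def)

text \<open>
  Sums and ramification profiles over edges at \<open>v\<close> depend on the multiset \<open>heights v\<close> alone, for which
  only finitely many values are possible.
\<close>

lemma mset_outgoing_stretch:
  fixes g :: "nat \<Rightarrow> 'b" and v :: "real ^ 2"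
  assumes v: "v \<in> S" and P: "\<And>d :: (real ^ 2) edge \<times> bool. d \<in> outgoing G v \<Longrightarrow> P d \<longleftrightarrow> Q \<lfloor>direction d $ 2 :: real\<rfloor>"
  shows "image_mset (\<lambda>d. g (stretch H f (fst d))) (mset_set {d \<in> outgoing G v. P d})
    = image_mset (\<lambda>x. g (nat \<bar>x\<bar>)) (filter_mset Q (heights v))"
proof -
  have "{d \<in> outgoing G v. P d} = {d \<in> outgoing G v. Q \<lfloor>direction d $ 2\<rfloor>}" using P by blast
  then have "image_mset (\<lambda>d. g (stretch H f (fst d))) (mset_set {d \<in> outgoing G v. P d})
      = image_mset (\<lambda>d. g (nat \<bar>\<lfloor>direction d $ 2\<rfloor>\<bar>)) (filter_mset (\<lambda>d. Q \<lfloor>direction d $ 2\<rfloor>) (mset_set (outgoing G v)))"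
    using finite_outgoing[of v] stretch_outgoing[of _ v] by (auto intro!: image_mset_cong)
  also have "\<dots> = image_mset (\<lambda>x. g (nat \<bar>x\<bar>)) (image_mset (\<lambda>d. \<lfloor>direction d $ 2\<rfloor>)
      (filter_mset (\<lambda>d. Q \<lfloor>direction d $ 2\<rfloor>) (mset_set (outgoing G v))))"
    by (simp add: multiset.map_comp o_def)
  also have "\<dots> = image_mset (\<lambda>x. g (nat \<bar>x\<bar>)) (filter_mset Q (heights v))"
    unfolding image_mset_filter_mset_swap[of "\<lambda>d. \<lfloor>direction d $ 2\<rfloor>" Q] heights_outgoing[OF v] ..
  finally show ?thesis .
qed

text \<open>
  For \<open>\<sigma> = 1\<close> and \<open>\<sigma> = -1\<close>, the ramification profile over the upper and over the lower edge of the target, from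
  the heights at a vertex over their common end.
\<close>

definition above :: "real \<Rightarrow> int multiset \<Rightarrow> nat multiset" where
  "above \<sigma> h = image_mset (\<lambda>x. nat \<bar>x\<bar>) (filter_mset (\<lambda>x. 0 < real_of_int x * \<sigma>) h)"

lemma profile_eq:
  fixes v :: "real ^ 2"
  assumes v: "v \<in> S" and d': "d' \<in> outgoing H (v $ 2)"
  shows "image_mset (\<lambda>d. stretch H f (fst d)) (mset_set (outgoing_over G f v d')) = above (direction d') (heights v)"
  unfolding outgoing_over_eq[OF d'] above_def
proof (rule mset_outgoing_stretch[OF v])
  fix d :: "(real ^ 2) edge \<times> bool"
  assume "d \<in> outgoing G v"
  then have "primitive (direction d)" using dedges_G_primitive by (simp add: outgoing_def)
  then show "0 < direction d $ 2 * direction d' \<longleftrightarrow> 0 < real_of_int \<lfloor>direction d $ 2\<rfloor> * direction d'"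
    by (simp only: primitive_floor)
qed

lemma sum_over_eq:
  fixes v :: "real ^ 2"
  assumes v: "v \<in> S" and d': "d' \<in> outgoing H (v $ 2)"
  shows "(\<Sum>d\<in>outgoing_over G f v d'. stretch H f (fst d)) = sum_mset (above (direction d') (heights v))"
  unfolding profile_eq[OF assms, symmetric] by (simp add: sum_unfold_sum_mset)

lemma sum_all_eq:
  fixes v :: "real ^ 2"
  assumes v: "v \<in> S"
  shows "(\<Sum>d\<in>outgoing G v. int (stretch H f (fst d)) - 1) = (\<Sum>x\<in>#heights v. \<bar>x\<bar> - 1)"
  using arg_cong[OF mset_outgoing_stretch[OF v, of "\<lambda>_. True" "\<lambda>_. True" "\<lambda>k. int k - 1"], of sum_mset]
  by (simp add: sum_unfold_sum_mset)

lemma sum_noncontracted_eq: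
  fixes v :: "real ^ 2"
  assumes v: "v \<in> S"
  shows "(\<Sum>d | d \<in> outgoing G v \<and> stretch H f (fst d) > 0. int (stretch H f (fst d)) - 1)
    = (\<Sum>x\<in>#filter_mset (\<lambda>x. x \<noteq> 0) (heights v). \<bar>x\<bar> - 1)"
proof -
  have P: "0 < stretch H f (fst d) \<longleftrightarrow> \<lfloor>direction d $ 2\<rfloor> \<noteq> 0" if "d \<in> outgoing G v" for d
    using stretch_outgoing[OF that] by simp
  show ?thesis
    unfolding sum_unfold_sum_mset
    using mset_outgoing_stretch[OF v, of "\<lambda>d. 0 < stretch H f (fst d)" "\<lambda>x. x \<noteq> 0" "\<lambda>k. int k - 1", OF P]
    by (simp del: stretch_outgoing)
qed

definition multiplicity :: "real ^ 2 \<Rightarrow> nat" where "multiplicity v = sum_mset (above 1 (heights v))"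

lemma heights_casesE:
  assumes "v \<in> S"
  obtains "heights v = {#1, - 1#}" | "heights v = {#2, - 2#}" | "heights v = {#3, - 3#}"
    | "heights v = {#1, - 1, 0#}" | "heights v = {#1, 1, - 2#}" | "heights v = {#- 1, - 1, 2#}"
    | "heights v = {#1, 2, - 3#}" | "heights v = {#- 1, - 2, 3#}"
  using heights_cases[OF assms] by auto

text \<open>
  Upper and lower edges carry the same total weight, since the heights at a vertex add up to 0. This
  is harmonicity.
\<close>

lemma multiplicity_below: "v \<in> S \<Longrightarrow> multiplicity v = sum_mset (above (-1) (heights v))"
  by (erule heights_casesE) (simp_all add: multiplicity_def above_def)

lemma multiplicity_pos: "v \<in> S \<Longrightarrow> multiplicity v > 0"
  by (erule heights_casesE) (simp_all add: multiplicity_def above_def)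

text \<open>
  Equality holds for the heights \<open>2, -2\<close> and \<open>3, -3\<close> as well as \<open>1, -1\<close>; in the trivalent cases the
  difference is 1.
\<close>

lemma riemann_hurwitz_heights:
  "v \<in> S \<Longrightarrow> 0 \<le> 2 * int (multiplicity v) - 2 - (\<Sum>x\<in>#heights v. \<bar>x\<bar> - 1)"
  by (erule heights_casesE) (simp_all add: multiplicity_def above_def)

text \<open>
  The sign \<open>\<sigma>\<close> accounts for the two orders in which the edges of the target may be listed. At a
  bivalent point the cover is totally ramified at both edges. At a trivalent point with three
  non-horizontal edges one further simple branch point remains, and where one edge is horizontal the
  cover has degree 1.
\<close>

lemma hurwitz_number_heights:
  assumes "v \<in> S" "\<sigma> = 1 \<or> \<sigma> = -1"
  shows "hurwitz_number 0 (multiplicity v) ([above \<sigma> (heights v), above (- \<sigma>) (heights v)] @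
    replicate (nat (2 * int (multiplicity v) - 2 - (\<Sum>x\<in>#filter_mset (\<lambda>x. x \<noteq> 0) (heights v). \<bar>x\<bar> - 1)))
      ({#2#} + replicate_mset (multiplicity v - 2) 1)) \<noteq> 0"
proof -
  note known = hurwitz_number_total_ramification[of 1] hurwitz_number_total_ramification[of 2]
    hurwitz_number_total_ramification[of 3] hurwitz_number_degree_2 hurwitz_number_degree_3
  from assms(2) show ?thesis
  proof
    assume "\<sigma> = 1"
    show ?thesis
      unfolding \<open>\<sigma> = 1\<close>
      by (rule heights_casesE[OF assms(1)]; insert known; simp add: multiplicity_def above_def add_mset_commute flip: numeral_2_eq_2 numeral_3_eq_3)
  next
    assume "\<sigma> = -1"
    show ?thesis
      unfolding \<open>\<sigma> = -1\<close>
      by (rule heights_casesE[OF assms(1)]; insert known; simp add: multiplicity_def above_def add_mset_commute flip: numeral_2_eq_2 numeral_3_eq_3)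
  qed
qed

lemma sum_over_multiplicity:
  fixes v :: "real ^ 2"
  assumes v: "v \<in> S" and d': "d' \<in> outgoing H (v $ 2)"
  shows "(\<Sum>d\<in>outgoing_over G f v d'. stretch H f (fst d)) = multiplicity v"
proof -
  have "d' \<in> dedges H" using d' by (simp add: outgoing_def)
  then have "direction d' = 1 \<or> direction d' = -1" by (rule direction_H)
  then show ?thesis
    unfolding sum_over_eq[OF assms] using multiplicity_below[OF v] multiplicity_def[of v] by auto
qed

lemma local_degree_eq:
  fixes v :: "real ^ 2"
  assumes v: "v \<in> S"
  shows "local_degree G H f v = multiplicity v"
proof -
  obtain d1 d2 where d: "outgoing H (v $ 2) = {d1, d2}" by (rule outgoing_H[OF S_height[OF v]])
  show ?thesis
    unfolding local_degree_def
  proof (rule the_equality)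
    show "\<forall>d'\<in>outgoing H (v $ 2). (\<Sum>d\<in>outgoing_over G f v d'. stretch H f (fst d)) = multiplicity v"
      using sum_over_multiplicity[OF v] by blast
    fix m assume m: "\<forall>d'\<in>outgoing H (v $ 2). (\<Sum>d\<in>outgoing_over G f v d'. stretch H f (fst d)) = m"
    have "d1 \<in> outgoing H (v $ 2)" using d by simp
    with m have "(\<Sum>d\<in>outgoing_over G f v d1. stretch H f (fst d)) = m" by (rule bspec)
    then show "m = multiplicity v" using sum_over_multiplicity[OF v \<open>d1 \<in> outgoing H (v $ 2)\<close>] by simp
  qed
qed

lemma dilates_cell:
  fixes d :: "(real ^ 2) edge \<times> bool"
  assumes d: "d \<in> dedges G" and d': "d' \<in> dedges H" and k: "k > 0" "dilates f k d d'"
  shows "f ` cell (fst d) = cell (fst d')"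
proof -
  have len: "len (fst d') = ereal (real k) * len (fst d)" using k(2) by (simp add: dilates_def)
  have l: "0 < len (fst d)" using segment_length[OF dedges_G(1)[OF d]] .
  have "f ` cell (fst d) = (\<lambda>t. dpar d' (real k * t)) ` {t. 0 < t \<and> ereal t < len (fst d)}"
    unfolding dedges_G(3)[OF d] image_image
    using k(2) by (intro image_cong) (auto simp: dilates_def edge_dom_def less_imp_le)
  also have "\<dots> = dpar d' ` ((\<lambda>t. real k * t) ` {t. 0 < t \<and> ereal t < len (fst d)})"
    by (simp add: image_image)
  also have "(\<lambda>t. real k * t) ` {t. 0 < t \<and> ereal t < len (fst d)} = {t. 0 < t \<and> ereal t < len (fst d')}"
  proof (intro equalityI subsetI)
    fix s assume "s \<in> (\<lambda>t. real k * t) ` {t. 0 < t \<and> ereal t < len (fst d)}"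
    then show "s \<in> {t. 0 < t \<and> ereal t < len (fst d')}"
      using k(1) l unfolding len by (cases "len (fst d)") auto
  next
    fix s assume "s \<in> {t. 0 < t \<and> ereal t < len (fst d')}"
    then have "0 < s / real k" "ereal (s / real k) < len (fst d)"
      using k(1) l unfolding len by (cases "len (fst d)"; simp add: pos_divide_less_eq mult.commute)+
    then show "s \<in> (\<lambda>t. real k * t) ` {t. 0 < t \<and> ereal t < len (fst d)}"
      using k(1) by (intro image_eqI[of _ _ "s / real k"]) auto
  qed
  finally show ?thesis unfolding line.dedges_model(3)[OF vertex_set_Y d'] .
qed

lemma cell_Y: "e' \<in> line.segments Y \<Longrightarrow> cell e' \<inter> Y = {}"
  using line.metric_graph_model[OF vertex_set_Y] by (simp add: metric_graph_def)

lemma cell_S: "e \<in> segments S \<Longrightarrow> cell e \<inter> S = {}"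
  using metric_graph_model[OF vertex_set_S] by (simp add: metric_graph_def)

lemma cell_C: "e \<in> segments S \<Longrightarrow> cell e \<subseteq> C"
  using points_model[OF vertex_set_S] unfolding points_def by auto

lemma cell_over:
  assumes e: "e \<in> segments S" "q \<in> cell e" and e': "e' \<in> line.segments Y" "f q \<in> cell e'"
  shows "f ` cell e = cell e'" and "direction (e, True) $ 2 \<noteq> 0"
proof -
  have d: "(e, True) \<in> dedges G" by (rule segments_dedges[OF vertex_set_S e(1)])
  show nz: "direction (e, True) $ 2 \<noteq> 0"
  proof
    assume "direction (e, True) $ 2 = 0"
    then have "contracted H f e" using contracted_iff[OF d] by simp
    then have "f q \<in> Y" using e(2) by (auto simp: contracted_def)
    then show False using cell_Y[OF e'(1)] e'(2) by blast
  qed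
  obtain d' where d': "d' \<in> dedges H" "dilates f (slope (direction (e, True))) (e, True) d'"
    using dilates_lift[OF d nz] by blast
  have "real (slope (direction (e, True))) > 0" using real_slope[OF dedges_G_primitive[OF d]] nz by simp
  then have im: "f ` cell e = cell (fst d')" using dilates_cell[OF d d'(1) _ d'(2)] by simp
  then have "f q \<in> cell (fst d')" using e(2) by blast
  moreover have "fst d' \<in> line.segments Y" using d'(1) by (auto simp: dedges_def)
  ultimately have "fst d' = e'" using line.segments_meet[OF vertex_set_Y _ e'(1)] e'(2) by blast
  then show "f ` cell e = cell e'" using im by simp
qed

lemma morphism_cover: "morphism G H f"
  unfolding morphism_def
proof (intro conjI ballI)
  show "metric_graph G" by (rule metric_graph_model[OF vertex_set_S])
  show "metric_graph H" by (rule line.metric_graph_model[OF vertex_set_Y])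
  have "continuous_on C f" by (intro continuous_intros)
  then show "continuous_map (graph_topology G) (graph_topology H) f"
    unfolding graph_topology_model[OF vertex_set_S] line.graph_topology_model[OF vertex_set_Y] by simp
  show "f ` verts G \<subseteq> verts H" using S_height by auto
  show "\<exists>F\<subseteq>edges G. {x \<in> points G. f x \<in> cell e'} = (\<Union>e\<in>F. cell e)" if "e' \<in> edges H" for e'
  proof -
    have e': "e' \<in> line.segments Y" using that by simp
    let ?F = "{e \<in> segments S. f ` cell e = cell e'}"
    have "{x \<in> points G. f x \<in> cell e'} = (\<Union>e\<in>?F. cell e)"
    proof (intro equalityI subsetI)
      fix x assume "x \<in> {x \<in> points G. f x \<in> cell e'}"
      then have x: "x \<in> points G" "f x \<in> cell e'" by auto
      have "x \<notin> S" using x(2) S_height cell_Y[OF e'] by blast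
      then obtain e where e: "e \<in> segments S" "x \<in> cell e" using x(1) by (auto simp: points_def)
      then show "x \<in> (\<Union>e\<in>?F. cell e)" using cell_over(1)[OF e e' x(2)] by blast
    next
      fix x assume "x \<in> (\<Union>e\<in>?F. cell e)"
      then obtain e where e: "e \<in> segments S" "f ` cell e = cell e'" "x \<in> cell e" by blast
      then have "f x \<in> cell e'" by blast
      moreover have "x \<in> points G" using e by (auto simp: points_def)
      ultimately show "x \<in> {x \<in> points G. f x \<in> cell e'}" by blast
    qed
    then show ?thesis by (intro exI[of _ ?F]) auto
  qed
  show "contracted H f e \<or> (\<exists>k>0. \<exists>d'\<in>dedges H. dilates f k (e, True) d')" if "e \<in> edges G" for e
  proof -
    have d: "(e, True) \<in> dedges G" using segments_dedges[OF vertex_set_S, of e] that by simp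
    show ?thesis
    proof (cases "direction (e, True) $ 2 = 0")
      case True
      then show ?thesis using contracted_iff[OF d] by simp
    next
      case False
      have "real (slope (direction (e, True))) > 0" using real_slope[OF dedges_G_primitive[OF d]] False by simp
      then show ?thesis using dilates_lift[OF d False] by auto
    qed
  qed
qed

text \<open>
  Off the vertices, the intersection multiplicity with the horizontal line is the stretching factor
  of the edge through the point.
\<close>

lemma crosses_slope:
  assumes p: "p \<in> C - S" and u: "u \<in> germs p"
  shows "card {i. i < 3 \<and> crosses i p} = slope u"
proof -
  have "p \<in> C" using p by blast
  then show ?thesis
  proof (cases rule: curve_cases)
    case (vertex a b e)
    then have "p \<in> trivalent" unfolding trivalent_def by blast
    then show ?thesis using p unfolding cover_vertices_def by blast
  next
    case (edge a b e t)
    have "u = edge_normal a b \<or> u = - edge_normal a b" using u edge_point(2)[OF edge(1,2,4)] by blast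
    then have "u $ 2 = real_of_int (int (fst a) - int (fst b)) \<or> u $ 2 = real_of_int (int (fst b) - int (fst a))" by auto
    then have "\<lfloor>u $ 2\<rfloor> = int (fst a) - int (fst b) \<or> \<lfloor>u $ 2\<rfloor> = int (fst b) - int (fst a)"
      by (metis floor_of_int)
    then have s: "slope u = nat \<bar>int (fst a) - int (fst b)\<bar>" by (auto simp: slope_def)
    have M': "M p = {b, a}" using edge(1) by (simp add: insert_commute)
    show ?thesis
    proof (cases "fst a \<le> fst b")
      case True
      then show ?thesis using crosses_edge[OF edge(1) True] s by simp
    next
      case False
      then show ?thesis using crosses_edge[OF M'] s by simp
    qed
  qed
qed

text \<open>
  The edges over an edge of the target correspond to the points of the curve at the height of one of its
  inner points, and their weights to the intersection multiplicities there.
\<close>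

lemma has_degree_cover: "has_degree G H f 3"
  unfolding has_degree_def
proof
  fix e' assume "e' \<in> edges H"
  then have e': "e' \<in> line.segments Y" by simp
  have d': "(e', True) \<in> dedges H" by (rule line.segments_dedges[OF vertex_set_Y e'])
  obtain t0 where "0 < t0" "ereal t0 < len e'"
    using line.segment_length[OF dedges_H(1)[OF d']] ereal_dense2[of 0 "len e'"] by (metis ereal_less(2) fst_conv)
  then obtain y where y: "y \<in> cell e'" by (auto simp: cell_def)
  have yY: "y \<notin> Y" using y cell_Y[OF e'] by blast
  define E where "E = {e \<in> segments S. f ` cell e = cell e'}"
  define X where "X = {p :: real ^ 2. p $ 2 = y \<and> (\<exists>i<3. crosses i p)}"
  define pt where "pt e = (SOME p. p \<in> cell e \<and> p $ 2 = y)" for e :: "(real ^ 2) edge"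
  have pt: "pt e \<in> cell e" "pt e $ 2 = y" if "e \<in> E" for e
  proof -
    have "y \<in> f ` cell e" using that y by (simp add: E_def)
    then have "\<exists>p. p \<in> cell e \<and> p $ 2 = y" by blast
    then have "pt e \<in> cell e \<and> pt e $ 2 = y" unfolding pt_def by (rule someI_ex)
    then show "pt e \<in> cell e" "pt e $ 2 = y" by simp_all
  qed
  have off: "p \<in> C - S" if "e \<in> segments S" "p \<in> cell e" for e p
    using that cell_S cell_C by blast
  have slope_pt: "stretch H f e = card {i. i < 3 \<and> crosses i p}" if e: "e \<in> segments S" "p \<in> cell e" for e p
  proof -
    have d: "(e, True) \<in> dedges G" by (rule segments_dedges[OF vertex_set_S e(1)])
    obtain t where t: "0 < t" "ereal t < len e" "p = dpar (e, True) t"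
      using e(2) dedges_G(3)[OF d] by auto
    have "p = dpar (e, True) 0 + t *\<^sub>R direction (e, True)" using t(3) dedges_G(2)[OF d, of t] by simp
    then have g: "- direction (e, True) \<in> germs p"
      using segment_backward_germ[OF dedges_G(1)[OF d], of t] t by simp
    then have "primitive (- direction (e, True))" unfolding germs_def by blast
    then have "real (slope (- direction (e, True))) = real (slope (direction (e, True)))"
      using real_slope dedges_G_primitive[OF d] by simp
    then have "slope (- direction (e, True)) = slope (direction (e, True))" by simp
    then show ?thesis using stretch_eq[OF d] crosses_slope[OF off[OF e] g] by simp
  qed
  have bij: "bij_betw pt E X"
    unfolding bij_betw_def
  proof
    show "inj_on pt E"
    proof (rule inj_onI)
      fix e1 e2 assume e: "e1 \<in> E" "e2 \<in> E" "pt e1 = pt e2"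
      then have "pt e1 \<in> cell e1" "pt e1 \<in> cell e2" using pt by metis+
      then show "e1 = e2" using segments_meet[OF vertex_set_S] e(1,2) unfolding E_def by blast
    qed
    show "pt ` E = X"
    proof (intro equalityI subsetI)
      fix p assume "p \<in> pt ` E"
      then obtain e where e: "e \<in> E" "p = pt e" by blast
      have eS: "e \<in> segments S" using e by (simp add: E_def)
      have pe: "p \<in> cell e" "p $ 2 = y" using pt[OF e(1)] e(2) by simp_all
      have d: "(e, True) \<in> dedges G" by (rule segments_dedges[OF vertex_set_S eS])
      have "direction (e, True) $ 2 \<noteq> 0" using cell_over(2)[OF eS pe(1) e'] pe(2) y by simp
      then have "real (slope (direction (e, True))) > 0" using real_slope[OF dedges_G_primitive[OF d]] by simp
      then have "card {i. i < 3 \<and> crosses i p} > 0" using slope_pt[OF eS pe(1)] stretch_eq[OF d] by simp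
      then have "{i. i < 3 \<and> crosses i p} \<noteq> {}" by (metis card.empty less_irrefl)
      then show "p \<in> X" using pe(2) unfolding X_def by blast
    next
      fix p assume "p \<in> X"
      then obtain i where p: "p $ 2 = y" "crosses i p" unfolding X_def by blast
      then have "\<exists>a\<in>M p. \<exists>b\<in>M p. a \<noteq> b" unfolding crosses_def by (metis not_le)
      then have "p \<in> C" by (simp add: curve_iff)
      moreover have "p \<notin> S" using S_height p(1) yY by blast
      ultimately obtain e where e: "e \<in> segments S" "p \<in> cell e"
        using points_model[OF vertex_set_S] unfolding points_def by auto
      have py: "f p \<in> cell e'" using p(1) y by simp
      have eE: "e \<in> E" using cell_over(1)[OF e e' py] e(1) by (simp add: E_def)
      have nz: "direction (e, True) $ 2 \<noteq> 0" by (rule cell_over(2)[OF e e' py])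
      have d: "(e, True) \<in> dedges G" by (rule segments_dedges[OF vertex_set_S e(1)])
      obtain t where t: "p = dpar (e, True) t" using e(2) dedges_G(3)[OF d] by auto
      obtain s where s: "pt e = dpar (e, True) s" using pt(1)[OF eE] dedges_G(3)[OF d] by auto
      have "(dpar (e, True) 0 + t *\<^sub>R direction (e, True)) $ 2 = (dpar (e, True) 0 + s *\<^sub>R direction (e, True)) $ 2"
        using dedges_G(2)[OF d, of t] dedges_G(2)[OF d, of s] t s p(1) pt(2)[OF eE] by metis
      then have "t = s" using nz by simp
      then have "p = pt e" using t s by simp
      then show "p \<in> pt ` E" using eE by blast
    qed
  qed
  have "finite E"
    using metric_graph_model[OF vertex_set_S] unfolding E_def by (simp add: metric_graph_def)
  then have finX: "finite X" using bij bij_betw_finite by blast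
  have "(\<Sum>e\<in>E. stretch H f e) = (\<Sum>e\<in>E. card {i. i < 3 \<and> crosses i (pt e)})"
    using slope_pt pt(1) by (intro sum.cong) (auto simp: E_def)
  also have "\<dots> = (\<Sum>p\<in>X. card {i. i < 3 \<and> crosses i p})"
    by (rule sum.reindex_bij_betw[OF bij])
  also have "\<dots> = 3" by (rule sum_crossings[OF finX]) (simp add: X_def)
  finally show "(\<Sum>e | e \<in> edges G \<and> f ` cell e = cell e'. stretch H f e) = 3" by (simp add: E_def)
qed

lemma well_contracted_cover_projection: "well_contracted_cover 3 G H f"
  unfolding well_contracted_cover_def tropical_cover_def harmonic_def nondegenerate_def
proof (intro conjI ballI impI)
  show "morphism G H f" by (rule morphism_cover)
  show "has_degree G H f 3" by (rule has_degree_cover)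
  show "is_path H" by (rule is_path_line_model[OF finite_Y Y_nonempty])
  show "\<exists>m. \<forall>d'\<in>outgoing H (f v). (\<Sum>d\<in>outgoing_over G f v d'. stretch H f (fst d)) = m" if "v \<in> verts G" for v
    using sum_over_multiplicity[of v] that by auto
  show "2 * int (local_degree G H f v) - 2 - (\<Sum>\<delta>\<in>outgoing G v. int (stretch H f (fst \<delta>)) - 1) \<ge> 0"
    if "v \<in> verts G" for v
    using riemann_hurwitz_heights[of v] that by (simp add: local_degree_eq sum_all_eq)
  show "\<exists>d\<in>outgoing G v. stretch H f (fst d) > 0" if "v \<in> verts G" for v
  proof -
    have v: "v \<in> S" using that by simp
    obtain d1 d2 where d: "outgoing H (v $ 2) = {d1, d2}" by (rule outgoing_H[OF S_height[OF v]])
    have "(\<Sum>d\<in>outgoing_over G f v d1. stretch H f (fst d)) \<noteq> 0"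
      using sum_over_multiplicity[OF v, of d1] multiplicity_pos[OF v] d by simp
    then obtain d where "d \<in> outgoing_over G f v d1" "stretch H f (fst d) \<noteq> 0"
      by (metis (no_types, lifting) sum.neutral)
    then show ?thesis by (auto simp: outgoing_over_def)
  qed
  show "\<not> contracted H f e" if "e \<in> edges G" "len e < \<infinity> \<and> par e 0 = par e (real_of_ereal (len e))" for e
  proof -
    have e: "e \<in> segments S" using that by simp
    have d: "(e, True) \<in> dedges G" by (rule segments_dedges[OF vertex_set_S e])
    have "0 < len e" using segment_length[OF dedges_G(1)[OF d]] by simp
    then have "real_of_ereal (len e) \<noteq> 0" using that(2) by (cases "len e") auto
    moreover have "direction (e, True) \<noteq> 0" using dedges_G_primitive[OF d] primitive_nonzero by metis
    moreover have "par e (real_of_ereal (len e)) = par e 0 + real_of_ereal (len e) *\<^sub>R direction (e, True)"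
      using dedges_G(2)[OF d, of "real_of_ereal (len e)"] by simp
    ultimately show ?thesis using that(2) by simp
  qed
qed

lemma realizable_projection: "realizable G H f"
  unfolding realizable_def
proof (intro ballI allI impI)
  fix v ds assume "v \<in> verts G" and ds: "distinct ds \<and> set ds = outgoing H (f v)"
  then have v: "v \<in> S" by simp
  obtain d1 d2 where d: "outgoing H (v $ 2) = {d1, d2}" "direction d1 = 1" "direction d2 = -1"
    by (rule outgoing_H[OF S_height[OF v]])
  have "d1 \<noteq> d2" using d(2,3) by auto
  have "length ds = 2" using ds d(1) \<open>d1 \<noteq> d2\<close> by (metis card_2_iff distinct_card)
  then obtain x y where xy: "ds = [x, y]" by (metis One_nat_def Suc_1 length_0_conv length_Suc_conv)
  then have "(x = d1 \<and> y = d2) \<or> (x = d2 \<and> y = d1)" using ds d(1) by (auto simp: doubleton_eq_iff)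
  then have dir: "direction y = - direction x" "direction x = 1 \<or> direction x = -1" using d(2,3) by auto
  have out: "x \<in> outgoing H (v $ 2)" "y \<in> outgoing H (v $ 2)" using ds xy by auto
  show "local_hurwitz_number G H f v ds \<noteq> 0"
    using hurwitz_number_heights[OF v dir(2)]
    by (simp add: local_hurwitz_number_def Let_def xy profile_eq[OF v out(1)] profile_eq[OF v out(2)] dir(1)
        local_degree_eq[OF v] sum_noncontracted_eq[OF v])
qed

end

lemma convex_hull_on_halfplane:
  fixes A :: "(nat \<times> nat) set"
  assumes "\<And>a. a \<in> A \<Longrightarrow> w \<bullet> lattice_point a \<le> k" "x \<in> newton_polygon A"
  shows "w \<bullet> x \<le> k"
proof -
  have "newton_polygon A \<subseteq> {x. w \<bullet> x \<le> k}"
    unfolding newton_polygon_def using assms(1) by (intro hull_minimal convex_halfspace_le) auto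
  then show ?thesis using assms(2) by blast
qed

text \<open>
  The exponents cannot all lie in a halfplane that misses a corner of their convex hull. Applied to
  the corners \<open>(0, 0)\<close> and \<open>(3, 0)\<close>, this gives exponents on the left and the right side.
\<close>

lemma trigonal_curve_hirzebruch:
  assumes "3 * n \<le> g + 2" "finite A" and P: "newton_polygon A = hirzebruch_polygon g n"
    and "unimodular_triangulation (dual_subdivision A c)"
  shows "trigonal_curve A c"
proof
  define h where "h = (real g + 3 * real n + 2) / 2"
  have h: "h > 0" by (simp add: h_def add_nonneg_pos)
  have corners: "vector [0, 0] \<in> newton_polygon A" "vector [0, h] \<in> newton_polygon A"
      "vector [3, 0] \<in> newton_polygon A"
    unfolding P hirzebruch_polygon_def h_def by (simp_all add: hull_inc)
  show "finite A" "unimodular_triangulation (dual_subdivision A c)" by fact+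
  show "\<exists>a\<in>A. lattice_point a \<bullet> w \<noteq> k" if "w \<noteq> 0" for w k
  proof (rule ccontr)
    assume "\<not> ?thesis"
    then have eq: "w \<bullet> lattice_point a = k" if "a \<in> A" for a using that by (simp add: inner_commute)
    have "w \<bullet> x = k" if "x \<in> newton_polygon A" for x
      using convex_hull_on_halfplane[of A w k x] convex_hull_on_halfplane[of A "- w" "- k" x] eq that by simp
    from this[OF corners(1)] this[OF corners(2)] this[OF corners(3)]
    have "k = 0" "w $ 2 * h = k" "w $ 1 * 3 = k" by (simp_all add: inner_real2 vector_2)
    then have "w = 0" using h by (simp add: real2_eq_iff)
    then show False using that by simp
  qed
  show "fst a \<le> 3" if "a \<in> A" for a
  proof -
    have "lattice_point a \<in> newton_polygon A" unfolding newton_polygon_def using that by (simp add: hull_inc)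
    moreover have "newton_polygon A \<subseteq> {x. vector [1, 0] \<bullet> x \<le> 3}"
      unfolding P hirzebruch_polygon_def
      by (intro hull_minimal convex_halfspace_le) (simp add: inner_real2 vector_2)
    ultimately have "vector [1, 0] \<bullet> lattice_point a \<le> 3" by blast
    then show ?thesis by (simp add: inner_real2 vector_2)
  qed
  show "\<exists>a\<in>A. fst a = 0"
  proof (rule ccontr)
    assume "\<not> ?thesis"
    then have "vector [-1, 0] \<bullet> lattice_point a \<le> -1" if "a \<in> A" for a
      using that by (force simp: inner_real2 vector_2)
    from convex_hull_on_halfplane[OF this corners(1)] show False by (simp add: inner_real2 vector_2)
  qed
  show "\<exists>a\<in>A. fst a = 3"
  proof (rule ccontr)
    assume no: "\<not> ?thesis"
    have "vector [1, 0] \<bullet> lattice_point a \<le> 2" if "a \<in> A" for a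
    proof -
      have "fst a \<le> 2" using no that \<open>\<And>a. a \<in> A \<Longrightarrow> fst a \<le> 3\<close>[OF that] by (metis le_antisym not_less_eq_eq numeral_2_eq_2 numeral_3_eq_3)
      then show ?thesis by (simp add: inner_real2 vector_2)
    qed
    from convex_hull_on_halfplane[OF this corners(3)] show False by (simp add: inner_real2 vector_2)
  qed
qed

theorem proposition1p1:
  fixes g n :: nat
    and A :: "(nat \<times> nat) set" and c :: "nat \<times> nat \<Rightarrow> real"
    and \<Gamma> :: "'a mgraph" and \<Gamma>' :: "(real ^ 2) mgraph"
  assumes "g mod 2 = n mod 2" and "3 * n \<le> g + 2"
    and "finite A" and "newton_polygon A = hirzebruch_polygon g n"
    and "unimodular_triangulation (dual_subdivision A c)"
    and "plane_curve_model (plane_tropical_curve A c) \<Gamma>'"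
    and "abstract_tropical_curve \<Gamma>"
    and "tropical_modification \<Gamma> \<Gamma>'"
  shows "\<exists>G H. same_metric_graph \<Gamma>' G \<and> same_metric_graph real_line H \<and>
    well_contracted_cover 3 G H (\<lambda>p. p $ 2) \<and> realizable G H (\<lambda>p. p $ 2)"
proof -
  interpret trigonal_curve A c by (rule trigonal_curve_hirzebruch[OF assms(2-5)])
  \<comment> \<open>The vertices of the target. Any further height may be added to those of the trivalent points; with 0 the set is visibly non-empty.\<close>
  define Y where "Y = insert 0 ((\<lambda>p. p $ 2) ` trivalent)"
  have X: "metric_graph \<Gamma>'" "points \<Gamma>' = C" "genus \<Gamma>' = (\<lambda>_. 0)"
    "\<And>e. e \<in> edges \<Gamma>' \<Longrightarrow> \<exists>p u. primitive u \<and> (\<forall>t\<in>edge_dom e. par e t = p + t *\<^sub>R u)"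
    using assms(6) unfolding plane_curve_model_def by blast+
  have "verts \<Gamma>' \<noteq> {}" using X(1) by (simp add: metric_graph_def)
  then have "C \<noteq> {}" unfolding X(2)[symmetric] points_def by blast
  then interpret trigonal_cover A c Y
    by unfold_locales (use finite_trivalent in \<open>auto simp: Y_def\<close>)
  have "same_metric_graph \<Gamma>' G"
    by (rule same_metric_graph_model[OF vertex_set_S X(1-3)]) (use X(4) in simp)
  moreover have "same_metric_graph real_line H"
    by (rule same_metric_graph_real_line[OF finite_Y Y_nonempty])
  ultimately show ?thesis
    using well_contracted_cover_projection realizable_projection by blast
qed

end
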